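(* Let $\Omega\subseteq\mathbf{R}^d$ be a closed convex set with $\mathcal{L}^d(\Omega)\ge1$. Suppose that $\mu,\nu\in\mathcal{P}_2(\Omega)$ are such that the set $\Pi(\mu,\nu)$ of transport plans is a singleton. Then $$W_2\big(\mathrm{P}^2_\Omega[\mu],\mathrm{P}^2_\Omega[\nu]\big)\le W_2(\mu,\nu).$$
   Context: $\mathcal{L}^d$ is Lebesgue measure. For a closed convex set $\Omega\subseteq\mathbf{R}^d$ and $p\ge1$, $\mathcal{P}_p(\Omega)$ is the set of Borel probability measures supported in $\Omega$ with finite $p$-th moment, $\Pi(\mu,\nu)$ is the set of all transport plans (couplings) of $\mu,\nu$, and $W_p^p(\mu,\nu)=\inf_{\gamma\in\Pi(\mu,\nu)}\int|x-y|^p\,\mathrm{d}\gamma$. Let $\mathcal{K}_p(\Omega)$ be the set of $\rho\in\mathcal{P}_p(\Omega)$ that are absolutely continuous with respect to Lebesgue measure with density satisfying $0\le\rho\le1$ a.e. For $p>1$ and $\mathcal{L}^d(\Omega)\ge1$, $\mathrm{P}^p_\Omega[\mu]$ denotes the metric projection of $\mu\in\mathcal{P}_p(\Omega)$ onto $\mathcal{K}_p(\Omega)$, i.e. the minimizer of $\rho\mapsto W_p^p(\rho,\mu)$ over $\rho\in\mathcal{K}_p(\Omega)$, which is known to exist and be unique. *)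

theory Defs
  imports "HOL-Probability.Probability"
begin

text \<open>Borel probability measures on the whole space are measures with \<open>sets \<mu> = sets borel\<close>.
  For closed \<open>\<Omega>\<close>, being supported in \<open>\<Omega>\<close> means that the complement of \<open>\<Omega>\<close> is a null set.\<close>

definition prob_measures_p :: "real \<Rightarrow> 'a::euclidean_space set \<Rightarrow> 'a measure set" where
  "prob_measures_p p \<Omega> = {\<mu>. sets \<mu> = sets borel \<and> prob_space \<mu> \<and> emeasure \<mu> (- \<Omega>) = 0 \<and>
     (\<integral>\<^sup>+ x. ennreal (norm x powr p) \<partial>\<mu>) < \<infinity>}"

definition transport_plans ::
    "'a::euclidean_space measure \<Rightarrow> 'a measure \<Rightarrow> ('a \<times> 'a) measure set" where
  "transport_plans \<mu> \<nu> = {\<gamma>. sets \<gamma> = sets borel \<and> prob_space \<gamma> \<and>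
     distr \<gamma> borel fst = \<mu> \<and> distr \<gamma> borel snd = \<nu>}"

definition wasserstein_pow ::
    "real \<Rightarrow> 'a::euclidean_space measure \<Rightarrow> 'a measure \<Rightarrow> ennreal" where
  "wasserstein_pow p \<mu> \<nu> =
     (INF \<gamma> \<in> transport_plans \<mu> \<nu>. \<integral>\<^sup>+ (x, y). ennreal (norm (x - y) powr p) \<partial>\<gamma>)"

text \<open>The \<open>p\<close>-th root; the case distinction is needed because \<open>enn2real \<infinity> = 0\<close>.\<close>

definition wasserstein ::
    "real \<Rightarrow> 'a::euclidean_space measure \<Rightarrow> 'a measure \<Rightarrow> ennreal" where
  "wasserstein p \<mu> \<nu> =
     (if wasserstein_pow p \<mu> \<nu> = \<infinity> then \<infinity>
      else ennreal (enn2real (wasserstein_pow p \<mu> \<nu>) powr (1 / p)))"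

definition bounded_density_measures :: "real \<Rightarrow> 'a::euclidean_space set \<Rightarrow> 'a measure set" where
  "bounded_density_measures p \<Omega> = {\<rho> \<in> prob_measures_p p \<Omega>.
     \<exists>f :: 'a \<Rightarrow> ennreal. f \<in> borel_measurable lborel \<and> (AE x in lborel. f x \<le> 1) \<and>
       \<rho> = density lborel f}"

text \<open>For \<open>p > 1\<close>, closed convex \<open>\<Omega>\<close> of Lebesgue measure at least \<open>1\<close> and
  \<open>\<mu> \<in> prob_measures_p p \<Omega>\<close>, the minimizer exists and is unique, so that the choice made by
  \<open>arg_min_on\<close> is immaterial. Outside of this range the value is arbitrary.\<close>

definition density_projection ::
    "real \<Rightarrow> 'a::euclidean_space set \<Rightarrow> 'a measure \<Rightarrow> 'a measure" where
  "density_projection p \<Omega> \<mu> =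
     arg_min_on (\<lambda>\<rho>. wasserstein_pow p \<rho> \<mu>) (bounded_density_measures p \<Omega>)"

end

theory Submission
  imports Defs
begin

text \<open>Let \<open>\<rho>\<close> and \<open>\<sigma>\<close> be the projections of \<open>\<mu>\<close> and \<open>\<nu>\<close>. There is a coupling \<open>(x, z)\<close> of \<open>\<rho>\<close> and
  \<open>\<sigma>\<close> all of whose interpolations \<open>(1 - t) x + t z\<close> have density at most \<open>1\<close>; it comes from the
  Hadwiger--Ohmann argument for the Brunn--Minkowski inequality, in which both measures are cut
  recursively by parallel hyperplanes into boxes of equal mass. Glue it to optimal couplings
  \<open>(x, y)\<close> of \<open>\<rho>, \<mu>\<close> and \<open>(z, w)\<close> of \<open>\<sigma>, \<nu>\<close>. Comparing \<open>\<rho>\<close> and \<open>\<sigma>\<close> with the interpolations for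
  small \<open>t\<close> gives \<open>E \<langle>x - y, z - x\<rangle> \<ge> 0\<close> and \<open>E \<langle>z - w, x - z\<rangle> \<ge> 0\<close>, whence
  \<open>E \<bar>x - z\<bar>\<^sup>2 \<le> E \<langle>x - z, y - w\<rangle>\<close> and so \<open>E \<bar>x - z\<bar>\<^sup>2 \<le> E \<bar>y - w\<bar>\<^sup>2\<close>. The pair \<open>(y, w)\<close> has the
  only transport plan of \<open>\<mu>\<close> and \<open>\<nu>\<close> as its law. Nearly optimal couplings and an approximate
  gluing suffice.\<close>

section \<open>Compactness of tight sequences of measures\<close>

text \<open>The competitors tested against \<open>\<rho>\<close> and \<open>\<sigma>\<close> must
  keep density at most 1, which fails along a general coupling of the two. An optimal coupling would
  do, at the price of a theory of optimal maps. Boxes of equal mass ask only for the inequality of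
  arithmetic and geometric means, and the coupling built from them may be far from optimal, because
  its cost merely bounds the distance of \<open>\<rho>\<close> and \<open>\<sigma>\<close> from
  above. The law of \<open>(y, w)\<close>, on the other hand, is dictated by the gluing, and its
  cost could exceed the infimum; uniqueness of the plan rules this out. Compactness enters twice.
  Boxes control the density only up to a small neighbourhood and a small mass, so the coupling is
  obtained as a weak limit. The projection is defined by a choice, so a minimizer has to be produced
  before anything can be said about it. In the final comparison the errors of gluing and of near
  optimality vanish first and the time \<open>t\<close> second, because the gain from interpolating
  is itself only of order \<open>t\<close>.\<close>

text \<open>At the first index \<open>i\<close> where the digits differ, the term has size
  \<open>1 / 3 ^ Suc i\<close>, while the tail is at most half of that. Leaving out the digit 2 is
  what keeps the tail this small, so nearby sums have equal leading digits, as in the Cantor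
  set.\<close>

lemma ternary_digits_eqI:
  fixes c d :: "nat \<Rightarrow> bool"
  assumes "\<bar>(\<Sum>j. of_bool (c j) / 3 ^ Suc j) - (\<Sum>j. of_bool (d j) / 3 ^ Suc j)\<bar> < (1 / 2 :: real) / 3 ^ Suc J"
    and "j \<le> J"
  shows "c j = d j"
proof (rule ccontr)
  assume ne: "c j \<noteq> d j"
  define i where "i = (LEAST j. c j \<noteq> d j)"
  have i: "c i \<noteq> d i" "i \<le> j" "\<And>k. k < i \<Longrightarrow> c k = d k"
    using LeastI[of "\<lambda>j. c j \<noteq> d j" j, OF ne] Least_le[of "\<lambda>j. c j \<noteq> d j" j, OF ne]
      not_less_Least[of _ "\<lambda>j. c j \<noteq> d j"]
    unfolding i_def by blast+
  define a :: "nat \<Rightarrow> real" where "a k = (of_bool (c k) - of_bool (d k)) / 3 ^ Suc k" for k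
  have geo: "(\<lambda>k. (1 / 3 :: real) ^ k / 3 ^ Suc (Suc i)) sums ((3 / 2) / 3 ^ Suc (Suc i))"
    using sums_divide[OF geometric_sums[of "1/3 :: real"], of "3 ^ Suc (Suc i)"] by simp
  have sm: "summable (\<lambda>k. of_bool (b k) / 3 ^ Suc k :: real)" for b :: "nat \<Rightarrow> bool"
    by (rule summable_comparison_test'[OF summable_geometric[of "1/3 :: real"], of 0])
      (auto simp: power_one_over field_simps)
  have a_sum: "suminf a = (\<Sum>k. of_bool (c k) / 3 ^ Suc k) - (\<Sum>k. of_bool (d k) / 3 ^ Suc k)"
    unfolding a_def diff_divide_distrib by (rule suminf_diff[OF sm sm, symmetric])
  have a_summable: "summable a"
    unfolding a_def diff_divide_distrib by (rule summable_diff[OF sm sm])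
  have split: "suminf a = (\<Sum>k. a (k + Suc i)) + a i"
    using suminf_split_initial_segment[OF a_summable, of "Suc i"] i(3) by (simp add: a_def)
  have "norm (a (k + Suc i)) \<le> (1 / 3) ^ k / 3 ^ Suc (Suc i)" for k
    by (auto simp: a_def power_add power_one_over)
  then have "norm (\<Sum>k. a (k + Suc i)) \<le> (3 / 2) / 3 ^ Suc (Suc i)"
    unfolding sums_unique[OF geo] by (rule norm_suminf_le[OF _ sums_summable[OF geo]])
  moreover have "\<bar>a i\<bar> = 1 / 3 ^ Suc i" using i(1) by (auto simp: a_def)
  ultimately have "\<bar>suminf a\<bar> \<ge> (1 / 2) / 3 ^ Suc i" unfolding split by auto
  moreover have "(1 / 2 :: real) / 3 ^ Suc J \<le> (1 / 2) / 3 ^ Suc i"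
    using i(2) assms(2) by (intro divide_left_mono power_increasing) auto
  ultimately show False using assms(1) unfolding a_sum by linarith
qed

text \<open>The bound 1/2 leaves a gap below the next integer, so the integer part of a code can be
  read off from any nearby code.\<close>

lemma ternary_sum_bounds:
  fixes c :: "nat \<Rightarrow> bool"
  shows "0 \<le> (\<Sum>j. of_bool (c j) / 3 ^ Suc j :: real)" "(\<Sum>j. of_bool (c j) / 3 ^ Suc j :: real) \<le> 1 / 2"
proof -
  have geo: "(\<lambda>k. (1 / 3 :: real) ^ k / 3) sums (1 / 2)"
    using sums_divide[OF geometric_sums[of "1/3 :: real"], of "3"] by simp
  have sm: "summable (\<lambda>k. of_bool (c k) / 3 ^ Suc k :: real)"
    by (rule summable_comparison_test'[OF summable_geometric[of "1/3 :: real"], of 0])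
      (auto simp: power_one_over field_simps)
  show "0 \<le> (\<Sum>j. of_bool (c j) / 3 ^ Suc j :: real)" by (rule suminf_nonneg[OF sm]) auto
  have "(\<Sum>j. of_bool (c j) / 3 ^ Suc j :: real) \<le> (\<Sum>k. (1 / 3 :: real) ^ k / 3)"
    by (rule suminf_le[OF _ sm sums_summable[OF geo]]) (auto simp: power_one_over)
  then show "(\<Sum>j. of_bool (c j) / 3 ^ Suc j :: real) \<le> 1 / 2" using sums_unique[OF geo] by simp
qed

text \<open>The floor of \<open>2 ^ Suc k * y\<close> is determined by its half, which is the
  preceding floor, and its parity, which is the next binary digit of \<open>y\<close>.\<close>

lemma floor_eq_of_parities:
  fixes y z :: real
  assumes "\<lfloor>y\<rfloor> = \<lfloor>z\<rfloor>" and "\<And>k. k < K \<Longrightarrow> odd \<lfloor>2 ^ Suc k * y\<rfloor> = odd \<lfloor>2 ^ Suc k * z\<rfloor>"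
  shows "\<lfloor>2 ^ K * y\<rfloor> = \<lfloor>2 ^ K * z\<rfloor>"
  using assms
proof (induction K)
  case (Suc K)
  then have IH: "\<lfloor>2 ^ K * y\<rfloor> = \<lfloor>2 ^ K * z\<rfloor>" by simp
  have half: "\<lfloor>2 ^ Suc K * x\<rfloor> div 2 = \<lfloor>2 ^ K * x\<rfloor>" for x :: real
    using floor_divide_real_eq_div[of 2 "2 ^ Suc K * x"] by simp
  have "odd \<lfloor>2 ^ Suc K * y\<rfloor> = odd \<lfloor>2 ^ Suc K * z\<rfloor>" using Suc.prems(2)[of K] by simp
  then have "\<lfloor>2 ^ Suc K * y\<rfloor> mod 2 = \<lfloor>2 ^ Suc K * z\<rfloor> mod 2" by presburger
  with IH half[of y] half[of z] show ?case by (metis div_mult_mod_eq)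
qed simp

text \<open>The integer part codes the floors of the coordinates of \<open>x\<close>; the ternary digits
  \<open>0\<close> and \<open>1\<close> of the fractional part are the binary digits of the coordinates.\<close>

definition real_code :: "'b::euclidean_space \<Rightarrow> real" where
  "real_code x = real (to_nat (map (\<lambda>b. \<lfloor>x \<bullet> b\<rfloor>) (SOME bs. set bs = Basis))) +
     (\<Sum>j. of_bool (odd \<lfloor>2 ^ Suc (fst (prod_decode j)) * (x \<bullet> from_nat_into Basis (snd (prod_decode j)))\<rfloor>) / 3 ^ Suc j)"

lemma set_Basis_list: "set (SOME bs. set bs = (Basis :: 'b::euclidean_space set)) = Basis"
  by (rule someI_ex) (rule finite_list[OF finite_Basis])

lemma borel_measurable_real_code [measurable]:
  "(real_code :: 'b::euclidean_space \<Rightarrow> real) \<in> borel_measurable borel"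
proof -
  define bs where "bs = (SOME bs. set bs = (Basis :: 'b set))"
  have "(\<lambda>x :: 'b. map (\<lambda>b. \<lfloor>x \<bullet> b\<rfloor>) bs) \<in> borel \<rightarrow>\<^sub>M count_space UNIV"
  proof (subst measurable_count_space_eq_countable; safe?)
    fix l :: "int list"
    have "(\<lambda>x :: 'b. map (\<lambda>b. \<lfloor>x \<bullet> b\<rfloor>) bs) -` {l} \<inter> space borel
      = {x. length bs = length l \<and> (\<forall>i \<in> {..<length bs}. \<lfloor>x \<bullet> (bs ! i)\<rfloor> = l ! i)}"
      by (auto simp: list_eq_iff_nth_eq)
    also have "\<dots> \<in> sets borel" by measurable
    finally show "(\<lambda>x :: 'b. map (\<lambda>b. \<lfloor>x \<bullet> b\<rfloor>) bs) -` {l} \<inter> space borel \<in> sets borel" .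
  qed auto
  note [measurable] = this
  have "(\<lambda>x :: 'b. real (to_nat (map (\<lambda>b. \<lfloor>x \<bullet> b\<rfloor>) bs))) \<in> borel_measurable borel"
    by measurable
  note [measurable] = this[unfolded bs_def]
  show ?thesis unfolding real_code_def[abs_def] by measurable
qed

lemma real_code_uniform_inverse:
  assumes "\<epsilon> > 0"
  obtains \<delta> where "\<delta> > 0" "\<And>x y :: 'b::euclidean_space. \<bar>real_code x - real_code y\<bar> < \<delta> \<Longrightarrow> dist x y < \<epsilon>"
proof -
  obtain K :: nat where K: "(1 / 2) ^ K < \<epsilon> / DIM('b)"
    using real_arch_pow_inv[of "\<epsilon> / DIM('b)" "1/2"] assms by auto
  \<comment> \<open>The largest position at which one of the first \<open>K\<close> binary digits of
    a coordinate is stored.\<close>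
  define J where "J = Max ((\<lambda>(k, b). prod_encode (k, to_nat_on (Basis :: 'b set) b)) ` ({..<K} \<times> Basis))"
  have J: "prod_encode (k, to_nat_on Basis b) \<le> J" if "k < K" "b \<in> (Basis :: 'b set)" for k b
    unfolding J_def using that by (intro Max_ge) force+
  show ?thesis
  proof (rule that[of "(1 / 2) / 3 ^ Suc J"])
    fix x y :: 'b
    define N where "N x = to_nat (map (\<lambda>b. \<lfloor>x \<bullet> b\<rfloor>) (SOME bs. set bs = (Basis :: 'b set)))" for x
    define c where "c x j = odd \<lfloor>2 ^ Suc (fst (prod_decode j)) * (x \<bullet> from_nat_into (Basis :: 'b set) (snd (prod_decode j)))\<rfloor>" for x j
    define s :: "'b \<Rightarrow> real" where "s x = (\<Sum>j. of_bool (c x j) / 3 ^ Suc j)" for x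
    have code: "real_code x = real (N x) + s x" for x
      by (simp add: real_code_def N_def s_def c_def)
    assume less: "\<bar>real_code x - real_code y\<bar> < (1 / 2) / 3 ^ Suc J"
    have "(1 / 2 :: real) / 3 ^ Suc J \<le> (1 / 2) / 1"
      by (rule divide_left_mono) (auto simp del: power_Suc)
    \<comment> \<open>The fractional parts differ by at most 1/2, so the integer parts differ by
      less than 1 and agree.\<close>
    then have "\<bar>real_code x - real_code y\<bar> < 1 / 2" using less by linarith
    moreover have "0 \<le> s x" "s x \<le> 1 / 2" "0 \<le> s y" "s y \<le> 1 / 2"
      unfolding s_def by (rule ternary_sum_bounds)+
    ultimately have "\<bar>real (N x) - real (N y)\<bar> < 1" unfolding code by linarith
    then have N: "N x = N y" by linarith
    then have fl: "\<lfloor>x \<bullet> b\<rfloor> = \<lfloor>y \<bullet> b\<rfloor>" if "b \<in> Basis" for b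
      using that set_Basis_list[where 'b='b] unfolding N_def by auto
    have "\<bar>s x - s y\<bar> < (1 / 2) / 3 ^ Suc J" using less N by (simp add: code)
    then have digits: "c x j = c y j" if "j \<le> J" for j
      using ternary_digits_eqI[of "c x" "c y" J j] that unfolding s_def by blast
    have "\<bar>(x - y) \<bullet> b\<bar> \<le> (1 / 2) ^ K" if b: "b \<in> Basis" for b
    proof -
      have "odd \<lfloor>2 ^ Suc k * (x \<bullet> b)\<rfloor> = odd \<lfloor>2 ^ Suc k * (y \<bullet> b)\<rfloor>" if "k < K" for k
        using digits[OF J[OF that b]] b by (simp add: c_def countable_finite del: power_Suc)
      then have "\<lfloor>2 ^ K * (x \<bullet> b)\<rfloor> = \<lfloor>2 ^ K * (y \<bullet> b)\<rfloor>"
        using floor_eq_of_parities[OF fl[OF b], of K] by blast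
      then have "\<bar>2 ^ K * (x \<bullet> b) - 2 ^ K * (y \<bullet> b)\<bar> \<le> 1" by linarith
      moreover have "\<bar>2 ^ K * (x \<bullet> b) - 2 ^ K * (y \<bullet> b)\<bar> = 2 ^ K * \<bar>(x - y) \<bullet> b\<bar>"
        by (simp add: inner_diff_left abs_mult flip: right_diff_distrib)
      ultimately show ?thesis by (simp add: power_one_over field_simps)
    qed
    then have "norm (x - y) \<le> (\<Sum>b\<in>(Basis :: 'b set). (1 / 2) ^ K)"
      by (intro order.trans[OF norm_le_l1 sum_mono])
    also have "\<dots> < \<epsilon>" using K by (simp add: field_simps)
    finally show "dist x y < \<epsilon>" by (simp add: dist_norm)
  qed simp
qed

text \<open>On a ball only finitely many lists of coordinate floors occur. This carries tightness
  over to the laws of the codes.\<close>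

lemma real_code_bounded_on_ball:
  obtains B where "B > 0" "\<And>x :: 'b::euclidean_space. norm x \<le> R \<Longrightarrow> 0 \<le> real_code x \<and> real_code x < B"
proof -
  define bs where "bs = (SOME bs. set bs = (Basis :: 'b set))"
  define L where "L = {l. set l \<subseteq> {\<lfloor>- R\<rfloor>..\<lfloor>R\<rfloor>} \<and> length l = length bs}"
  have "finite L" unfolding L_def by (intro finite_lists_length_eq) auto
  then have fin: "finite (to_nat ` L)" by simp
  show ?thesis
  proof (rule that[of "real (Max (insert 0 (to_nat ` L))) + 1"])
    fix x :: 'b assume R: "norm x \<le> R"
    have "\<lfloor>x \<bullet> b\<rfloor> \<in> {\<lfloor>- R\<rfloor>..\<lfloor>R\<rfloor>}" if "b \<in> Basis" for b
    proof -
      have "\<bar>x \<bullet> b\<bar> \<le> R" using Basis_le_norm[OF that, of x] R by linarith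
      then have "- R \<le> x \<bullet> b" "x \<bullet> b \<le> R" by linarith+
      then show ?thesis by (auto intro: floor_mono)
    qed
    then have "map (\<lambda>b. \<lfloor>x \<bullet> b\<rfloor>) bs \<in> L"
      using set_Basis_list[where 'b='b] unfolding L_def bs_def by auto
    then have "to_nat (map (\<lambda>b. \<lfloor>x \<bullet> b\<rfloor>) bs) \<le> Max (insert 0 (to_nat ` L))"
      using fin by (intro Max_ge) auto
    moreover have "0 \<le> real_code x - real (to_nat (map (\<lambda>b. \<lfloor>x \<bullet> b\<rfloor>) bs))"
      "real_code x - real (to_nat (map (\<lambda>b. \<lfloor>x \<bullet> b\<rfloor>) bs)) \<le> 1 / 2"
      unfolding real_code_def bs_def add_diff_cancel_left' by (rule ternary_sum_bounds)+
    ultimately show "0 \<le> real_code x \<and> real_code x < real (Max (insert 0 (to_nat ` L))) + 1" by linarith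
  qed simp
qed

text \<open>The code jumps, but its inverse is uniformly continuous on the range. It therefore
  extends to the closure of the range, and by Dugundji's theorem to the whole line. Convergence of
  codes can then be pulled back to points.\<close>

lemma real_code_left_inverse:
  obtains g :: "real \<Rightarrow> 'b::euclidean_space" where "continuous_on UNIV g" "\<And>x. g (real_code x) = x"
proof -
  have inj: "inj (real_code :: 'b \<Rightarrow> real)"
  proof (rule injI, rule ccontr)
    fix x y :: 'b assume eq: "real_code x = real_code y" and "x \<noteq> y"
    then have pos: "dist x y > 0" by simp
    obtain \<delta> where \<delta>: "\<delta> > 0" "\<And>x' y' :: 'b. \<bar>real_code x' - real_code y'\<bar> < \<delta> \<Longrightarrow> dist x' y' < dist x y"
      by (rule real_code_uniform_inverse[OF pos, where 'b='b]) (rule that)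
    have "dist x y < dist x y" by (rule \<delta>(2)) (simp add: eq \<delta>(1))
    then show False by simp
  qed
  define f where "f = (inv real_code :: real \<Rightarrow> 'b)"
  have f: "f (real_code x) = x" for x unfolding f_def by (rule inv_f_f[OF inj])
  have "uniformly_continuous_on (range (real_code :: 'b \<Rightarrow> real)) f"
    unfolding uniformly_continuous_on_def
  proof (intro allI impI)
    fix \<epsilon> :: real assume pos: "\<epsilon> > 0"
    obtain \<delta> where \<delta>: "\<delta> > 0" "\<And>x' y' :: 'b. \<bar>real_code x' - real_code y'\<bar> < \<delta> \<Longrightarrow> dist x' y' < \<epsilon>"
      by (rule real_code_uniform_inverse[OF pos, where 'b='b]) (rule that)
    then show "\<exists>d>0. \<forall>x\<in>range (real_code :: 'b \<Rightarrow> real). \<forall>x'\<in>range (real_code :: 'b \<Rightarrow> real). dist x' x < d \<longrightarrow> dist (f x') (f x) < \<epsilon>"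
    proof (intro exI[of _ \<delta>] conjI \<delta>(1) ballI impI)
      fix u v assume "u \<in> range (real_code :: 'b \<Rightarrow> real)" "v \<in> range (real_code :: 'b \<Rightarrow> real)" "dist v u < \<delta>"
      then show "dist (f v) (f u) < \<epsilon>" by (auto simp only: f dist_real_def image_iff intro: \<delta>(2))
    qed
  qed
  from uniformly_continuous_on_extension_on_closure[OF this]
  obtain h where h: "uniformly_continuous_on (closure (range (real_code :: 'b \<Rightarrow> real))) h"
    "\<And>x. x \<in> range (real_code :: 'b \<Rightarrow> real) \<Longrightarrow> f x = h x"
    by (metis (no_types, lifting))
  obtain g where g: "continuous_on UNIV g" "\<And>x. x \<in> closure (range (real_code :: 'b \<Rightarrow> real)) \<Longrightarrow> g x = h x"
    by (rule Dugundji[OF convex_UNIV UNIV_not_empty _ uniformly_continuous_imp_continuous[OF h(1)] subset_UNIV, of UNIV])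
      (auto simp: closed_closedin[symmetric] intro: that)
  have "g (real_code x) = x" for x
    unfolding g(2)[OF subsetD[OF closure_subset rangeI]] h(2)[OF rangeI, symmetric] by (rule f)
  with g(1) show ?thesis by (rule that)
qed

section \<open>Weak limits and Prokhorov's theorem\<close>

text \<open>The lower half of weak convergence, in a form that serves indicators of open sets and
  unbounded costs alike. It fixes the limit of a constant marginal, since two probability measures
  comparable on all open sets are equal.\<close>

definition lsc_limit :: "(nat \<Rightarrow> 'b::topological_space measure) \<Rightarrow> 'b measure \<Rightarrow> bool" where
  "lsc_limit \<mu> M \<longleftrightarrow> (\<forall>h :: 'b \<Rightarrow> ennreal. h \<in> borel_measurable borel \<longrightarrow>
     (\<forall>X x. X \<longlonglongrightarrow> x \<longrightarrow> h x \<le> liminf (\<lambda>n. h (X n))) \<longrightarrow>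
     (\<integral>\<^sup>+ x. h x \<partial>M) \<le> liminf (\<lambda>n. \<integral>\<^sup>+ x. h x \<partial>\<mu> n))"

text \<open>Prokhorov's theorem, in the form of the portmanteau inequality for lower semicontinuous
  functions. The coding \<open>real_code\<close> reduces it to Helly's and Skorohod's theorems on the line.\<close>

theorem tight_imp_lsc_limit:
  fixes \<mu> :: "nat \<Rightarrow> 'b::euclidean_space measure"
  assumes sets: "\<And>n. sets (\<mu> n) = sets borel" and prob: "\<And>n. prob_space (\<mu> n)"
    and tight: "\<And>\<epsilon>. \<epsilon> > 0 \<Longrightarrow> \<exists>R. \<forall>n. measure (\<mu> n) {x. norm x > R} < \<epsilon>"
  obtains r M where "strict_mono (r :: nat \<Rightarrow> nat)" "sets M = sets borel" "prob_space M"
    "lsc_limit (\<lambda>n. \<mu> (r n)) M"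
proof -
  note [measurable_cong] = sets
  define \<kappa> where "\<kappa> n = distr (\<mu> n) borel real_code" for n
  have rd: "real_distribution (\<kappa> n)" for n
    unfolding \<kappa>_def real_distribution_def real_distribution_axioms_def
    by (auto intro!: prob_space.prob_space_distr prob)
  have "tight \<kappa>" unfolding tight_def
  proof (intro conjI allI impI rd)
    fix \<epsilon> :: real assume "\<epsilon> > 0"
    then obtain R where R: "\<And>n. measure (\<mu> n) {x. norm x > R} < \<epsilon>" using tight by blast
    obtain B where B: "B > 0" "\<And>x :: 'b. norm x \<le> R \<Longrightarrow> 0 \<le> real_code x \<and> real_code x < B"
      using real_code_bounded_on_ball by blast
    \<comment> \<open>Tightness on the line is phrased with intervals open on the left; the endpoint
      -1 keeps the code 0 inside.\<close>
    have "measure (\<kappa> n) {-1<..B} > 1 - \<epsilon>" for n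
    proof -
      interpret prob_space "\<mu> n" by (rule prob)
      have sp: "space (\<mu> n) = UNIV" using sets_eq_imp_space_eq[OF sets[of n]] by simp
      have "1 - \<epsilon> < 1 - measure (\<mu> n) {x. norm x > R}" using R[of n] by simp
      also have "\<dots> = measure (\<mu> n) (UNIV - {x. norm x > R})"
        using prob_compl[of "{x. norm x > R}"] sp sets by simp
      also have "\<dots> \<le> measure (\<mu> n) (real_code -` {-1<..B} \<inter> space (\<mu> n))"
        proof (rule finite_measure_mono)
        show "UNIV - {x :: 'b. norm x > R} \<subseteq> real_code -` {-1<..B} \<inter> space (\<mu> n)"
        proof
          fix x assume "x \<in> UNIV - {x :: 'b. norm x > R}"
          then show "x \<in> real_code -` {-1<..B} \<inter> space (\<mu> n)" using B(2)[of x] sp by auto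
        qed
      qed measurable
      also have "\<dots> = measure (\<kappa> n) {-1<..B}"
        unfolding \<kappa>_def by (rule measure_distr[symmetric]) auto
      finally show ?thesis .
    qed
    then show "\<exists>a b. a < b \<and> (\<forall>n. 1 - \<epsilon> < measure (\<kappa> n) {a<..b})"
      using B(1) by (intro exI[of _ "-1"] exI[of _ B]) auto
  qed
  then obtain r L where r: "strict_mono r" "real_distribution L" "weak_conv_m (\<kappa> \<circ> id \<circ> r) L"
    using tight_imp_convergent_subsubsequence[of \<kappa> id] by (auto simp: strict_mono_def)
  then have wc: "weak_conv_m (\<lambda>n. \<kappa> (r n)) L" by (simp add: comp_def)
  obtain \<Omega> :: "real measure" and Y_seq Y where \<Omega>: "prob_space \<Omega>"
    and Ys [measurable]: "\<And>n. Y_seq n \<in> borel_measurable \<Omega>"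
    and dist: "\<And>n. distr \<Omega> borel (Y_seq n) = \<kappa> (r n)"
    and Y: "Y \<in> measurable \<Omega> lborel"
    and conv: "\<And>x. x \<in> space \<Omega> \<Longrightarrow> (\<lambda>n. Y_seq n x) \<longlonglongrightarrow> Y x"
    using Skorohod[OF rd r(2) wc] by blast
  have [measurable]: "Y \<in> borel_measurable \<Omega>" using Y by simp
  obtain g :: "real \<Rightarrow> 'b" where g: "continuous_on UNIV g" "\<And>x. g (real_code x) = x"
    using real_code_left_inverse by blast
  have [measurable]: "g \<in> borel_measurable borel" by (rule borel_measurable_continuous_onI[OF g(1)])
  define M where "M = distr \<Omega> borel (\<lambda>x. g (Y x))"
  show ?thesis
  proof (rule that[OF r(1)])
    show "sets M = sets borel" by (simp add: M_def)
    show "prob_space M" unfolding M_def by (intro prob_space.prob_space_distr[OF \<Omega>]) measurable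
    show "lsc_limit (\<lambda>n. \<mu> (r n)) M" unfolding lsc_limit_def
    proof (intro allI impI)
      fix h :: "'b \<Rightarrow> ennreal" assume h [measurable]: "h \<in> borel_measurable borel"
        and lsc: "\<forall>X x. X \<longlonglongrightarrow> x \<longrightarrow> h x \<le> liminf (\<lambda>n. h (X n))"
      have eq: "(\<integral>\<^sup>+ x. h (g (Y_seq n x)) \<partial>\<Omega>) = (\<integral>\<^sup>+ x. h x \<partial>\<mu> (r n))" for n
      proof -
        have "(\<integral>\<^sup>+ x. h (g (Y_seq n x)) \<partial>\<Omega>) = (\<integral>\<^sup>+ y. h (g y) \<partial>distr \<Omega> borel (Y_seq n))"
          by (subst nn_integral_distr) auto
        also have "\<dots> = (\<integral>\<^sup>+ x. h x \<partial>\<mu> (r n))"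
          unfolding dist \<kappa>_def by (subst nn_integral_distr) (auto simp: g)
        finally show ?thesis .
      qed
      have "(\<integral>\<^sup>+ x. h x \<partial>M) = (\<integral>\<^sup>+ x. h (g (Y x)) \<partial>\<Omega>)"
        unfolding M_def by (subst nn_integral_distr) auto
      \<comment> \<open>Skorohod's variables converge pointwise, so lower semicontinuity applies
        under the integral and Fatou's lemma finishes.\<close>
      also have "\<dots> \<le> (\<integral>\<^sup>+ x. liminf (\<lambda>n. h (g (Y_seq n x))) \<partial>\<Omega>)"
      proof (rule nn_integral_mono)
        fix x assume "x \<in> space \<Omega>"
        then have "(\<lambda>n. g (Y_seq n x)) \<longlonglongrightarrow> g (Y x)"
          using g(1) conv by (intro isCont_tendsto_compose[of _ g]) (auto simp: continuous_on_eq_continuous_at)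
        then show "h (g (Y x)) \<le> liminf (\<lambda>n. h (g (Y_seq n x)))" by (intro lsc[rule_format])
      qed
      also have "\<dots> \<le> liminf (\<lambda>n. \<integral>\<^sup>+ x. h (g (Y_seq n x)) \<partial>\<Omega>)"
        by (rule nn_integral_liminf) measurable
      finally show "(\<integral>\<^sup>+ x. h x \<partial>M) \<le> liminf (\<lambda>n. \<integral>\<^sup>+ x. h x \<partial>\<mu> (r n))" unfolding eq .
    qed
  qed
qed

section \<open>Measures dominated by Lebesgue measure, and transport plans\<close>

lemma emeasure_le_of_open_le:
  fixes M N :: "'b::euclidean_space measure"
  assumes "sets N = sets borel" "emeasure N (space N) \<noteq> \<infinity>"
    and "sets M = sets borel" and le: "\<And>U. open U \<Longrightarrow> emeasure M U \<le> emeasure N U"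
    and "A \<in> sets borel"
  shows "emeasure M A \<le> emeasure N A"
  unfolding outer_regular[OF assms(1,2,5)]
  using assms by (intro INF_greatest) (auto intro!: order.trans[OF emeasure_mono le])

text \<open>Outer regularity extends the inequality to all Borel sets. Applied to a set and to its
  complement it must be an equality, because both total masses are 1.\<close>

lemma prob_eq_of_open_le:
  fixes M N :: "'b::euclidean_space measure"
  assumes N: "sets N = sets borel" "prob_space N"
    and M: "sets M = sets borel" "prob_space M"
    and le: "\<And>U. open U \<Longrightarrow> emeasure M U \<le> emeasure N U"
  shows "M = N"
proof (rule measure_eqI)
  fix A assume A: "A \<in> sets M"
  interpret M: prob_space M by fact
  interpret N: prob_space N by fact
  have sp: "space M = UNIV" "space N = UNIV"
    using sets_eq_imp_space_eq[OF M(1)] sets_eq_imp_space_eq[OF N(1)] by auto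
  have le': "emeasure M B \<le> emeasure N B" if "B \<in> sets borel" for B
    using emeasure_le_of_open_le[OF N(1) _ M(1) le that] by simp
  have "measure M A \<le> measure N A"
    using le'[of A] A M(1) by (simp add: M.emeasure_eq_measure N.emeasure_eq_measure)
  moreover have "measure M (UNIV - A) \<le> measure N (UNIV - A)"
    using le'[of "UNIV - A"] A M(1) by (simp add: M.emeasure_eq_measure N.emeasure_eq_measure)
  ultimately have "measure M A = measure N A"
    using M.prob_compl[of A] N.prob_compl[of A] sp A M(1) N(1) by simp
  then show "emeasure M A = emeasure N A" by (simp add: M.emeasure_eq_measure N.emeasure_eq_measure)
qed (use M N in simp)

text \<open>Lebesgue measure is infinite, so outer regularity is used in the form of an open
  superset with small excess.\<close>

lemma emeasure_le_lborel_of_open_le: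
  fixes M :: "'b::euclidean_space measure"
  assumes M: "sets M = sets borel" and le: "\<And>U. open U \<Longrightarrow> emeasure M U \<le> emeasure lborel U"
    and A: "A \<in> sets borel"
  shows "emeasure M A \<le> emeasure lborel A"
proof (rule ennreal_le_epsilon)
  fix e :: real assume "e > 0"
  then obtain U where U: "open U" "A \<subseteq> U" "emeasure lborel (U - A) < e"
    using outer_regular_lborel[OF A] by blast
  have "emeasure M A \<le> emeasure M U" using U M by (intro emeasure_mono) auto
  also have "\<dots> \<le> emeasure lborel U" by (rule le[OF U(1)])
  also have "U = A \<union> (U - A)" using U by auto
  also have "emeasure lborel \<dots> = emeasure lborel A + emeasure lborel (U - A)"
    using U A by (intro plus_emeasure[symmetric]) auto
  also have "\<dots> \<le> emeasure lborel A + ennreal e" using U(3) by (intro add_left_mono) auto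
  finally show "emeasure M A \<le> emeasure lborel A + ennreal e" .
qed

lemma AE_le_1_of_nn_integral_le:
  fixes f :: "'b::euclidean_space \<Rightarrow> ennreal"
  assumes [measurable]: "f \<in> borel_measurable lborel"
    and le: "\<And>A. A \<in> sets borel \<Longrightarrow> (\<integral>\<^sup>+ x. f x * indicator A x \<partial>lborel) \<le> emeasure lborel A"
  shows "AE x in lborel. f x \<le> 1"
proof -
  have "AE x in lborel. \<not> (f x > 1 \<and> norm x \<le> real k)" for k :: nat
  proof -
    \<comment> \<open>The ball makes the integral of the indicator finite, as the subtraction below
      requires; the balls exhaust the space.\<close>
    define A where "A = {x. f x > 1} \<inter> cball 0 (real k)"
    have A [measurable]: "A \<in> sets borel" unfolding A_def by measurable
    have fin: "emeasure lborel A < \<infinity>"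
      by (rule order.strict_trans1[OF emeasure_mono[of A "cball 0 (real k)"] emeasure_lborel_cball_finite])
        (auto simp: A_def)
    have fin': "(\<integral>\<^sup>+ x. indicator A x \<partial>lborel) \<noteq> \<infinity>" using fin by simp
    have "(\<integral>\<^sup>+ x. f x * indicator A x - indicator A x \<partial>lborel)
      = (\<integral>\<^sup>+ x. f x * indicator A x \<partial>lborel) - (\<integral>\<^sup>+ x. indicator A x \<partial>lborel)"
      by (rule nn_integral_diff[OF _ _ fin']) (auto simp: A_def indicator_def less_imp_le)
    also have "\<dots> = 0" using le[OF A] order.strict_trans1[OF le[OF A] fin]
      by (simp add: diff_eq_0_iff_ennreal)
    finally have "AE x in lborel. f x * indicator A x - indicator A x = 0"
      by (subst (asm) nn_integral_0_iff_AE) auto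
    then show ?thesis
    proof eventually_elim
      case (elim x)
      show ?case
      proof
        assume x: "f x > 1 \<and> norm x \<le> real k"
        then have "f x - 1 = 0" using elim by (auto simp: A_def)
        then show False using x diff_gr0_ennreal[of 1 "f x"] by auto
      qed
    qed
  qed
  then have "AE x in lborel. \<forall>k :: nat. \<not> (f x > 1 \<and> norm x \<le> real k)" unfolding AE_all_countable by (rule allI)
  then show ?thesis
  proof eventually_elim
    case (elim x)
    then show ?case using real_arch_simple[of "norm x"] by (meson not_le_imp_less)
  qed
qed

text \<open>By Radon-Nikodym the density constraint becomes a setwise inequality. In that form it
  can be checked on open sets, and so it survives weak limits.\<close>

lemma density_bounded_iff_le_lborel:
  fixes M :: "'b::euclidean_space measure"
  assumes M: "sets M = sets borel" "prob_space M"
  shows "(\<exists>f :: 'b \<Rightarrow> ennreal. f \<in> borel_measurable lborel \<and> (AE x in lborel. f x \<le> 1) \<and> M = density lborel f)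
    \<longleftrightarrow> (\<forall>A \<in> sets borel. emeasure M A \<le> emeasure lborel A)"
proof
  assume "\<exists>f :: 'b \<Rightarrow> ennreal. f \<in> borel_measurable lborel \<and> (AE x in lborel. f x \<le> 1) \<and> M = density lborel f"
  then obtain f :: "'b \<Rightarrow> ennreal" where [measurable]: "f \<in> borel_measurable lborel"
    and f: "AE x in lborel. f x \<le> 1" "M = density lborel f" by blast
  show "\<forall>A \<in> sets borel. emeasure M A \<le> emeasure lborel A"
  proof
    fix A :: "'b set" assume [measurable]: "A \<in> sets borel"
    have "emeasure M A = (\<integral>\<^sup>+ x. f x * indicator A x \<partial>lborel)"
      unfolding f(2) by (rule emeasure_density) auto
    also have "\<dots> \<le> (\<integral>\<^sup>+ x. indicator A x \<partial>lborel)"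
      using f(1) by (intro nn_integral_mono_AE) (auto split: split_indicator)
    finally show "emeasure M A \<le> emeasure lborel A" by simp
  qed
next
  assume le: "\<forall>A \<in> sets borel. emeasure M A \<le> emeasure lborel A"
  have "absolutely_continuous lborel M"
    unfolding absolutely_continuous_def null_sets_def using le M by auto
  then obtain f where f: "f \<in> borel_measurable lborel" "density lborel f = M"
    using sigma_finite_measure.Radon_Nikodym[OF sigma_finite_lborel, of M] M by auto
  have "AE x in lborel. f x \<le> 1"
  proof (rule AE_le_1_of_nn_integral_le[OF f(1)])
    fix A :: "'b set" assume A: "A \<in> sets borel"
    then have "(\<integral>\<^sup>+ x. f x * indicator A x \<partial>lborel) = emeasure M A"
      using f by (subst f(2)[symmetric], subst emeasure_density) auto
    then show "(\<integral>\<^sup>+ x. f x * indicator A x \<partial>lborel) \<le> emeasure lborel A" using le A by auto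
  qed
  with f show "\<exists>f :: 'b \<Rightarrow> ennreal. f \<in> borel_measurable lborel \<and> (AE x in lborel. f x \<le> 1) \<and> M = density lborel f"
    by metis
qed

lemma lsc_limit_open:
  assumes lim: "lsc_limit \<mu> M" and S: "open S"
    and sets: "\<And>n. sets (\<mu> n) = sets borel" "sets M = sets borel"
  shows "emeasure M S \<le> liminf (\<lambda>n. emeasure (\<mu> n) S)"
proof -
  have "indicator S x \<le> liminf (\<lambda>n. indicator S (X n) :: ennreal)" if "X \<longlonglongrightarrow> x" for X x
  proof (cases "x \<in> S")
    case True
    then have "\<forall>\<^sub>F n in sequentially. X n \<in> S" using that S by (rule topological_tendstoD[rotated 2])
    then have "\<forall>\<^sub>F n in sequentially. (1 :: ennreal) \<le> indicator S (X n)" by eventually_elim simp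
    then show ?thesis using True by (simp add: Liminf_bounded)
  qed simp
  then have "(\<integral>\<^sup>+ x. indicator S x \<partial>M) \<le> liminf (\<lambda>n. \<integral>\<^sup>+ x. indicator S x \<partial>\<mu> n)"
    using S by (intro lim[unfolded lsc_limit_def, rule_format]) auto
  then show ?thesis using S sets by simp
qed

lemma lsc_limit_continuous:
  fixes f :: "'b::t2_space \<Rightarrow> real"
  assumes lim: "lsc_limit \<mu> M" and f: "continuous_on UNIV f"
  shows "(\<integral>\<^sup>+ x. ennreal (f x) \<partial>M) \<le> liminf (\<lambda>n. \<integral>\<^sup>+ x. ennreal (f x) \<partial>\<mu> n)"
proof -
  have "ennreal (f x) \<le> liminf (\<lambda>n. ennreal (f (X n)))" if "X \<longlonglongrightarrow> x" for X x
  proof -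
    have "(\<lambda>n. f (X n)) \<longlonglongrightarrow> f x"
      using f that by (intro isCont_tendsto_compose[of x f]) (auto simp: continuous_on_eq_continuous_at)
    then have "(\<lambda>n. ennreal (f (X n))) \<longlonglongrightarrow> ennreal (f x)" by (rule tendsto_ennrealI)
    from lim_imp_Liminf[OF _ this] show ?thesis by simp
  qed
  moreover have "(\<lambda>x. ennreal (f x)) \<in> borel_measurable borel"
    using borel_measurable_continuous_onI[OF f] by measurable
  ultimately show ?thesis by (intro lim[unfolded lsc_limit_def, rule_format]) auto
qed

section \<open>Transport plans: marginals, tightness and limits\<close>

lemma measurable_fst_snd_borel:
  fixes \<gamma> :: "('a::second_countable_topology \<times> 'b::second_countable_topology) measure"
  assumes "sets \<gamma> = sets borel"
  shows "fst \<in> \<gamma> \<rightarrow>\<^sub>M borel" "snd \<in> \<gamma> \<rightarrow>\<^sub>M borel"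
  unfolding measurable_cong_sets[OF assms refl] by (simp_all add: borel_prod[symmetric])

lemma transport_plansD:
  assumes "\<gamma> \<in> transport_plans \<mu> \<nu>"
  shows "sets \<gamma> = sets borel" "prob_space \<gamma>" "distr \<gamma> borel fst = \<mu>" "distr \<gamma> borel snd = \<nu>"
    "space \<gamma> = UNIV" "sets \<mu> = sets borel" "sets \<nu> = sets borel" "prob_space \<mu>" "prob_space \<nu>"
proof -
  show g: "sets \<gamma> = sets borel" "prob_space \<gamma>" "distr \<gamma> borel fst = \<mu>" "distr \<gamma> borel snd = \<nu>"
    using assms by (auto simp: transport_plans_def)
  show "space \<gamma> = UNIV" using sets_eq_imp_space_eq[OF g(1)] by simp
  show "sets \<mu> = sets borel" "sets \<nu> = sets borel" using g(3,4) by (metis sets_distr)+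
  have "prob_space (distr \<gamma> borel fst)" "prob_space (distr \<gamma> borel snd)"
    by (intro prob_space.prob_space_distr g(2) measurable_fst_snd_borel g(1))+
  then show "prob_space \<mu>" "prob_space \<nu>" using g by simp_all
qed

lemma transport_plans_marginal_fst:
  assumes "\<gamma> \<in> transport_plans \<mu> \<nu>" "X \<in> sets borel"
  shows "emeasure \<gamma> (X \<times> UNIV) = emeasure \<mu> X"
proof -
  note g = transport_plansD[OF assms(1)]
  have "emeasure \<mu> X = emeasure \<gamma> (fst -` X \<inter> space \<gamma>)"
    unfolding g(3)[symmetric] by (rule emeasure_distr[OF measurable_fst_snd_borel(1)[OF g(1)] assms(2)])
  also have "fst -` X \<inter> space \<gamma> = X \<times> UNIV" using g(5) by auto
  finally show ?thesis ..
qed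

lemma transport_plans_marginal_snd:
  assumes "\<gamma> \<in> transport_plans \<mu> \<nu>" "Y \<in> sets borel"
  shows "emeasure \<gamma> (UNIV \<times> Y) = emeasure \<nu> Y"
proof -
  note g = transport_plansD[OF assms(1)]
  have "emeasure \<nu> Y = emeasure \<gamma> (snd -` Y \<inter> space \<gamma>)"
    unfolding g(4)[symmetric] by (rule emeasure_distr[OF measurable_fst_snd_borel(2)[OF g(1)] assms(2)])
  also have "snd -` Y \<inter> space \<gamma> = UNIV \<times> Y" using g(5) by auto
  finally show ?thesis ..
qed

lemma transport_plansI:
  assumes sets: "sets \<gamma> = sets borel" "sets \<mu> = sets borel" "sets \<nu> = sets borel" and prob: "prob_space \<mu>"
    and fst: "\<And>X. X \<in> sets borel \<Longrightarrow> emeasure \<gamma> (X \<times> UNIV) = emeasure \<mu> X"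
    and snd: "\<And>Y. Y \<in> sets borel \<Longrightarrow> emeasure \<gamma> (UNIV \<times> Y) = emeasure \<nu> Y"
  shows "\<gamma> \<in> transport_plans \<mu> \<nu>"
proof -
  have sp: "space \<gamma> = UNIV" "space \<mu> = UNIV"
    using sets_eq_imp_space_eq[OF sets(1)] sets_eq_imp_space_eq[OF sets(2)] by simp_all
  note m = measurable_fst_snd_borel[OF sets(1)]
  have eq: "fst -` X = X \<times> UNIV" "snd -` X = UNIV \<times> X" for X by auto
  have "distr \<gamma> borel fst = \<mu>"
    by (rule measure_eqI) (simp_all add: sets emeasure_distr[OF m(1)] eq sp fst)
  moreover have "distr \<gamma> borel snd = \<nu>"
    by (rule measure_eqI) (simp_all add: sets emeasure_distr[OF m(2)] eq sp snd)
  moreover have "prob_space \<gamma>"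
    using fst[of UNIV] prob_space.emeasure_space_1[OF prob] sp by (intro prob_spaceI) simp
  ultimately show ?thesis using sets by (simp add: transport_plans_def)
qed

lemma prob_tight:
  fixes M :: "'b::euclidean_space measure"
  assumes "sets M = sets borel" "prob_space M" "\<epsilon> > 0"
  obtains R where "R > 0" "measure M {x. norm x > R} < \<epsilon>"
proof -
  interpret prob_space M by fact
  have sp: "space M = UNIV" using sets_eq_imp_space_eq[OF assms(1)] by simp
  define A where "A n = {x :: 'b. norm x > real n}" for n
  have A: "A n \<in> sets M" for n unfolding A_def assms(1) by measurable
  have "(\<Inter>n. A n) = {}"
  proof (rule equals0I)
    fix x :: 'b assume x: "x \<in> (\<Inter>n. A n)"
    obtain n where "norm x \<le> real n" using real_arch_simple by blast
    then show False using INT_D[OF x, of n] by (simp add: A_def)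
  qed
  moreover have "decseq A" unfolding decseq_def A_def by (auto intro: le_less_trans)
  ultimately have "(\<lambda>n. measure M (A n)) \<longlonglongrightarrow> 0"
    using finite_Lim_measure_decseq[of A] A by (simp add: image_subset_iff)
  then have "\<forall>\<^sub>F n in sequentially. measure M (A n) < \<epsilon>"
    using assms(3) by (rule order_tendstoD(2))
  then have "\<exists>n. measure M (A n) < \<epsilon>" by (rule eventually_happens'[rotated]) simp
  then obtain n where n: "measure M (A n) < \<epsilon>" by blast
  have "measure M {x. norm x > real n + 1} \<le> measure M (A n)"
    by (rule finite_measure_mono[OF _ A]) (auto simp: A_def)
  with n show ?thesis by (intro that[of "real n + 1"]) simp_all
qed

lemma transport_plans_tight:
  fixes \<gamma> :: "nat \<Rightarrow> ('a::euclidean_space \<times> 'a) measure"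
  assumes plans: "\<And>n. \<gamma> n \<in> transport_plans (\<rho> n) \<mu>"
    and tight: "\<And>\<epsilon>. \<epsilon> > 0 \<Longrightarrow> \<exists>R. \<forall>n. measure (\<rho> n) {x. norm x > R} < \<epsilon>"
    and "\<epsilon> > 0"
  shows "\<exists>R. \<forall>n. measure (\<gamma> n) {p. norm p > R} < \<epsilon>"
proof -
  obtain R where R: "\<And>n. measure (\<rho> n) {x. norm x > R} < \<epsilon> / 2"
    using tight[of "\<epsilon> / 2"] \<open>\<epsilon> > 0\<close> by auto
  obtain R' where R': "measure \<mu> {x. norm x > R'} < \<epsilon> / 2"
    using prob_tight[OF transport_plansD(7,9)[OF plans[of 0]], of "\<epsilon> / 2"] \<open>\<epsilon> > 0\<close> by auto
  have "measure (\<gamma> n) {p. norm p > R + R'} < \<epsilon>" for n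
  proof -
    note g = transport_plansD[OF plans[of n]]
    interpret prob_space "\<gamma> n" by (rule g)
    have norm_le: "norm (a, b) \<le> norm a + norm b" for a b :: 'a
      by (simp add: norm_Pair sqrt_sum_squares_le_sum)
    have "{p :: 'a \<times> 'a. norm p > R + R'} \<subseteq> {x. norm x > R} \<times> UNIV \<union> UNIV \<times> {x. norm x > R'}"
    proof (intro subsetI)
      fix p :: "'a \<times> 'a" assume "p \<in> {p. norm p > R + R'}"
      then have "R + R' < norm (fst p) + norm (snd p)"
        using norm_le[of "fst p" "snd p"] by simp
      then have "R < norm (fst p) \<or> R' < norm (snd p)" by linarith
      then show "p \<in> {x. norm x > R} \<times> UNIV \<union> UNIV \<times> {x. norm x > R'}" by (cases p) auto
    qed
    then have "measure (\<gamma> n) {p. norm p > R + R'}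
        \<le> measure (\<gamma> n) ({x. norm x > R} \<times> UNIV \<union> UNIV \<times> {x. norm x > R'})"
      by (intro finite_measure_mono) (simp_all add: g(1) borel_prod[symmetric])
    also have "\<dots> \<le> measure (\<gamma> n) ({x. norm x > R} \<times> UNIV) + measure (\<gamma> n) (UNIV \<times> {x. norm x > R'})"
      by (intro measure_Un_le) (simp_all add: g(1) borel_prod[symmetric])
    also have "\<dots> = measure (\<rho> n) {x. norm x > R} + measure \<mu> {x. norm x > R'}"
      using transport_plans_marginal_fst[OF plans[of n], of "{x. norm x > R}"]
        transport_plans_marginal_snd[OF plans[of n], of "{x. norm x > R'}"] by (simp add: measure_def)
    also have "\<dots> < \<epsilon>" using R[of n] R' by linarith
    finally show ?thesis .
  qed
  then show ?thesis by blast
qed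

text \<open>The second marginal is constant along the sequence and is inherited on open sets. The
  first one varies with \<open>n\<close>, so that of the limit can only be named as a
  pushforward.\<close>

lemma lsc_limit_transport_plans:
  fixes \<gamma> :: "nat \<Rightarrow> ('a::euclidean_space \<times> 'a) measure"
  assumes plans: "\<And>n. \<gamma> n \<in> transport_plans (\<rho> n) \<mu>"
    and M: "sets M = sets borel" "prob_space M" and lim: "lsc_limit \<gamma> M"
  shows "M \<in> transport_plans (distr M borel fst) \<mu>"
proof -
  note m = measurable_fst_snd_borel(2)[OF M(1)]
  note g = transport_plansD[OF plans]
  have sp: "space M = UNIV" using sets_eq_imp_space_eq[OF M(1)] by simp
  have "distr M borel snd = \<mu>"
  proof (rule prob_eq_of_open_le)
    show "prob_space (distr M borel snd)" by (rule prob_space.prob_space_distr[OF M(2) m])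
    fix U :: "'a set" assume U: "open U"
    have "emeasure (distr M borel snd) U = emeasure M (UNIV \<times> U)"
    proof -
      have "snd -` U \<inter> space M = UNIV \<times> U" using sp by auto
      then show ?thesis using U by (simp add: emeasure_distr[OF m])
    qed
    also have "\<dots> \<le> liminf (\<lambda>n. emeasure (\<gamma> n) (UNIV \<times> U))"
      by (rule lsc_limit_open[OF lim open_Times[OF open_UNIV U] g(1) M(1)])
    also have "\<dots> = emeasure \<mu> U"
      unfolding transport_plans_marginal_snd[OF plans borel_open[OF U]] by (simp add: Liminf_const)
    finally show "emeasure (distr M borel snd) U \<le> emeasure \<mu> U" .
  qed (use g(7,9) in simp_all)
  then show ?thesis using M by (simp add: transport_plans_def)
qed

section \<open>Coupling of boxes\<close>

definition set_coord :: "'a::euclidean_space \<Rightarrow> 'a \<Rightarrow> real \<Rightarrow> 'a" where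
  "set_coord x b c = x + (c - x \<bullet> b) *\<^sub>R b"

lemma set_coord_inner [simp]:
  "b \<in> Basis \<Longrightarrow> i \<in> Basis \<Longrightarrow> set_coord x b c \<bullet> i = (if i = b then c else x \<bullet> i)"
  by (auto simp: set_coord_def inner_add_left inner_Basis)

text \<open>Cutting commutes with interpolating: the halves of an interpolated box are the
  interpolations of corresponding halves.\<close>

lemma set_coord_affine:
  "(1 - t) *\<^sub>R set_coord x b c + t *\<^sub>R set_coord y b d
    = set_coord ((1 - t) *\<^sub>R x + t *\<^sub>R y) b ((1 - t) * c + t * d)"
  by (simp add: set_coord_def algebra_simps inner_add_left)

lemma cbox_set_coord:
  assumes b: "b \<in> Basis" and c: "l \<bullet> b \<le> c" "c \<le> u \<bullet> b"
  shows "cbox l u = cbox l (set_coord u b c) \<union> cbox (set_coord l b c) u"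
    and "cbox l (set_coord u b c) \<inter> cbox (set_coord l b c) u \<subseteq> {x. x \<bullet> b = c}"
  using assms by (fastforce simp: mem_box split: if_splits)+

locale sub_lebesgue = prob_space M for M :: "'a::euclidean_space measure" +
  assumes sets_M [simp, measurable_cong]: "sets M = sets borel"
    and le_lborel: "A \<in> sets borel \<Longrightarrow> emeasure M A \<le> emeasure lborel A"
begin

lemma space_M [simp]: "space M = UNIV"
  using sets_eq_imp_space_eq[OF sets_M] by simp

end

lemma hyperplane_null_lborel: "b \<in> Basis \<Longrightarrow> emeasure lborel {x :: 'a::euclidean_space. x \<bullet> b = c} = 0"
  using negligible_standard_hyperplane[of b c]
  by (auto simp: negligible_iff_null_sets null_sets_def inner_commute)

text \<open>The closed halves overlap in a hyperplane, which is null for every measure below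
  Lebesgue measure. \<open>M\<close> may have infinite mass, since the lemma is applied to
  \<open>lborel\<close> as well.\<close>

lemma emeasure_cbox_split:
  fixes l u :: "'a::euclidean_space"
  assumes M: "sets M = sets borel" "\<And>A. A \<in> sets borel \<Longrightarrow> emeasure M A \<le> emeasure lborel A"
    and b: "b \<in> Basis" and c: "l \<bullet> b \<le> c" "c \<le> u \<bullet> b" and X: "X \<in> sets borel"
  shows "emeasure M (X \<inter> cbox l u)
    = emeasure M (X \<inter> cbox l (set_coord u b c)) + emeasure M (X \<inter> cbox (set_coord l b c) u)"
proof -
  let ?A = "X \<inter> cbox l (set_coord u b c)" and ?B = "X \<inter> cbox (set_coord l b c) u"
  have null: "emeasure M (?A \<inter> ?B) = 0"
  proof -
    have "emeasure M (?A \<inter> ?B) \<le> emeasure M {x. x \<bullet> b = c}"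
      using cbox_set_coord(2)[OF b c] M(1) by (intro emeasure_mono) auto
    also have "\<dots> \<le> emeasure lborel {x. x \<bullet> b = c}" by (rule M(2)) measurable
    finally show ?thesis by (simp add: hyperplane_null_lborel[OF b])
  qed
  have sets: "?A \<in> sets M" "?B \<in> sets M" using X M(1) by auto
  have "X \<inter> cbox l u = ?A \<union> ?B" using cbox_set_coord(1)[OF b c] by auto
  then show ?thesis using emeasure_Un'[OF sets] null sets by (auto simp: null_sets_def)
qed

text \<open>The mass below the cut is Lipschitz in the height of the cut, since a slab has volume
  \<open>K * (d - c)\<close> with \<open>K\<close> the area of the face. The intermediate value
  theorem then gives every value.\<close>

lemma (in sub_lebesgue) cbox_cut_with_mass:
  assumes b: "b \<in> Basis" and lu: "\<And>i. i \<in> Basis \<Longrightarrow> l \<bullet> i \<le> u \<bullet> i"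
    and v: "0 \<le> v" "v \<le> measure M (cbox l u)"
  obtains c where "l \<bullet> b \<le> c" "c \<le> u \<bullet> b" "measure M (cbox l (set_coord u b c)) = v"
proof -
  define F where "F c = measure M (cbox l (set_coord u b c))" for c
  define K where "K = (\<Prod>i\<in>Basis - {b}. u \<bullet> i - l \<bullet> i)"
  have K: "K \<ge> 0" unfolding K_def using lu by (intro prod_nonneg) auto
  have slice: "measure M (cbox (set_coord l b c) (set_coord u b d)) \<le> K * (d - c)" if "c \<le> d" for c d
  proof -
    have "emeasure M (cbox (set_coord l b c) (set_coord u b d))
      \<le> emeasure lborel (cbox (set_coord l b c) (set_coord u b d))" by (rule le_lborel) auto
    also have "\<dots> = ennreal (\<Prod>i\<in>Basis. (set_coord u b d - set_coord l b c) \<bullet> i)"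
      using that b lu by (intro emeasure_lborel_cbox) auto
    also have "(\<Prod>i\<in>Basis. (set_coord u b d - set_coord l b c) \<bullet> i) = K * (d - c)"
      unfolding K_def using b
      by (subst prod.remove[OF finite_Basis b]) (auto simp: inner_diff_left intro!: prod.cong)
    finally show ?thesis using K that by (simp add: emeasure_eq_measure)
  qed
  have add: "F d = F c + measure M (cbox (set_coord l b c) (set_coord u b d))"
    if "l \<bullet> b \<le> c" "c \<le> d" for c d
  proof -
    have [simp]: "set_coord (set_coord u b d) b c = set_coord u b c"
      using b by (simp add: set_coord_def inner_add_left algebra_simps)
    show ?thesis
    using emeasure_cbox_split[OF sets_M le_lborel b, of l c "set_coord u b d" UNIV] that b
    by (simp add: F_def emeasure_eq_measure flip: ennreal_plus)
  qed
  have "K-lipschitz_on {l \<bullet> b..u \<bullet> b} F"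
  proof (rule lipschitz_onI[OF _ K])
    fix c d assume cd: "c \<in> {l \<bullet> b..u \<bullet> b}" "d \<in> {l \<bullet> b..u \<bullet> b}"
    have le: "\<bar>F d - F c\<bar> \<le> K * (d - c)" if "l \<bullet> b \<le> c" "c \<le> d" for c d
      using slice[OF that(2)] add[OF that] measure_nonneg[of M] by simp
    show "dist (F c) (F d) \<le> K * dist c d"
      using le[of c d] le[of d c] cd by (cases "c \<le> d") (auto simp: dist_real_def abs_minus_commute)
  qed
  then have cont: "continuous_on {l \<bullet> b..u \<bullet> b} F" by (rule lipschitz_on_continuous_on)
  have "F (l \<bullet> b) \<le> K * (l \<bullet> b - l \<bullet> b)"
    using slice[of "l \<bullet> b" "l \<bullet> b"] by (simp add: F_def set_coord_def)
  then have "F (l \<bullet> b) \<le> v" using v by simp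
  moreover have "v \<le> F (u \<bullet> b)" using v by (simp add: F_def set_coord_def)
  ultimately obtain c where "l \<bullet> b \<le> c" "c \<le> u \<bullet> b" "F c = v"
    using IVT'[of F "l \<bullet> b" v "u \<bullet> b"] lu[OF b] cont by auto
  then show ?thesis using that by (auto simp: F_def)
qed

text \<open>The weighted inequality of arithmetic and geometric means in each factor, together with
  \<open>m = m powr (1 - t) * m powr t\<close>. This is the Brunn-Minkowski inequality for two
  parallel boxes. A positive \<open>m\<close> forces all factors to be positive.\<close>

lemma prod_convex_combination_ge:
  fixes a b :: "'i \<Rightarrow> real"
  assumes I: "finite I" and nonneg: "\<And>i. i \<in> I \<Longrightarrow> 0 \<le> a i" "\<And>i. i \<in> I \<Longrightarrow> 0 \<le> b i"
    and m: "m \<le> prod a I" "m \<le> prod b I" and t: "0 \<le> t" "t \<le> 1"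
  shows "m \<le> (\<Prod>i\<in>I. (1 - t) * a i + t * b i)"
proof (cases "m > 0")
  case False
  moreover have "0 \<le> (\<Prod>i\<in>I. (1 - t) * a i + t * b i)" using nonneg t by (intro prod_nonneg) auto
  ultimately show ?thesis by linarith
next
  case True
  then have "prod a I \<noteq> 0" "prod b I \<noteq> 0" using m by auto
  then have pos: "0 < a i" "0 < b i" if "i \<in> I" for i
    using I that nonneg[of i] by (auto simp: less_le)
  have "m = m powr (1 - t) * m powr t" using True by (simp flip: powr_add)
  also have "\<dots> \<le> prod a I powr (1 - t) * prod b I powr t"
    using True m t by (intro mult_mono powr_mono2) auto
  also have "\<dots> = (\<Prod>i\<in>I. a i powr (1 - t) * b i powr t)"
    using nonneg by (simp add: prod_powr_distrib prod.distrib)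
  also have "\<dots> \<le> (\<Prod>i\<in>I. (1 - t) * a i + t * b i)"
    using pos t by (intro prod_mono conjI Youngs_inequality_0) auto
  finally show ?thesis .
qed

lemma convex_combination_mem_cbox:
  assumes "x \<in> cbox l u" "z \<in> cbox l' u'" "0 \<le> t" "t \<le> 1"
  shows "(1 - t) *\<^sub>R x + t *\<^sub>R z \<in> cbox ((1 - t) *\<^sub>R l + t *\<^sub>R l') ((1 - t) *\<^sub>R u + t *\<^sub>R u')"
  using assms by (auto simp: mem_box inner_add_left intro!: add_mono mult_left_mono)

section \<open>Densities that couple the mass of two boxes\<close>

text \<open>\<open>h\<close> is a density with respect to the product measure whose marginals are
  the restrictions of \<open>\<rho>\<close> and \<open>\<sigma>\<close> to the boxes; as a function
  it can be added over subboxes. Inside a tiny box only the total mass is under control, so the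
  interpolated mass of \<open>U\<close> is compared with the volume of a set \<open>V\<close> around
  it. Intersecting \<open>V\<close> with the interpolated box makes this bound additive under
  cuts.\<close>

definition box_coupling :: "'a::euclidean_space measure \<Rightarrow> 'a measure \<Rightarrow> real
    \<Rightarrow> 'a \<Rightarrow> 'a \<Rightarrow> 'a \<Rightarrow> 'a \<Rightarrow> ('a \<times> 'a \<Rightarrow> ennreal) \<Rightarrow> bool" where
  "box_coupling \<rho> \<sigma> \<epsilon> l u l' u' h \<longleftrightarrow> h \<in> borel_measurable (borel \<Otimes>\<^sub>M borel) \<and>
    (\<forall>X\<in>sets borel. (\<integral>\<^sup>+ p. h p * indicator (X \<times> UNIV) p \<partial>(\<rho> \<Otimes>\<^sub>M \<sigma>)) = emeasure \<rho> (X \<inter> cbox l u)) \<and>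
    (\<forall>Z\<in>sets borel. (\<integral>\<^sup>+ p. h p * indicator (UNIV \<times> Z) p \<partial>(\<rho> \<Otimes>\<^sub>M \<sigma>)) = emeasure \<sigma> (Z \<inter> cbox l' u')) \<and>
    (\<forall>t\<in>{0..1}. \<forall>U\<in>sets borel. \<forall>V\<in>sets borel. (\<forall>y\<in>U. ball y \<epsilon> \<subseteq> V) \<longrightarrow>
      (\<integral>\<^sup>+ p. h p * indicator {p. (1 - t) *\<^sub>R fst p + t *\<^sub>R snd p \<in> U} p \<partial>(\<rho> \<Otimes>\<^sub>M \<sigma>))
        \<le> emeasure lborel (V \<inter> cbox ((1 - t) *\<^sub>R l + t *\<^sub>R l') ((1 - t) *\<^sub>R u + t *\<^sub>R u')))"

locale sub_lebesgue_pair = r: sub_lebesgue \<rho> + s: sub_lebesgue \<sigma>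
  for \<rho> \<sigma> :: "'a::euclidean_space measure"
begin

sublocale rs: pair_prob_space \<rho> \<sigma> ..

lemma sets_pair [simp]: "sets (\<rho> \<Otimes>\<^sub>M \<sigma>) = sets (borel \<Otimes>\<^sub>M borel)"
  by (intro sets_pair_measure_cong) simp_all

lemma borel_measurable_pair [simp]: "borel_measurable (\<rho> \<Otimes>\<^sub>M \<sigma>) = borel_measurable (borel \<Otimes>\<^sub>M borel)"
  by (intro measurable_cong_sets) simp_all

lemma interpolation_sets [measurable]:
  "U \<in> sets borel \<Longrightarrow> {p. (1 - t) *\<^sub>R fst p + t *\<^sub>R snd p \<in> U} \<in> sets (borel \<Otimes>\<^sub>M (borel :: 'a measure))"
  using measurable_sets[of "\<lambda>p. (1 - t) *\<^sub>R fst p + t *\<^sub>R snd p" "borel \<Otimes>\<^sub>M (borel :: 'a measure)" borel U]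
  by (simp add: vimage_def space_pair_measure)

text \<open>The interpolated box has at least the mass \<open>m\<close> by the inequality of arithmetic and
  geometric means, and by its smallness it lies in \<open>V\<close> as soon as it meets \<open>U\<close>.\<close>

lemma box_coupling_small:
  fixes \<delta> :: real
  assumes side: "\<And>b. b \<in> Basis \<Longrightarrow> l \<bullet> b \<le> u \<bullet> b" "\<And>b. b \<in> Basis \<Longrightarrow> u \<bullet> b - l \<bullet> b \<le> \<delta>"
    and side': "\<And>b. b \<in> Basis \<Longrightarrow> l' \<bullet> b \<le> u' \<bullet> b" "\<And>b. b \<in> Basis \<Longrightarrow> u' \<bullet> b - l' \<bullet> b \<le> \<delta>"
    and small: "DIM('a) * \<delta> < \<epsilon>"
    and mass: "measure \<rho> (cbox l u) = measure \<sigma> (cbox l' u')"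
  shows "\<exists>h. box_coupling \<rho> \<sigma> \<epsilon> l u l' u' h"
proof -
  define m where "m = measure \<rho> (cbox l u)"
  have m: "emeasure \<rho> (cbox l u) = ennreal m" "emeasure \<sigma> (cbox l' u') = ennreal m" "m \<ge> 0"
    using mass by (simp_all add: m_def r.emeasure_eq_measure s.emeasure_eq_measure)
  \<comment> \<open>The normalised product of the two restrictions. For \<open>m = 0\<close> it is
    infinite on the product of the boxes, but that set is null, and the integrals vanish because
    \<open>0 / 0 = 0\<close> in \<open>ennreal\<close>.\<close>
  define h :: "'a \<times> 'a \<Rightarrow> ennreal" where "h p = indicator (cbox l u \<times> cbox l' u') p / ennreal m" for p
  have h_meas [measurable]: "h \<in> borel_measurable (borel \<Otimes>\<^sub>M borel)"
    unfolding h_def by measurable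
  have times: "(\<integral>\<^sup>+ p. h p * indicator (X \<times> Z) p \<partial>(\<rho> \<Otimes>\<^sub>M \<sigma>))
      = emeasure \<rho> (X \<inter> cbox l u) * emeasure \<sigma> (Z \<inter> cbox l' u') / ennreal m"
    if [measurable]: "X \<in> sets borel" "Z \<in> sets borel" for X Z
  proof -
    have "(\<integral>\<^sup>+ p. h p * indicator (X \<times> Z) p \<partial>(\<rho> \<Otimes>\<^sub>M \<sigma>))
      = (\<integral>\<^sup>+ p. indicator ((X \<inter> cbox l u) \<times> (Z \<inter> cbox l' u')) p / ennreal m \<partial>(\<rho> \<Otimes>\<^sub>M \<sigma>))"
      by (intro nn_integral_cong) (auto simp: h_def indicator_def)
    also have "\<dots> = (\<integral>\<^sup>+ p. indicator ((X \<inter> cbox l u) \<times> (Z \<inter> cbox l' u')) p \<partial>(\<rho> \<Otimes>\<^sub>M \<sigma>)) / ennreal m"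
      by (intro nn_integral_divide) (simp, measurable)
    also have "\<dots> = emeasure (\<rho> \<Otimes>\<^sub>M \<sigma>) ((X \<inter> cbox l u) \<times> (Z \<inter> cbox l' u')) / ennreal m"
      by (subst nn_integral_indicator) auto
    also have "\<dots> = emeasure \<rho> (X \<inter> cbox l u) * emeasure \<sigma> (Z \<inter> cbox l' u') / ennreal m"
      by (subst s.emeasure_pair_measure_Times) auto
    finally show ?thesis .
  qed
  have cancel: "a * ennreal m / ennreal m = a" if "a \<le> ennreal m" for a
    using that m(3) by (cases "m = 0") (auto simp: ennreal_mult_divide_eq)
  have le_m: "emeasure \<rho> (X \<inter> cbox l u) \<le> ennreal m" "emeasure \<sigma> (X \<inter> cbox l' u') \<le> ennreal m" for X
    using emeasure_mono[of "X \<inter> cbox l u" "cbox l u" \<rho>] emeasure_mono[of "X \<inter> cbox l' u'" "cbox l' u'" \<sigma>]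
    unfolding m(1,2) by auto
  have "box_coupling \<rho> \<sigma> \<epsilon> l u l' u' h"
    unfolding box_coupling_def
  proof (intro conjI ballI impI h_meas)
    show "(\<integral>\<^sup>+ p. h p * indicator (X \<times> UNIV) p \<partial>(\<rho> \<Otimes>\<^sub>M \<sigma>)) = emeasure \<rho> (X \<inter> cbox l u)"
      if "X \<in> sets borel" for X
      using times[OF that, of UNIV] cancel[OF le_m(1)] m by simp
    show "(\<integral>\<^sup>+ p. h p * indicator (UNIV \<times> Z) p \<partial>(\<rho> \<Otimes>\<^sub>M \<sigma>)) = emeasure \<sigma> (Z \<inter> cbox l' u')"
      if "Z \<in> sets borel" for Z
      using times[of UNIV, OF _ that] cancel[OF le_m(2)] m by (simp add: mult.commute)
  next
    fix t :: real and U V :: "'a set"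
    assume t: "t \<in> {0..1}" and [measurable]: "U \<in> sets borel" "V \<in> sets borel" and UV: "\<forall>y\<in>U. ball y \<epsilon> \<subseteq> V"
    define lt where "lt = (1 - t) *\<^sub>R l + t *\<^sub>R l'"
    define ut where "ut = (1 - t) *\<^sub>R u + t *\<^sub>R u'"
    have side_t: "ut \<bullet> b - lt \<bullet> b = (1 - t) * (u \<bullet> b - l \<bullet> b) + t * (u' \<bullet> b - l' \<bullet> b)" for b
      by (simp add: lt_def ut_def inner_add_left algebra_simps)
    have side_le: "ut \<bullet> b - lt \<bullet> b \<le> \<delta>" "lt \<bullet> b \<le> ut \<bullet> b" if "b \<in> Basis" for b
    proof -
      show "ut \<bullet> b - lt \<bullet> b \<le> \<delta>"
        unfolding side_t using side(2)[OF that] side'(2)[OF that] t by (intro convex_bound_le) auto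
      have "0 \<le> ut \<bullet> b - lt \<bullet> b"
        unfolding side_t using side(1)[OF that] side'(1)[OF that] t by auto
      then show "lt \<bullet> b \<le> ut \<bullet> b" by simp
    qed
    show "(\<integral>\<^sup>+ p. h p * indicator {p. (1 - t) *\<^sub>R fst p + t *\<^sub>R snd p \<in> U} p \<partial>(\<rho> \<Otimes>\<^sub>M \<sigma>))
        \<le> emeasure lborel (V \<inter> cbox ((1 - t) *\<^sub>R l + t *\<^sub>R l') ((1 - t) *\<^sub>R u + t *\<^sub>R u'))"
      unfolding lt_def[symmetric] ut_def[symmetric]
    proof (cases "U \<inter> cbox lt ut = {}")
      case True
      then have eq_0: "h p * indicator {p. (1 - t) *\<^sub>R fst p + t *\<^sub>R snd p \<in> U} p = 0" for p
        using convex_combination_mem_cbox[of "fst p" l u "snd p" l' u' t] t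
        by (cases p) (auto simp: h_def indicator_def lt_def ut_def)
      show "(\<integral>\<^sup>+ p. h p * indicator {p. (1 - t) *\<^sub>R fst p + t *\<^sub>R snd p \<in> U} p \<partial>(\<rho> \<Otimes>\<^sub>M \<sigma>))
        \<le> emeasure lborel (V \<inter> cbox lt ut)" unfolding eq_0 by simp
    next
      case False
      then obtain y where y: "y \<in> U" "y \<in> cbox lt ut" by blast
      have "cbox lt ut \<subseteq> ball y \<epsilon>"
      proof
        fix x assume x: "x \<in> cbox lt ut"
        have "\<bar>(x - y) \<bullet> b\<bar> \<le> \<delta>" if "b \<in> Basis" for b
          using x y(2) side_le(1)[OF that] that by (fastforce simp: mem_box inner_diff_left)
        then have "norm (x - y) \<le> (\<Sum>b\<in>(Basis :: 'a set). \<delta>)"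
          by (intro order.trans[OF norm_le_l1 sum_mono])
        then show "x \<in> ball y \<epsilon>" using small by (simp add: dist_norm norm_minus_commute)
      qed
      then have V: "V \<inter> cbox lt ut = cbox lt ut" using UV y(1) by blast
      have "(\<integral>\<^sup>+ p. h p * indicator {p. (1 - t) *\<^sub>R fst p + t *\<^sub>R snd p \<in> U} p \<partial>(\<rho> \<Otimes>\<^sub>M \<sigma>))
        \<le> (\<integral>\<^sup>+ p. h p * indicator (UNIV \<times> UNIV) p \<partial>(\<rho> \<Otimes>\<^sub>M \<sigma>))"
        by (intro nn_integral_mono) (auto simp: indicator_def)
      also have "\<dots> = ennreal m" using times[of UNIV UNIV] cancel[of "ennreal m"] m by simp
      also have "m \<le> (\<Prod>b\<in>Basis. (1 - t) * (u \<bullet> b - l \<bullet> b) + t * (u' \<bullet> b - l' \<bullet> b))"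
      proof (rule prod_convex_combination_ge)
        have "ennreal m \<le> emeasure lborel (cbox l u)" unfolding m(1)[symmetric] by (rule r.le_lborel) simp
        also have "\<dots> = ennreal (\<Prod>b\<in>Basis. u \<bullet> b - l \<bullet> b)"
          using side(1) by (simp add: emeasure_lborel_cbox_eq inner_diff_left)
        finally show "m \<le> (\<Prod>b\<in>Basis. u \<bullet> b - l \<bullet> b)"
          using side(1) by (subst (asm) ennreal_le_iff) (auto intro!: prod_nonneg)
        have "ennreal m \<le> emeasure lborel (cbox l' u')" unfolding m(2)[symmetric] by (rule s.le_lborel) simp
        also have "\<dots> = ennreal (\<Prod>b\<in>Basis. u' \<bullet> b - l' \<bullet> b)"
          using side'(1) by (simp add: emeasure_lborel_cbox_eq inner_diff_left)
        finally show "m \<le> (\<Prod>b\<in>Basis. u' \<bullet> b - l' \<bullet> b)"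
          using side'(1) by (subst (asm) ennreal_le_iff) (auto intro!: prod_nonneg)
      qed (use side side' t in auto)
      then have "ennreal m \<le> emeasure lborel (cbox lt ut)"
        using side_le(2) by (simp add: emeasure_lborel_cbox_eq inner_diff_left side_t ennreal_leI)
      finally show "(\<integral>\<^sup>+ p. h p * indicator {p. (1 - t) *\<^sub>R fst p + t *\<^sub>R snd p \<in> U} p \<partial>(\<rho> \<Otimes>\<^sub>M \<sigma>))
        \<le> emeasure lborel (V \<inter> cbox lt ut)" unfolding V .
    qed
  qed
  then show ?thesis by blast
qed

text \<open>Marginals add because the overlap of the halves is null. The volume bounds add because
  the interpolated box is cut at the interpolated height \<open>(1 - t) * c + t * c'\<close>, which
  yields exactly the interpolated halves.\<close>

lemma box_coupling_join:
  assumes b: "b \<in> Basis" and c: "l \<bullet> b \<le> c" "c \<le> u \<bullet> b" and c': "l' \<bullet> b \<le> c'" "c' \<le> u' \<bullet> b"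
    and h1: "box_coupling \<rho> \<sigma> \<epsilon> l (set_coord u b c) l' (set_coord u' b c') h1"
    and h2: "box_coupling \<rho> \<sigma> \<epsilon> (set_coord l b c) u (set_coord l' b c') u' h2"
  shows "box_coupling \<rho> \<sigma> \<epsilon> l u l' u' (\<lambda>p. h1 p + h2 p)"
proof -
  have [measurable]: "h1 \<in> borel_measurable (borel \<Otimes>\<^sub>M borel)" "h2 \<in> borel_measurable (borel \<Otimes>\<^sub>M borel)"
    using h1 h2 by (auto simp: box_coupling_def)
  have add: "(\<integral>\<^sup>+ p. (h1 p + h2 p) * indicator S p \<partial>(\<rho> \<Otimes>\<^sub>M \<sigma>))
    = (\<integral>\<^sup>+ p. h1 p * indicator S p \<partial>(\<rho> \<Otimes>\<^sub>M \<sigma>)) + (\<integral>\<^sup>+ p. h2 p * indicator S p \<partial>(\<rho> \<Otimes>\<^sub>M \<sigma>))"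
    if [measurable]: "S \<in> sets (borel \<Otimes>\<^sub>M borel)" for S
    unfolding distrib_right by (intro nn_integral_add) simp_all
  show ?thesis
    unfolding box_coupling_def
  proof (intro conjI ballI impI)
    show "(\<integral>\<^sup>+ p. (h1 p + h2 p) * indicator (X \<times> UNIV) p \<partial>(\<rho> \<Otimes>\<^sub>M \<sigma>)) = emeasure \<rho> (X \<inter> cbox l u)"
      if "X \<in> sets borel" for X
      using h1 h2 that emeasure_cbox_split[OF r.sets_M r.le_lborel b c that]
      by (subst add) (auto simp: box_coupling_def)
    show "(\<integral>\<^sup>+ p. (h1 p + h2 p) * indicator (UNIV \<times> Z) p \<partial>(\<rho> \<Otimes>\<^sub>M \<sigma>)) = emeasure \<sigma> (Z \<inter> cbox l' u')"
      if "Z \<in> sets borel" for Z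
      using h1 h2 that emeasure_cbox_split[OF s.sets_M s.le_lborel b c' that]
      by (subst add) (auto simp: box_coupling_def)
  next
    fix t :: real and U V :: "'a set"
    assume t: "t \<in> {0..1}" and U [measurable]: "U \<in> sets borel" and V [measurable]: "V \<in> sets borel"
      and UV: "\<forall>y\<in>U. ball y \<epsilon> \<subseteq> V"
    define lt where "lt = (1 - t) *\<^sub>R l + t *\<^sub>R l'"
    define ut where "ut = (1 - t) *\<^sub>R u + t *\<^sub>R u'"
    define ct where "ct = (1 - t) * c + t * c'"
    have ct: "lt \<bullet> b \<le> ct" "ct \<le> ut \<bullet> b"
      using c c' t by (auto simp: lt_def ut_def ct_def inner_add_left intro!: add_mono mult_left_mono)
    have "(\<integral>\<^sup>+ p. (h1 p + h2 p) * indicator {p. (1 - t) *\<^sub>R fst p + t *\<^sub>R snd p \<in> U} p \<partial>(\<rho> \<Otimes>\<^sub>M \<sigma>))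
      = (\<integral>\<^sup>+ p. h1 p * indicator {p. (1 - t) *\<^sub>R fst p + t *\<^sub>R snd p \<in> U} p \<partial>(\<rho> \<Otimes>\<^sub>M \<sigma>)) +
        (\<integral>\<^sup>+ p. h2 p * indicator {p. (1 - t) *\<^sub>R fst p + t *\<^sub>R snd p \<in> U} p \<partial>(\<rho> \<Otimes>\<^sub>M \<sigma>))"
      by (rule add) measurable
    also have "\<dots> \<le> emeasure lborel (V \<inter> cbox lt (set_coord ut b ct))
      + emeasure lborel (V \<inter> cbox (set_coord lt b ct) ut)"
      using h1 h2 t U V UV unfolding box_coupling_def set_coord_affine lt_def ut_def ct_def
      by (intro add_mono) blast+
    also have "\<dots> = emeasure lborel (V \<inter> cbox lt ut)"
      by (rule emeasure_cbox_split[OF sets_lborel _ b ct V, symmetric]) simp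
    finally show "(\<integral>\<^sup>+ p. (h1 p + h2 p) * indicator {p. (1 - t) *\<^sub>R fst p + t *\<^sub>R snd p \<in> U} p \<partial>(\<rho> \<Otimes>\<^sub>M \<sigma>))
        \<le> emeasure lborel (V \<inter> cbox ((1 - t) *\<^sub>R l + t *\<^sub>R l') ((1 - t) *\<^sub>R u + t *\<^sub>R u'))"
      unfolding lt_def ut_def .
  qed measurable
qed

lemma midpoint_bounds:
  fixes l u d e :: real
  assumes "u - l \<le> d" "d = 2 * e"
  shows "(l + u) / 2 - l \<le> e" "u - (l + u) / 2 \<le> e"
  using assms by (simp_all add: field_simps)

text \<open>\<open>k b\<close> and \<open>k' b\<close> bound the number of halvings that direction
  \<open>b\<close> still requires in either box, and the induction is on their total. Each box has
  its own exponents because only one of the two is halved at a time.\<close>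

lemma box_coupling_exists:
  fixes \<delta> :: real
  assumes \<delta>: "\<delta> \<ge> 0" "DIM('a) * \<delta> < \<epsilon>"
    and side: "\<And>b. b \<in> Basis \<Longrightarrow> l \<bullet> b \<le> u \<bullet> b" "\<And>b. b \<in> Basis \<Longrightarrow> u \<bullet> b - l \<bullet> b \<le> \<delta> * 2 ^ k b"
    and side': "\<And>b. b \<in> Basis \<Longrightarrow> l' \<bullet> b \<le> u' \<bullet> b" "\<And>b. b \<in> Basis \<Longrightarrow> u' \<bullet> b - l' \<bullet> b \<le> \<delta> * 2 ^ k' b"
    and mass: "measure \<rho> (cbox l u) = measure \<sigma> (cbox l' u')"
  shows "\<exists>h. box_coupling \<rho> \<sigma> \<epsilon> l u l' u' h"
  using side side' mass
proof (induction "\<Sum>b\<in>(Basis :: 'a set). k b + k' b" arbitrary: l u l' u' k k' rule: less_induct)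
  case less
  note side = less.prems(1,2) and side' = less.prems(3,4) and mass = less.prems(5)
  show ?case
  proof (cases "\<forall>b\<in>Basis. k b = 0 \<and> k' b = 0")
    case True
    then have "u \<bullet> b - l \<bullet> b \<le> \<delta>" "u' \<bullet> b - l' \<bullet> b \<le> \<delta>" if "b \<in> Basis" for b
      using side(2)[OF that] side'(2)[OF that] that by simp_all
    then show ?thesis by (intro box_coupling_small[OF side(1) _ side'(1) _ \<delta>(2) mass])
  next
    case False
    then obtain b where b: "b \<in> Basis" and "k b > 0 \<or> k' b > 0" by auto
    have lt: "(\<Sum>b\<in>(Basis :: 'a set). k1 b + k1' b) < (\<Sum>b\<in>(Basis :: 'a set). k b + k' b)"
      if "\<And>i. k1 i \<le> k i" "\<And>i. k1' i \<le> k' i" "k1 b < k b \<or> k1' b < k' b" for k1 k1'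
    proof (rule sum_strict_mono_ex1)
      show "\<exists>i\<in>Basis. k1 i + k1' i < k i + k' i"
        using that(1)[of b] that(2)[of b] that(3) by (intro bexI[OF _ b]) linarith
    qed (simp_all add: add_mono that)
    \<comment> \<open>One box is cut at its midpoint, which lowers its exponent. The other is cut by
      a parallel hyperplane where the masses match; that cut may be uneven, but it lengthens no
      side, so the exponents there stay.\<close>
    have "\<exists>c c' k1 k1'. l \<bullet> b \<le> c \<and> c \<le> u \<bullet> b \<and> l' \<bullet> b \<le> c' \<and> c' \<le> u' \<bullet> b \<and>
      measure \<rho> (cbox l (set_coord u b c)) = measure \<sigma> (cbox l' (set_coord u' b c')) \<and>
      (\<Sum>b\<in>(Basis :: 'a set). k1 b + k1' b) < (\<Sum>b\<in>(Basis :: 'a set). k b + k' b) \<and>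
      (\<forall>i\<in>Basis. set_coord u b c \<bullet> i - l \<bullet> i \<le> \<delta> * 2 ^ k1 i \<and> u \<bullet> i - set_coord l b c \<bullet> i \<le> \<delta> * 2 ^ k1 i \<and>
        set_coord u' b c' \<bullet> i - l' \<bullet> i \<le> \<delta> * 2 ^ k1' i \<and> u' \<bullet> i - set_coord l' b c' \<bullet> i \<le> \<delta> * 2 ^ k1' i)"
      using \<open>k b > 0 \<or> k' b > 0\<close>
    proof
      assume k: "k b > 0"
      define c where "c = (l \<bullet> b + u \<bullet> b) / 2"
      have c: "l \<bullet> b \<le> c" "c \<le> u \<bullet> b" using side(1)[OF b] by (auto simp: c_def)
      have "measure \<rho> (cbox l (set_coord u b c)) \<le> measure \<rho> (cbox l u)"
        using cbox_set_coord(1)[OF b c] by (intro r.finite_measure_mono) auto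
      then have le: "measure \<rho> (cbox l (set_coord u b c)) \<le> measure \<sigma> (cbox l' u')" using mass by simp
      obtain c' where c': "l' \<bullet> b \<le> c'" "c' \<le> u' \<bullet> b"
        "measure \<sigma> (cbox l' (set_coord u' b c')) = measure \<rho> (cbox l (set_coord u b c))"
        by (rule s.cbox_cut_with_mass[OF b side'(1) measure_nonneg le]) (assumption, rule that)
      have half: "c - l \<bullet> b \<le> \<delta> * 2 ^ (k b - 1)" "u \<bullet> b - c \<le> \<delta> * 2 ^ (k b - 1)"
      proof -
        have "\<delta> * 2 ^ k b = 2 * (\<delta> * 2 ^ (k b - 1))" using k by (cases "k b") simp_all
        from midpoint_bounds[OF side(2)[OF b] this]
        show "c - l \<bullet> b \<le> \<delta> * 2 ^ (k b - 1)" "u \<bullet> b - c \<le> \<delta> * 2 ^ (k b - 1)"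
          unfolding c_def .
      qed
      have sA: "set_coord u b c \<bullet> i - l \<bullet> i \<le> \<delta> * 2 ^ (k(b := k b - 1)) i"
        "u \<bullet> i - set_coord l b c \<bullet> i \<le> \<delta> * 2 ^ (k(b := k b - 1)) i" if "i \<in> Basis" for i
        using side(2)[OF that] half b that by (cases "i = b"; simp)+
      have sB: "set_coord u' b c' \<bullet> i - l' \<bullet> i \<le> \<delta> * 2 ^ k' i"
        "u' \<bullet> i - set_coord l' b c' \<bullet> i \<le> \<delta> * 2 ^ k' i" if "i \<in> Basis" for i
        using side'(2)[OF that] b that c'(1,2) by (cases "i = b"; simp)+
      have "(\<Sum>i\<in>(Basis :: 'a set). (k(b := k b - 1)) i + k' i) < (\<Sum>b\<in>(Basis :: 'a set). k b + k' b)"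
        by (rule lt) (use k in simp_all)
      then show ?thesis
        by (intro exI[of _ c] exI[of _ c'] exI[of _ "k(b := k b - 1)"] exI[of _ k'] conjI ballI c c'(1,2) c'(3)[symmetric] sA sB)
    next
      assume k: "k' b > 0"
      define c' where "c' = (l' \<bullet> b + u' \<bullet> b) / 2"
      have c': "l' \<bullet> b \<le> c'" "c' \<le> u' \<bullet> b" using side'(1)[OF b] by (auto simp: c'_def)
      have "measure \<sigma> (cbox l' (set_coord u' b c')) \<le> measure \<sigma> (cbox l' u')"
        using cbox_set_coord(1)[OF b c'] by (intro s.finite_measure_mono) auto
      then have le: "measure \<sigma> (cbox l' (set_coord u' b c')) \<le> measure \<rho> (cbox l u)" using mass by simp
      obtain c where c: "l \<bullet> b \<le> c" "c \<le> u \<bullet> b"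
        "measure \<rho> (cbox l (set_coord u b c)) = measure \<sigma> (cbox l' (set_coord u' b c'))"
        by (rule r.cbox_cut_with_mass[OF b side(1) measure_nonneg le]) (assumption, rule that)
      have half: "c' - l' \<bullet> b \<le> \<delta> * 2 ^ (k' b - 1)" "u' \<bullet> b - c' \<le> \<delta> * 2 ^ (k' b - 1)"
      proof -
        have "\<delta> * 2 ^ k' b = 2 * (\<delta> * 2 ^ (k' b - 1))" using k by (cases "k' b") simp_all
        from midpoint_bounds[OF side'(2)[OF b] this]
        show "c' - l' \<bullet> b \<le> \<delta> * 2 ^ (k' b - 1)" "u' \<bullet> b - c' \<le> \<delta> * 2 ^ (k' b - 1)"
          unfolding c'_def .
      qed
      have sA: "set_coord u' b c' \<bullet> i - l' \<bullet> i \<le> \<delta> * 2 ^ (k'(b := k' b - 1)) i"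
        "u' \<bullet> i - set_coord l' b c' \<bullet> i \<le> \<delta> * 2 ^ (k'(b := k' b - 1)) i" if "i \<in> Basis" for i
        using side'(2)[OF that] half b that by (cases "i = b"; simp)+
      have sB: "set_coord u b c \<bullet> i - l \<bullet> i \<le> \<delta> * 2 ^ k i"
        "u \<bullet> i - set_coord l b c \<bullet> i \<le> \<delta> * 2 ^ k i" if "i \<in> Basis" for i
        using side(2)[OF that] b that c(1,2) by (cases "i = b"; simp)+
      have "(\<Sum>i\<in>(Basis :: 'a set). k i + (k'(b := k' b - 1)) i) < (\<Sum>b\<in>(Basis :: 'a set). k b + k' b)"
        by (rule lt) (use k in simp_all)
      then show ?thesis
        by (intro exI[of _ c] exI[of _ c'] exI[of _ k] exI[of _ "k'(b := k' b - 1)"] conjI ballI c c' sA sB)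
    qed
    then obtain c c' k1 k1' where c: "l \<bullet> b \<le> c" "c \<le> u \<bullet> b" and c': "l' \<bullet> b \<le> c'" "c' \<le> u' \<bullet> b"
      and mass1: "measure \<rho> (cbox l (set_coord u b c)) = measure \<sigma> (cbox l' (set_coord u' b c'))"
      and less1: "(\<Sum>b\<in>(Basis :: 'a set). k1 b + k1' b) < (\<Sum>b\<in>(Basis :: 'a set). k b + k' b)"
      and sides: "\<And>i. i \<in> Basis \<Longrightarrow> set_coord u b c \<bullet> i - l \<bullet> i \<le> \<delta> * 2 ^ k1 i"
        "\<And>i. i \<in> Basis \<Longrightarrow> u \<bullet> i - set_coord l b c \<bullet> i \<le> \<delta> * 2 ^ k1 i"
        "\<And>i. i \<in> Basis \<Longrightarrow> set_coord u' b c' \<bullet> i - l' \<bullet> i \<le> \<delta> * 2 ^ k1' i"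
        "\<And>i. i \<in> Basis \<Longrightarrow> u' \<bullet> i - set_coord l' b c' \<bullet> i \<le> \<delta> * 2 ^ k1' i"
      by blast
    have "measure \<rho> (cbox l u) = measure \<rho> (cbox l (set_coord u b c)) + measure \<rho> (cbox (set_coord l b c) u)"
      using emeasure_cbox_split[OF r.sets_M r.le_lborel b c, of UNIV]
      by (simp add: r.emeasure_eq_measure flip: ennreal_plus)
    moreover have "measure \<sigma> (cbox l' u') = measure \<sigma> (cbox l' (set_coord u' b c')) + measure \<sigma> (cbox (set_coord l' b c') u')"
      using emeasure_cbox_split[OF s.sets_M s.le_lborel b c', of UNIV]
      by (simp add: s.emeasure_eq_measure flip: ennreal_plus)
    ultimately have mass2: "measure \<rho> (cbox (set_coord l b c) u) = measure \<sigma> (cbox (set_coord l' b c') u')"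
      using mass mass1 by simp
    have ordered: "l \<bullet> i \<le> set_coord u b c \<bullet> i" "l' \<bullet> i \<le> set_coord u' b c' \<bullet> i"
      "set_coord l b c \<bullet> i \<le> u \<bullet> i" "set_coord l' b c' \<bullet> i \<le> u' \<bullet> i" if "i \<in> Basis" for i
      using side(1)[OF that] side'(1)[OF that] b c c' that by (cases "i = b"; simp)+
    obtain h1 where "box_coupling \<rho> \<sigma> \<epsilon> l (set_coord u b c) l' (set_coord u' b c') h1"
      using less.hyps[OF less1 ordered(1) sides(1) ordered(2) sides(3) mass1] by blast
    moreover obtain h2 where "box_coupling \<rho> \<sigma> \<epsilon> (set_coord l b c) u (set_coord l' b c') u' h2"
      using less.hyps[OF less1 ordered(3) sides(2) ordered(4) sides(4) mass2] by blast
    ultimately show ?thesis using box_coupling_join[OF b c c'] by blast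
  qed
qed

end

section \<open>A coupling whose interpolations have bounded density\<close>

text \<open>A large cube carries more than \<open>v\<close> and can be trimmed in one coordinate.
  \<open>v\<close> stays below 1 because no bounded box need carry the full mass.\<close>

lemma (in sub_lebesgue) box_with_mass:
  assumes v: "0 \<le> v" "v < 1"
  obtains l u where "\<And>b. b \<in> Basis \<Longrightarrow> l \<bullet> b \<le> u \<bullet> b" "measure M (cbox l u) = v"
proof -
  define C where "C n = cbox (- (real n *\<^sub>R One)) (real n *\<^sub>R One :: 'a)" for n :: nat
  have "(\<Union>n. C n) = UNIV"
    using UN_box_eq_UNIV box_subset_cbox unfolding C_def by blast
  moreover have "incseq C"
    by (rule incseq_SucI) (simp add: C_def subset_box)
  ultimately have "(\<lambda>n. measure M (C n)) \<longlonglongrightarrow> measure M UNIV"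
    using finite_Lim_measure_incseq[of C] by (simp add: C_def image_subset_iff)
  then have "\<forall>\<^sub>F n in sequentially. v < measure M (C n)"
    using v prob_space by (intro order_tendstoD(1)) simp_all
  then have "\<exists>n. v < measure M (C n)" by (rule eventually_happens'[rotated]) simp
  then obtain n where n: "v < measure M (C n)" by blast
  obtain b :: 'a where b: "b \<in> Basis" using nonempty_Basis by blast
  define l u where "l = - (real n *\<^sub>R One :: 'a)" and "u = (real n *\<^sub>R One :: 'a)"
  have lu: "l \<bullet> i \<le> u \<bullet> i" if "i \<in> Basis" for i using that by (simp add: l_def u_def)
  have "v \<le> measure M (cbox l u)" using n by (simp add: C_def l_def u_def)
  from cbox_cut_with_mass[OF b lu v(1) this]
  obtain c where c: "l \<bullet> b \<le> c" "c \<le> u \<bullet> b" "measure M (cbox l (set_coord u b c)) = v"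
    by metis
  show ?thesis
  proof (rule that[OF _ c(3)])
    show "l \<bullet> i \<le> set_coord u b c \<bullet> i" if "i \<in> Basis" for i
      using lu[OF that] c b that by (cases "i = b") simp_all
  qed
qed

text \<open>Points whose distance to the complement exceeds \<open>1 / (k + 1)\<close>. The uniform
  margin absorbs the neighbourhoods in the approximate density bound.\<close>

lemma open_exhaustion:
  fixes U :: "'a::metric_space set"
  assumes U: "open U"
  obtains W :: "nat \<Rightarrow> 'a set" where "incseq W" "\<And>k. open (W k)" "(\<Union>k. W k) = U"
    "\<And>k y. y \<in> W k \<Longrightarrow> ball y (inverse (real (Suc k))) \<subseteq> U"
\<comment> \<open>The distance \<open>infdist\<close> to the empty set is 0 by convention, so the
  whole space is a case of its own.\<close>
proof (cases "U = UNIV")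
  case True
  then show ?thesis by (intro that[of "\<lambda>_. UNIV"]) (simp_all add: incseq_const)
next
  case False
  define W where "W k = {x. inverse (real (Suc k)) < infdist x (- U)}" for k
  have pos: "x \<in> U" if "0 < infdist x (- U)" for x
    using that infdist_zero[of x "- U"] by (cases "x \<in> U") simp_all
  show ?thesis
  proof (rule that[of W])
    show "incseq W"
    proof (rule incseq_SucI, rule subsetI)
      fix k x assume "x \<in> W k"
      moreover have "inverse (real (Suc (Suc k))) \<le> inverse (real (Suc k))" by (rule le_imp_inverse_le) simp_all
      ultimately show "x \<in> W (Suc k)" unfolding W_def by (simp only: mem_Collect_eq)
    qed
    show "open (W k)" for k
      unfolding W_def by (intro open_Collect_less continuous_intros)
    show "(\<Union>k. W k) = U"
    proof (intro equalityI subsetI)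
      fix x assume "x \<in> (\<Union>k. W k)"
      then obtain k where "inverse (real (Suc k)) < infdist x (- U)" by (auto simp: W_def)
      then have "0 < infdist x (- U)" by (rule less_trans[rotated]) simp
      then show "x \<in> U" by (rule pos)
    next
      fix x assume "x \<in> U"
      then have "infdist x (- U) > 0"
        using U False by (intro infdist_pos_not_in_closed) (auto simp: closed_def)
      from reals_Archimedean[OF this] show "x \<in> (\<Union>k. W k)" by (auto simp: W_def)
    qed
    show "ball y (inverse (real (Suc k))) \<subseteq> U" if y: "y \<in> W k" for k y
    proof (rule subsetI, rule ccontr)
      fix x assume "x \<in> ball y (inverse (real (Suc k)))" "x \<notin> U"
      then show False using y infdist_le[of x "- U" y] by (simp add: W_def)
    qed
  qed
qed

context sub_lebesgue_pair
begin

text \<open>Small boxes carry almost all of the mass; the remaining mass \<open>\<eta>\<close> is coupled arbitrarily.\<close>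

lemma approximate_displacement_coupling:
  assumes "\<epsilon> > 0" and \<eta>: "0 < \<eta>" "\<eta> < 1"
  shows "\<exists>\<pi>\<in>transport_plans \<rho> \<sigma>. \<forall>t\<in>{0..1}. \<forall>U\<in>sets borel. \<forall>V\<in>sets borel. (\<forall>y\<in>U. ball y \<epsilon> \<subseteq> V) \<longrightarrow>
    emeasure \<pi> {p. (1 - t) *\<^sub>R fst p + t *\<^sub>R snd p \<in> U} \<le> emeasure lborel V + ennreal \<eta>"
proof -
  obtain l u where lu: "\<And>b. b \<in> Basis \<Longrightarrow> l \<bullet> b \<le> u \<bullet> b" "measure \<rho> (cbox l u) = 1 - \<eta>"
    using \<eta> by (elim r.box_with_mass[of "1 - \<eta>", rotated 2]) simp_all
  obtain l' u' where lu': "\<And>b. b \<in> Basis \<Longrightarrow> l' \<bullet> b \<le> u' \<bullet> b" "measure \<sigma> (cbox l' u') = 1 - \<eta>"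
    using \<eta> by (elim s.box_with_mass[of "1 - \<eta>", rotated 2]) simp_all
  define \<delta> where "\<delta> = \<epsilon> / (2 * DIM('a))"
  have \<delta>: "\<delta> > 0" "DIM('a) * \<delta> < \<epsilon>" using \<open>\<epsilon> > 0\<close> by (auto simp: \<delta>_def)
  have "\<exists>k. x \<le> \<delta> * 2 ^ k" for x
  proof -
    obtain k where "x / \<delta> < 2 ^ k" using real_arch_pow[of 2 "x / \<delta>"] by auto
    then have "x \<le> \<delta> * 2 ^ k" using \<delta>(1) by (simp add: field_simps)
    then show ?thesis ..
  qed
  then obtain K where K: "\<And>x. x \<le> \<delta> * 2 ^ K x" by metis
  obtain h where h: "box_coupling \<rho> \<sigma> \<epsilon> l u l' u' h"
    using box_coupling_exists[where k="\<lambda>b. K (u \<bullet> b - l \<bullet> b)" and k'="\<lambda>b. K (u' \<bullet> b - l' \<bullet> b)",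
        OF less_imp_le[OF \<delta>(1)] \<delta>(2) lu(1) K lu'(1) K] lu(2) lu'(2) by auto
  have [measurable]: "h \<in> borel_measurable (borel \<Otimes>\<^sub>M borel)" using h by (simp add: box_coupling_def)
  let ?A = "- cbox l u" and ?B = "- cbox l' u'"
  have mass: "emeasure \<rho> ?A = ennreal \<eta>" "emeasure \<sigma> ?B = ennreal \<eta>"
    using r.prob_compl[of "cbox l u"] s.prob_compl[of "cbox l' u'"] lu(2) lu'(2)
    by (simp_all add: r.emeasure_eq_measure s.emeasure_eq_measure Compl_eq_Diff_UNIV)
  \<comment> \<open>Outside the boxes both measures have mass \<open>\<eta>\<close>, so the product
    of these remainders divided by \<open>\<eta>\<close> has the missing marginals, and it adds at
    most \<open>\<eta>\<close> to any set.\<close>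
  define g :: "'a \<times> 'a \<Rightarrow> ennreal" where "g p = h p + indicator (?A \<times> ?B) p / ennreal \<eta>" for p
  have [measurable]: "g \<in> borel_measurable (borel \<Otimes>\<^sub>M borel)" unfolding g_def by measurable
  define \<pi> where "\<pi> = density (\<rho> \<Otimes>\<^sub>M \<sigma>) g"
  have sets_\<pi>: "sets \<pi> = sets borel" unfolding \<pi>_def sets_density sets_pair borel_prod ..
  have \<pi>: "emeasure \<pi> S = (\<integral>\<^sup>+ p. h p * indicator S p \<partial>(\<rho> \<Otimes>\<^sub>M \<sigma>))
      + emeasure (\<rho> \<Otimes>\<^sub>M \<sigma>) (?A \<times> ?B \<inter> S) / ennreal \<eta>"
    if [measurable]: "S \<in> sets (borel \<Otimes>\<^sub>M borel)" for S
  proof -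
    have "emeasure \<pi> S = (\<integral>\<^sup>+ p. h p * indicator S p + indicator (?A \<times> ?B \<inter> S) p / ennreal \<eta> \<partial>(\<rho> \<Otimes>\<^sub>M \<sigma>))"
      unfolding \<pi>_def by (subst emeasure_density) (auto simp: g_def indicator_def intro!: nn_integral_cong)
    also have "\<dots> = (\<integral>\<^sup>+ p. h p * indicator S p \<partial>(\<rho> \<Otimes>\<^sub>M \<sigma>))
      + (\<integral>\<^sup>+ p. indicator (?A \<times> ?B \<inter> S) p / ennreal \<eta> \<partial>(\<rho> \<Otimes>\<^sub>M \<sigma>))"
      by (rule nn_integral_add) simp_all
    also have "(\<integral>\<^sup>+ p. indicator (?A \<times> ?B \<inter> S) p / ennreal \<eta> \<partial>(\<rho> \<Otimes>\<^sub>M \<sigma>))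
      = (\<integral>\<^sup>+ p. indicator (?A \<times> ?B \<inter> S) p \<partial>(\<rho> \<Otimes>\<^sub>M \<sigma>)) / ennreal \<eta>"
      by (rule nn_integral_divide) simp
    also have "(\<integral>\<^sup>+ p. indicator (?A \<times> ?B \<inter> S) p \<partial>(\<rho> \<Otimes>\<^sub>M \<sigma>)) = emeasure (\<rho> \<Otimes>\<^sub>M \<sigma>) (?A \<times> ?B \<inter> S)"
      by (rule nn_integral_indicator) simp
    finally show ?thesis .
  qed
  have cancel: "a * ennreal \<eta> / ennreal \<eta> = a" for a
    using \<eta>(1) by (simp add: ennreal_mult_divide_eq)
  have compl_add: "emeasure N (X \<inter> C) + emeasure N (- C \<inter> X) = emeasure N X"
    if "sets N = sets borel" "X \<in> sets borel" "C \<in> sets borel" for N :: "'a measure" and X C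
  proof -
    have "emeasure N (X \<inter> C) + emeasure N (- C \<inter> X) = emeasure N ((X \<inter> C) \<union> (- C \<inter> X))"
      using that by (intro plus_emeasure) auto
    also have "(X \<inter> C) \<union> (- C \<inter> X) = X" by auto
    finally show ?thesis .
  qed
  have "\<pi> \<in> transport_plans \<rho> \<sigma>"
  proof (rule transport_plansI[OF sets_\<pi> r.sets_M s.sets_M r.prob_space_axioms])
    fix X :: "'a set" assume X: "X \<in> sets borel"
    have "emeasure \<pi> (X \<times> UNIV) = emeasure \<rho> (X \<inter> cbox l u) + emeasure (\<rho> \<Otimes>\<^sub>M \<sigma>) (?A \<times> ?B \<inter> X \<times> UNIV) / ennreal \<eta>"
      using h X by (subst \<pi>) (simp_all add: box_coupling_def)
    also have "?A \<times> ?B \<inter> X \<times> UNIV = (?A \<inter> X) \<times> ?B" by auto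
    also have "emeasure (\<rho> \<Otimes>\<^sub>M \<sigma>) ((?A \<inter> X) \<times> ?B) / ennreal \<eta> = emeasure \<rho> (?A \<inter> X)"
      using X by (subst s.emeasure_pair_measure_Times) (simp_all add: mass cancel)
    also have "emeasure \<rho> (X \<inter> cbox l u) + emeasure \<rho> (?A \<inter> X) = emeasure \<rho> X"
      using X by (intro compl_add) simp_all
    finally show "emeasure \<pi> (X \<times> UNIV) = emeasure \<rho> X" .
  next
    fix Y :: "'a set" assume Y: "Y \<in> sets borel"
    have "emeasure \<pi> (UNIV \<times> Y) = emeasure \<sigma> (Y \<inter> cbox l' u') + emeasure (\<rho> \<Otimes>\<^sub>M \<sigma>) (?A \<times> ?B \<inter> UNIV \<times> Y) / ennreal \<eta>"
      using h Y by (subst \<pi>) (simp_all add: box_coupling_def)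
    also have "?A \<times> ?B \<inter> UNIV \<times> Y = ?A \<times> (?B \<inter> Y)" by auto
    also have "emeasure (\<rho> \<Otimes>\<^sub>M \<sigma>) (?A \<times> (?B \<inter> Y)) / ennreal \<eta> = emeasure \<sigma> (?B \<inter> Y)"
      using Y by (subst s.emeasure_pair_measure_Times) (simp_all add: mass cancel mult.commute[of "ennreal \<eta>"])
    also have "emeasure \<sigma> (Y \<inter> cbox l' u') + emeasure \<sigma> (?B \<inter> Y) = emeasure \<sigma> Y"
      using Y by (intro compl_add) simp_all
    finally show "emeasure \<pi> (UNIV \<times> Y) = emeasure \<sigma> Y" .
  qed
  moreover have "emeasure \<pi> {p. (1 - t) *\<^sub>R fst p + t *\<^sub>R snd p \<in> U} \<le> emeasure lborel V + ennreal \<eta>"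
    if t: "t \<in> {0..1}" and U: "U \<in> sets borel" and V: "V \<in> sets borel" and UV: "\<forall>y\<in>U. ball y \<epsilon> \<subseteq> V" for t U V
  proof -
    let ?S = "{p. (1 - t) *\<^sub>R fst p + t *\<^sub>R snd p \<in> U}"
    have S: "?S \<in> sets (borel \<Otimes>\<^sub>M borel)" using U by (rule interpolation_sets)
    have "(\<integral>\<^sup>+ p. h p * indicator ?S p \<partial>(\<rho> \<Otimes>\<^sub>M \<sigma>))
      \<le> emeasure lborel (V \<inter> cbox ((1 - t) *\<^sub>R l + t *\<^sub>R l') ((1 - t) *\<^sub>R u + t *\<^sub>R u'))"
      using h t U V UV unfolding box_coupling_def by blast
    also have "\<dots> \<le> emeasure lborel V" using V by (intro emeasure_mono) auto
    finally have 1: "(\<integral>\<^sup>+ p. h p * indicator ?S p \<partial>(\<rho> \<Otimes>\<^sub>M \<sigma>)) \<le> emeasure lborel V" .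
    have "emeasure (\<rho> \<Otimes>\<^sub>M \<sigma>) (?A \<times> ?B \<inter> ?S) / ennreal \<eta> \<le> emeasure (\<rho> \<Otimes>\<^sub>M \<sigma>) (?A \<times> ?B) / ennreal \<eta>"
      by (intro divide_right_mono_ennreal emeasure_mono) simp_all
    also have "\<dots> = ennreal \<eta>"
      by (subst s.emeasure_pair_measure_Times) (simp_all add: mass cancel)
    finally show ?thesis unfolding \<pi>[OF S] by (rule add_mono[OF 1])
  qed
  ultimately show ?thesis by blast
qed

text \<open>The approximate couplings have constant marginals and are therefore tight. Domination of
  the interpolations by Lebesgue measure passes to a weak limit on open sets, and from there to
  Borel sets.\<close>

theorem displacement_coupling:
  "\<exists>\<pi>\<in>transport_plans \<rho> \<sigma>. \<forall>t\<in>{0..1}. \<forall>A\<in>sets borel.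
    emeasure \<pi> {p. (1 - t) *\<^sub>R fst p + t *\<^sub>R snd p \<in> A} \<le> emeasure lborel A"
proof -
  \<comment> \<open>The shift by two keeps \<open>e 0\<close> below 1; \<open>e n\<close> serves
    both as radius and as left-over mass.\<close>
  define e :: "nat \<Rightarrow> real" where "e n = inverse (real (Suc (Suc n)))" for n
  have e: "0 < e n" "e n < 1" for n by (simp_all add: e_def field_simps)
  have e_lim: "e \<longlonglongrightarrow> 0"
    unfolding e_def by (rule LIMSEQ_Suc[OF LIMSEQ_inverse_real_of_nat])
  have "\<forall>n. \<exists>\<pi>. \<pi> \<in> transport_plans \<rho> \<sigma> \<and> (\<forall>t\<in>{0..1}. \<forall>U\<in>sets borel. \<forall>V\<in>sets borel.
      (\<forall>y\<in>U. ball y (e n) \<subseteq> V) \<longrightarrow>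
      emeasure \<pi> {p. (1 - t) *\<^sub>R fst p + t *\<^sub>R snd p \<in> U} \<le> emeasure lborel V + ennreal (e n))"
    using approximate_displacement_coupling[OF e(1) e] unfolding Bex_def by (rule allI)
  from choice[OF this] obtain \<gamma> where \<gamma>': "\<forall>n. \<gamma> n \<in> transport_plans \<rho> \<sigma> \<and> (\<forall>t\<in>{0..1}. \<forall>U\<in>sets borel. \<forall>V\<in>sets borel.
      (\<forall>y\<in>U. ball y (e n) \<subseteq> V) \<longrightarrow>
      emeasure (\<gamma> n) {p. (1 - t) *\<^sub>R fst p + t *\<^sub>R snd p \<in> U} \<le> emeasure lborel V + ennreal (e n))" ..
  have \<gamma>: "\<gamma> n \<in> transport_plans \<rho> \<sigma>"
    "t \<in> {0..1} \<Longrightarrow> U \<in> sets borel \<Longrightarrow> V \<in> sets borel \<Longrightarrow> (\<And>y. y \<in> U \<Longrightarrow> ball y (e n) \<subseteq> V) \<Longrightarrow>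
      emeasure (\<gamma> n) {p. (1 - t) *\<^sub>R fst p + t *\<^sub>R snd p \<in> U} \<le> emeasure lborel V + ennreal (e n)" for n t U V
  proof -
    show "\<gamma> n \<in> transport_plans \<rho> \<sigma>" using \<gamma>' by simp
    assume "t \<in> {0..1}" "U \<in> sets borel" "V \<in> sets borel" "\<And>y. y \<in> U \<Longrightarrow> ball y (e n) \<subseteq> V"
    then show "emeasure (\<gamma> n) {p. (1 - t) *\<^sub>R fst p + t *\<^sub>R snd p \<in> U} \<le> emeasure lborel V + ennreal (e n)"
      by (intro \<gamma>'[THEN spec, of n, THEN conjunct2, rule_format])
  qed
  note g = transport_plansD[OF \<gamma>(1)]
  have tight: "\<exists>R. \<forall>n. measure (\<gamma> n) {p. norm p > R} < \<epsilon>" if "\<epsilon> > 0" for \<epsilon>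
  proof (rule transport_plans_tight[OF \<gamma>(1) _ that])
    fix \<epsilon> :: real assume "\<epsilon> > 0"
    from prob_tight[OF r.sets_M r.prob_space_axioms this]
    obtain R where "measure \<rho> {x. norm x > R} < \<epsilon>" by metis
    then show "\<exists>R. \<forall>n :: nat. measure \<rho> {x. norm x > R} < \<epsilon>" by blast
  qed
  obtain r M where r: "strict_mono (r :: nat \<Rightarrow> nat)" and M: "sets M = sets borel" "prob_space M"
    and lim: "lsc_limit (\<lambda>n. \<gamma> (r n)) M"
    by (rule tight_imp_lsc_limit[of \<gamma>, OF g(1) g(2) tight]) (assumption, rule that)
  have e_lim_r: "(\<lambda>n. e (r n)) \<longlonglongrightarrow> 0"
    using LIMSEQ_subseq_LIMSEQ[OF e_lim r] by (simp only: comp_def)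
  have cont: "continuous_on UNIV (\<lambda>p :: 'a \<times> 'a. (1 - t) *\<^sub>R fst p + t *\<^sub>R snd p)" for t
    by (intro continuous_intros)
  have "distr M borel fst = \<rho>"
  proof (rule prob_eq_of_open_le[OF r.sets_M r.prob_space_axioms])
    note m = measurable_fst_snd_borel(1)[OF M(1)]
    show "prob_space (distr M borel fst)" by (rule prob_space.prob_space_distr[OF M(2) m])
    fix U :: "'a set" assume U: "open U"
    have "fst -` U \<inter> space M = U \<times> UNIV" using sets_eq_imp_space_eq[OF M(1)] by auto
    then have "emeasure (distr M borel fst) U = emeasure M (U \<times> UNIV)"
      using U by (simp add: emeasure_distr[OF m])
    also have "\<dots> \<le> liminf (\<lambda>n. emeasure (\<gamma> (r n)) (U \<times> UNIV))"
      by (rule lsc_limit_open[OF lim open_Times[OF U open_UNIV] g(1) M(1)])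
    also have "\<dots> = emeasure \<rho> U"
      unfolding transport_plans_marginal_fst[OF \<gamma>(1) borel_open[OF U]] by (simp add: Liminf_const)
    finally show "emeasure (distr M borel fst) U \<le> emeasure \<rho> U" .
  qed simp
  then have plan: "M \<in> transport_plans \<rho> \<sigma>"
    using lsc_limit_transport_plans[OF \<gamma>(1) M lim] by simp
  have "emeasure M {p. (1 - t) *\<^sub>R fst p + t *\<^sub>R snd p \<in> A} \<le> emeasure lborel A"
    if t: "t \<in> {0..1}" and A: "A \<in> sets borel" for t A
  proof -
    let ?f = "\<lambda>p :: 'a \<times> 'a. (1 - t) *\<^sub>R fst p + t *\<^sub>R snd p"
    have m: "?f \<in> M \<rightarrow>\<^sub>M borel"
      unfolding measurable_cong_sets[OF M(1) refl] by (rule borel_measurable_continuous_onI[OF cont])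
    have sp: "space M = UNIV" using sets_eq_imp_space_eq[OF M(1)] by simp
    have distr_eq: "emeasure (distr M borel ?f) B = emeasure M {p. ?f p \<in> B}" if "B \<in> sets borel" for B
      using that by (simp add: emeasure_distr[OF m] sp vimage_def)
    have "emeasure (distr M borel ?f) A \<le> emeasure lborel A"
    proof (rule emeasure_le_lborel_of_open_le[OF _ _ A])
      fix U :: "'a set" assume U: "open U"
      \<comment> \<open>For fixed \<open>k\<close> the \<open>e (r n)\<close>-balls around points of
        \<open>W k\<close> eventually lie in \<open>U\<close>, so the bound in the limit is by the
        volume of \<open>U\<close> itself; then \<open>k\<close> tends to infinity.\<close>
      obtain W :: "nat \<Rightarrow> 'a set" where W: "incseq W" "\<And>k. open (W k)" "(\<Union>k. W k) = U"
        "\<And>k y. y \<in> W k \<Longrightarrow> ball y (inverse (real (Suc k))) \<subseteq> U"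
        by (rule open_exhaustion[OF U]) (rule that)
      have "emeasure (distr M borel ?f) (W k) \<le> emeasure lborel U" for k
      proof -
        have opn: "open {p. ?f p \<in> W k}"
          using open_vimage[OF W(2) cont] by (simp add: vimage_def)
        have "emeasure (distr M borel ?f) (W k) = emeasure M {p. ?f p \<in> W k}"
          by (rule distr_eq) (rule borel_open[OF W(2)])
        also have "\<dots> \<le> liminf (\<lambda>n. emeasure (\<gamma> (r n)) {p. ?f p \<in> W k})"
          by (rule lsc_limit_open[OF lim opn g(1) M(1)])
        also have "\<dots> \<le> liminf (\<lambda>n. emeasure lborel U + ennreal (e (r n)))"
        proof (rule Liminf_mono)
          have "\<forall>\<^sub>F n in sequentially. e (r n) < inverse (real (Suc k))"
            by (rule order_tendstoD(2)[OF e_lim_r]) simp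
          then show "\<forall>\<^sub>F n in sequentially. emeasure (\<gamma> (r n)) {p. ?f p \<in> W k} \<le> emeasure lborel U + ennreal (e (r n))"
          proof eventually_elim
            case (elim n)
            show ?case
            proof (rule \<gamma>(2)[OF t borel_open[OF W(2)] borel_open[OF U]])
              fix y assume "y \<in> W k"
              from W(4)[OF this] show "ball y (e (r n)) \<subseteq> U"
                using subset_ball[OF less_imp_le[OF elim], of y] by (rule subset_trans[rotated])
            qed
          qed
        qed
        also have "\<dots> = emeasure lborel U"
        proof -
          have "(\<lambda>n. emeasure lborel U + ennreal (e (r n))) \<longlonglongrightarrow> emeasure lborel U + ennreal 0"
            by (intro tendsto_add tendsto_const tendsto_ennrealI e_lim_r)
          from lim_imp_Liminf[OF sequentially_bot this] show ?thesis by simp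
        qed
        finally show ?thesis .
      qed
      then have "(SUP k. emeasure (distr M borel ?f) (W k)) \<le> emeasure lborel U" by (rule SUP_least)
      moreover have "(SUP k. emeasure (distr M borel ?f) (W k)) = emeasure (distr M borel ?f) U"
        unfolding W(3)[symmetric] using borel_open[OF W(2)]
        by (intro SUP_emeasure_incseq W(1)) (simp add: image_subset_iff)
      ultimately show "emeasure (distr M borel ?f) U \<le> emeasure lborel U" by simp
    qed simp
    then show ?thesis unfolding distr_eq[OF A] .
  qed
  then show ?thesis using plan by blast
qed

end

section \<open>Existence of the projection\<close>

text \<open>An unbounded convex set with an interior point contains arbitrarily many disjoint balls of
  one and the same radius, lined up on a long segment.\<close>

lemma convex_bounded_part_measure_ge_1:
  fixes \<Omega> :: "'a::euclidean_space set"
  assumes "closed \<Omega>" "convex \<Omega>" "emeasure lborel \<Omega> \<ge> 1"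
  obtains R where "emeasure lborel (\<Omega> \<inter> cball 0 R) \<ge> 1"
proof (cases "bounded \<Omega>")
  case True
  then obtain R where "\<Omega> \<subseteq> ball 0 R" using bounded_subset_ballD[of \<Omega> 0] by blast
  then have "\<Omega> \<subseteq> cball 0 R" using ball_subset_cball[of 0 R] by (rule subset_trans)
  then show ?thesis using assms(3) by (intro that[of R]) (simp add: Int_absorb2)
next
  case False
  have "interior \<Omega> \<noteq> {}"
  proof
    assume "interior \<Omega> = {}"
    then have "negligible \<Omega>" using negligible_convex_interior[OF assms(2)] by simp
    then have "emeasure lborel \<Omega> = 0"
      using assms(1) by (auto simp: negligible_iff_null_sets null_sets_def)
    then show False using assms(3) by simp
  qed
  then obtain a where "a \<in> interior \<Omega>" by blast
  then obtain r where r: "r > 0" "ball a r \<subseteq> \<Omega>" unfolding mem_interior by blast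
  define \<beta> where "\<beta> = unit_ball_vol (DIM('a)) * (r / 2) ^ DIM('a)"
  have \<beta>: "emeasure lborel (ball c (r / 2)) = ennreal \<beta>" for c :: 'a
    unfolding \<beta>_def using r(1) by (intro emeasure_ball) simp
  have "\<beta> > 0" unfolding \<beta>_def using r(1) by (intro mult_pos_pos) simp_all
  obtain m :: nat where "1 / \<beta> \<le> real m" using real_arch_simple by blast
  then have m: "1 \<le> real m * \<beta>" using \<open>\<beta> > 0\<close> by (simp add: field_simps)
  \<comment> \<open>A point this far away puts the \<open>m\<close> centres, at mutual distance at
    least \<open>r\<close>, into the half of the segment nearer to \<open>a\<close>.\<close>
  have "\<not> \<Omega> \<subseteq> cball a (2 * r * (real m + 1))" using False bounded_subset[OF bounded_cball] by blast
  then obtain p where p: "p \<in> \<Omega>" "p \<notin> cball a (2 * r * (real m + 1))" by blast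
  define L where "L = norm (p - a)"
  have L: "L > 2 * r * (real m + 1)"
    using p(2) by (simp add: L_def dist_norm norm_minus_commute)
  have "0 < 2 * r * (real m + 1)" using r(1) by simp
  then have L_pos: "L > 0" using L by linarith
  define s where "s j = real j * r / L" for j :: nat
  define c where "c j = a + s j *\<^sub>R (p - a)" for j
  have sub: "ball (c j) (r / 2) \<subseteq> \<Omega>" if "j < m" for j
  proof
    fix x assume x: "x \<in> ball (c j) (r / 2)"
    have "real j * r \<le> (real m + 1) * r" using r(1) that by (intro mult_right_mono) auto
    moreover have "2 * r * (real m + 1) = 2 * ((real m + 1) * r)" by simp
    ultimately have "2 * (real j * r) \<le> L" using L by linarith
    then have s: "0 \<le> s j" "s j \<le> 1 / 2" using L_pos r(1) by (simp_all add: s_def divide_le_eq)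
    define v where "v = x - c j"
    have v: "norm v < r / 2" using x by (simp add: v_def dist_norm norm_minus_commute)
    have "1 / (1 - s j) \<le> 2" using s by (simp add: divide_le_eq)
    then have "1 / (1 - s j) * norm v \<le> 2 * norm v" by (intro mult_right_mono) simp_all
    then have "norm ((1 / (1 - s j)) *\<^sub>R v) \<le> 2 * norm v" using s by simp
    then have "a + (1 / (1 - s j)) *\<^sub>R v \<in> ball a r" using v by (simp add: dist_norm)
    then have "a + (1 / (1 - s j)) *\<^sub>R v \<in> \<Omega>" using r(2) by blast
    \<comment> \<open>The homothety with centre \<open>p\<close> and ratio
      \<open>1 - s j \<ge> 1 / 2\<close> maps \<open>ball a r\<close> into \<open>\<Omega>\<close>,
      and its image contains the ball of radius \<open>r / 2\<close> around
      \<open>c j\<close>.\<close>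
    then have "(1 - s j) *\<^sub>R (a + (1 / (1 - s j)) *\<^sub>R v) + s j *\<^sub>R p \<in> \<Omega>"
      using s by (intro convexD[OF assms(2) _ p(1)]) auto
    also have "(1 - s j) *\<^sub>R (a + (1 / (1 - s j)) *\<^sub>R v) + s j *\<^sub>R p = (1 - s j) *\<^sub>R a + v + s j *\<^sub>R p"
      using s by (simp add: scaleR_add_right)
    also have "\<dots> = x" by (simp add: v_def c_def algebra_simps)
    finally show "x \<in> \<Omega>" .
  qed
  have disj: "disjoint_family_on (\<lambda>j. ball (c j) (r / 2)) {..<m}"
    unfolding disjoint_family_on_def
  proof (intro ballI impI)
    fix i j :: nat assume "i \<noteq> j"
    have "c i - c j = (s i - s j) *\<^sub>R (p - a)" by (simp add: c_def algebra_simps)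
    then have "dist (c i) (c j) = \<bar>s i - s j\<bar> * L" by (simp add: dist_norm L_def)
    also have "\<dots> = \<bar>real i - real j\<bar> * r"
    proof -
      have "s i - s j = (real i - real j) * r / L" by (simp add: s_def diff_divide_distrib left_diff_distrib)
      then show ?thesis using L_pos r(1) by (simp add: abs_mult)
    qed
    finally have dist_eq: "dist (c i) (c j) = \<bar>real i - real j\<bar> * r" .
    have "1 \<le> \<bar>real i - real j\<bar>" using \<open>i \<noteq> j\<close> by (cases i j rule: linorder_cases) simp_all
    then have "1 * r \<le> \<bar>real i - real j\<bar> * r" using r(1) by (intro mult_right_mono) simp_all
    then show "ball (c i) (r / 2) \<inter> ball (c j) (r / 2) = {}"
      by (intro disjoint_ballI) (simp add: dist_eq)
  qed
  let ?B = "\<Union>j<m. ball (c j) (r / 2)"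
  have "bounded ?B" by (intro bounded_UN) simp_all
  then obtain R where "?B \<subseteq> ball 0 R" using bounded_subset_ballD[of ?B 0] by blast
  then have R: "?B \<subseteq> cball 0 R" using ball_subset_cball[of 0 R] by (rule subset_trans)
  show ?thesis
  proof (rule that[of R])
    have "1 \<le> ennreal (real m * \<beta>)" using m by (simp add: ennreal_leI flip: ennreal_1)
    also have "\<dots> = (\<Sum>j<m. emeasure lborel (ball (c j) (r / 2)))"
      using \<open>\<beta> > 0\<close> by (simp add: \<beta> ennreal_mult' ennreal_of_nat_eq_real_of_nat)
    also have "\<dots> = emeasure lborel ?B"
      by (rule sum_emeasure) (use disj in auto)
    also have "\<dots> \<le> emeasure lborel (\<Omega> \<inter> cball 0 R)"
    proof (rule emeasure_mono)
      have "?B \<subseteq> \<Omega>" using sub by blast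
      with R show "?B \<subseteq> \<Omega> \<inter> cball 0 R" by simp
    qed (use assms(1) in simp)
    finally show "1 \<le> emeasure lborel (\<Omega> \<inter> cball 0 R)" .
  qed
qed

lemma norm_powr_2 [simp]: "norm x powr 2 = (norm x)\<^sup>2"
  by (cases "x = 0") simp_all

lemma sub_lebesgue_iff:
  "sub_lebesgue M \<longleftrightarrow> prob_space M \<and> sets M = sets borel \<and> (\<forall>A\<in>sets borel. emeasure M A \<le> emeasure lborel A)"
  by (auto simp: sub_lebesgue_def sub_lebesgue_axioms_def)

lemma bounded_density_measures_iff:
  "\<rho> \<in> bounded_density_measures p \<Omega> \<longleftrightarrow> \<rho> \<in> prob_measures_p p \<Omega> \<and> sub_lebesgue \<rho>"
  unfolding bounded_density_measures_def sub_lebesgue_iff prob_measures_p_def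
  using density_bounded_iff_le_lborel[of \<rho>] by auto

text \<open>The uniform distribution on a bounded part of \<open>\<Omega>\<close> of volume at least
  1 has density at most 1, and boundedness gives the finite second moment.\<close>

lemma bounded_density_measures_nonempty:
  fixes \<Omega> :: "'a::euclidean_space set"
  assumes "closed \<Omega>" "convex \<Omega>" "emeasure lborel \<Omega> \<ge> 1"
  shows "bounded_density_measures 2 \<Omega> \<noteq> {}"
proof -
  obtain R where R: "emeasure lborel (\<Omega> \<inter> cball 0 R) \<ge> 1"
    by (rule convex_bounded_part_measure_ge_1[OF assms]) (rule that)
  define S where "S = \<Omega> \<inter> cball 0 R"
  have S [measurable]: "S \<in> sets borel" using assms(1) by (auto simp: S_def)
  have S_pos: "emeasure lborel S \<noteq> 0" using R by (auto simp: S_def)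
  have "emeasure lborel S \<le> emeasure lborel (cball 0 R :: 'a set)" by (rule emeasure_mono) (auto simp: S_def)
  also have "\<dots> < \<infinity>" by (rule emeasure_lborel_cball_finite)
  finally have S_fin: "emeasure lborel S \<noteq> \<infinity>" by simp
  define \<rho> where "\<rho> = uniform_measure lborel S"
  have \<rho>: "emeasure \<rho> A = emeasure lborel (S \<inter> A) / emeasure lborel S" if "A \<in> sets borel" for A
    unfolding \<rho>_def using that by (intro emeasure_uniform_measure) simp_all
  have prob: "prob_space \<rho>" unfolding \<rho>_def using S_pos S_fin by (rule prob_space_uniform_measure)
  have sets: "sets \<rho> = sets borel" by (simp add: \<rho>_def)
  have le: "emeasure \<rho> A \<le> emeasure lborel A" if A: "A \<in> sets borel" for A
  proof -
    have "1 * emeasure lborel (S \<inter> A) \<le> emeasure lborel S * emeasure lborel A"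
      using A R by (intro mult_mono emeasure_mono) (simp_all add: S_def)
    then show ?thesis
      unfolding \<rho>[OF A] using S_pos by (intro divide_le_posI_ennreal) (simp_all add: zero_less_iff_neq_zero)
  qed
  have "S \<inter> - \<Omega> = {}" by (auto simp: S_def)
  then have supp: "emeasure \<rho> (- \<Omega>) = 0" using assms(1) by (subst \<rho>) auto
  have "AE x in \<rho>. x \<in> S"
    unfolding \<rho>_def by (rule AE_uniform_measureI) simp_all
  then have "AE x in \<rho>. ennreal ((norm x)\<^sup>2) \<le> ennreal (R\<^sup>2)"
    by eventually_elim (auto simp: S_def intro!: ennreal_leI power_mono)
  then have "(\<integral>\<^sup>+ x. ennreal ((norm x)\<^sup>2) \<partial>\<rho>) \<le> (\<integral>\<^sup>+ x. ennreal (R\<^sup>2) \<partial>\<rho>)" by (rule nn_integral_mono_AE)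
  also have "\<dots> < \<infinity>" using prob_space.emeasure_space_1[OF prob] by simp
  finally have "\<rho> \<in> bounded_density_measures 2 \<Omega>"
    using prob sets le supp by (simp add: bounded_density_measures_iff prob_measures_p_def sub_lebesgue_iff)
  then show ?thesis by blast
qed

section \<open>Quadratic cost and second moments\<close>

definition quadratic_cost :: "('a::euclidean_space \<times> 'a) measure \<Rightarrow> ennreal" where
  "quadratic_cost \<gamma> = (\<integral>\<^sup>+ p. ennreal ((norm (fst p - snd p))\<^sup>2) \<partial>\<gamma>)"

lemma wasserstein_pow_2: "wasserstein_pow 2 \<mu> \<nu> = (INF \<gamma>\<in>transport_plans \<mu> \<nu>. quadratic_cost \<gamma>)"
  by (simp add: wasserstein_pow_def quadratic_cost_def case_prod_unfold)

lemma wasserstein_pow_le_cost: "\<gamma> \<in> transport_plans \<mu> \<nu> \<Longrightarrow> wasserstein_pow 2 \<mu> \<nu> \<le> quadratic_cost \<gamma>"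
  unfolding wasserstein_pow_2 by (rule INF_lower)

lemma nn_integral_fst_plan:
  assumes "\<gamma> \<in> transport_plans \<mu> \<nu>" "f \<in> borel_measurable borel"
  shows "(\<integral>\<^sup>+ p. f (fst p) \<partial>\<gamma>) = (\<integral>\<^sup>+ x. f x \<partial>\<mu>)"
  unfolding transport_plansD(3)[OF assms(1), symmetric]
  by (rule nn_integral_distr[OF measurable_fst_snd_borel(1)[OF transport_plansD(1)[OF assms(1)]], symmetric])
    (simp add: assms(2))

lemma nn_integral_snd_plan:
  assumes "\<gamma> \<in> transport_plans \<mu> \<nu>" "f \<in> borel_measurable borel"
  shows "(\<integral>\<^sup>+ p. f (snd p) \<partial>\<gamma>) = (\<integral>\<^sup>+ x. f x \<partial>\<nu>)"
  unfolding transport_plansD(4)[OF assms(1), symmetric]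
  by (rule nn_integral_distr[OF measurable_fst_snd_borel(2)[OF transport_plansD(1)[OF assms(1)]], symmetric])
    (simp add: assms(2))

lemma transport_plans_nonempty:
  assumes \<mu>: "sets \<mu> = sets borel" "prob_space \<mu>" and \<nu>: "sets \<nu> = sets borel" "prob_space \<nu>"
  shows "\<mu> \<Otimes>\<^sub>M \<nu> \<in> transport_plans \<mu> \<nu>"
proof -
  interpret \<mu>: prob_space \<mu> by fact
  interpret \<nu>: prob_space \<nu> by fact
  have sp: "space \<mu> = UNIV" "space \<nu> = UNIV"
    using sets_eq_imp_space_eq[OF \<mu>(1)] sets_eq_imp_space_eq[OF \<nu>(1)] by simp_all
  have sets: "sets (\<mu> \<Otimes>\<^sub>M \<nu>) = sets borel"
    unfolding sets_pair_measure_cong[OF \<mu>(1) \<nu>(1)] borel_prod ..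
  show ?thesis
  proof (rule transport_plansI[OF sets \<mu>(1) \<nu>(1) \<mu>(2)])
    show "emeasure (\<mu> \<Otimes>\<^sub>M \<nu>) (X \<times> UNIV) = emeasure \<mu> X" if "X \<in> sets borel" for X
      using that \<mu>(1) \<nu>(1) sp \<nu>.emeasure_space_1 by (subst \<nu>.emeasure_pair_measure_Times) simp_all
    show "emeasure (\<mu> \<Otimes>\<^sub>M \<nu>) (UNIV \<times> Y) = emeasure \<nu> Y" if "Y \<in> sets borel" for Y
      using that \<mu>(1) \<nu>(1) sp \<mu>.emeasure_space_1 by (subst \<nu>.emeasure_pair_measure_Times) simp_all
  qed
qed

lemma norm_diff_power2_le:
  fixes x y :: "'a::real_inner"
  shows "(norm (x - y))\<^sup>2 \<le> 2 * (norm x)\<^sup>2 + 2 * (norm y)\<^sup>2"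
proof -
  have "(norm (x - y))\<^sup>2 + (norm (x + y))\<^sup>2 = 2 * (norm x)\<^sup>2 + 2 * (norm y)\<^sup>2"
    by (simp add: power2_norm_eq_inner inner_add_left inner_add_right inner_diff_left inner_diff_right)
  then show ?thesis using zero_le_power2[of "norm (x + y)"] by linarith
qed

lemma prob_measures_2D:
  assumes "\<mu> \<in> prob_measures_p 2 \<Omega>"
  shows "sets \<mu> = sets borel" "prob_space \<mu>" "emeasure \<mu> (- \<Omega>) = 0"
    "(\<integral>\<^sup>+ x. ennreal ((norm x)\<^sup>2) \<partial>\<mu>) < \<infinity>"
  using assms by (simp_all add: prob_measures_p_def)

lemma nn_integral_add_scaled:
  assumes "f \<in> borel_measurable M" "g \<in> borel_measurable M"
    and "\<And>x. f x \<ge> 0" "\<And>x. g x \<ge> 0" "a \<ge> 0" "b \<ge> 0"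
  shows "(\<integral>\<^sup>+ x. ennreal (a * f x + b * g x) \<partial>M)
    = ennreal a * (\<integral>\<^sup>+ x. ennreal (f x) \<partial>M) + ennreal b * (\<integral>\<^sup>+ x. ennreal (g x) \<partial>M)"
proof -
  have "(\<integral>\<^sup>+ x. ennreal (a * f x + b * g x) \<partial>M) = (\<integral>\<^sup>+ x. ennreal a * ennreal (f x) + ennreal b * ennreal (g x) \<partial>M)"
    using assms by (intro nn_integral_cong) (simp add: ennreal_plus ennreal_mult)
  also have "\<dots> = ennreal a * (\<integral>\<^sup>+ x. ennreal (f x) \<partial>M) + ennreal b * (\<integral>\<^sup>+ x. ennreal (g x) \<partial>M)"
    using assms(1,2) by (subst nn_integral_add) (simp_all add: nn_integral_cmult)
  finally show ?thesis .
qed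

lemma borel_measurable_plan [simp]:
  assumes "\<gamma> \<in> transport_plans \<mu> \<nu>"
  shows "borel_measurable \<gamma> = borel_measurable borel"
  by (rule measurable_cong_sets[OF transport_plansD(1)[OF assms] refl])

lemma borel_measurable_norm_plan [simp]:
  "(\<lambda>p :: 'a::euclidean_space \<times> 'a. (norm (fst p))\<^sup>2) \<in> borel_measurable borel"
  "(\<lambda>p :: 'a::euclidean_space \<times> 'a. (norm (snd p))\<^sup>2) \<in> borel_measurable borel"
  "(\<lambda>p :: 'a::euclidean_space \<times> 'a. (norm (fst p - snd p))\<^sup>2) \<in> borel_measurable borel"
  by (intro borel_measurable_continuous_onI continuous_intros)+

lemma quadratic_cost_finite:
  assumes \<gamma>: "\<gamma> \<in> transport_plans \<mu> \<nu>" and "\<mu> \<in> prob_measures_p 2 \<Omega>" "\<nu> \<in> prob_measures_p 2 \<Omega>'"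
  shows "quadratic_cost \<gamma> < \<infinity>"
proof -
  have "quadratic_cost \<gamma> \<le> (\<integral>\<^sup>+ p. ennreal (2 * (norm (fst p))\<^sup>2 + 2 * (norm (snd p))\<^sup>2) \<partial>\<gamma>)"
    unfolding quadratic_cost_def by (intro nn_integral_mono ennreal_leI norm_diff_power2_le)
  also have "\<dots> = ennreal 2 * (\<integral>\<^sup>+ p. ennreal ((norm (fst p))\<^sup>2) \<partial>\<gamma>) + ennreal 2 * (\<integral>\<^sup>+ p. ennreal ((norm (snd p))\<^sup>2) \<partial>\<gamma>)"
    by (rule nn_integral_add_scaled) (simp_all add: borel_measurable_plan[OF \<gamma>])
  also have "\<dots> = ennreal 2 * (\<integral>\<^sup>+ x. ennreal ((norm x)\<^sup>2) \<partial>\<mu>) + ennreal 2 * (\<integral>\<^sup>+ x. ennreal ((norm x)\<^sup>2) \<partial>\<nu>)"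
    using nn_integral_fst_plan[OF \<gamma>, of "\<lambda>x. ennreal ((norm x)\<^sup>2)"]
      nn_integral_snd_plan[OF \<gamma>, of "\<lambda>x. ennreal ((norm x)\<^sup>2)"] by simp
  also have "\<dots> < \<infinity>"
    using prob_measures_2D(4)[OF assms(2)] prob_measures_2D(4)[OF assms(3)]
    by (simp add: ennreal_mult_less_top)
  finally show ?thesis .
qed

text \<open>Bounded cost towards a fixed \<open>\<mu>\<close> bounds the second moments, which makes
  minimizing sequences tight.\<close>

lemma second_moment_le:
  assumes \<gamma>: "\<gamma> \<in> transport_plans \<rho> \<mu>"
  shows "(\<integral>\<^sup>+ x. ennreal ((norm x)\<^sup>2) \<partial>\<rho>) \<le> 2 * quadratic_cost \<gamma> + 2 * (\<integral>\<^sup>+ x. ennreal ((norm x)\<^sup>2) \<partial>\<mu>)"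
proof -
  have "(\<integral>\<^sup>+ x. ennreal ((norm x)\<^sup>2) \<partial>\<rho>) = (\<integral>\<^sup>+ p. ennreal ((norm (fst p))\<^sup>2) \<partial>\<gamma>)"
    using nn_integral_fst_plan[OF \<gamma>, of "\<lambda>x. ennreal ((norm x)\<^sup>2)"] by simp
  also have "\<dots> \<le> (\<integral>\<^sup>+ p. ennreal (2 * (norm (fst p - snd p))\<^sup>2 + 2 * (norm (snd p))\<^sup>2) \<partial>\<gamma>)"
  proof (intro nn_integral_mono ennreal_leI)
    fix p :: "'a \<times> 'a"
    show "(norm (fst p))\<^sup>2 \<le> 2 * (norm (fst p - snd p))\<^sup>2 + 2 * (norm (snd p))\<^sup>2"
      using norm_diff_power2_le[of "fst p - snd p" "- snd p"] by simp
  qed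
  also have "\<dots> = ennreal 2 * (\<integral>\<^sup>+ p. ennreal ((norm (fst p - snd p))\<^sup>2) \<partial>\<gamma>) + ennreal 2 * (\<integral>\<^sup>+ p. ennreal ((norm (snd p))\<^sup>2) \<partial>\<gamma>)"
    by (rule nn_integral_add_scaled) (simp_all add: borel_measurable_plan[OF \<gamma>])
  also have "\<dots> = 2 * quadratic_cost \<gamma> + 2 * (\<integral>\<^sup>+ x. ennreal ((norm x)\<^sup>2) \<partial>\<mu>)"
    using nn_integral_snd_plan[OF \<gamma>, of "\<lambda>x. ennreal ((norm x)\<^sup>2)"] by (simp add: quadratic_cost_def)
  finally show ?thesis .
qed

lemma tight_of_second_moment:
  fixes \<rho> :: "nat \<Rightarrow> 'a::euclidean_space measure"
  assumes sets: "\<And>n. sets (\<rho> n) = sets borel" and prob: "\<And>n. prob_space (\<rho> n)"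
    and B: "\<And>n. (\<integral>\<^sup>+ x. ennreal ((norm x)\<^sup>2) \<partial>\<rho> n) \<le> ennreal B" and "\<epsilon> > 0"
  shows "\<exists>R. \<forall>n. measure (\<rho> n) {x. norm x > R} < \<epsilon>"
proof -
  \<comment> \<open>Chebyshev's inequality bounds the mass outside radius \<open>R\<close> by
    \<open>max B 0 / R\<^sup>2\<close>; the added 1 makes this strictly less than
    \<open>\<epsilon>\<close>. A negative \<open>B\<close> is read as 0 by
    \<open>ennreal\<close>.\<close>
  define R where "R = sqrt (max B 0 / \<epsilon> + 1)"
  have q: "0 \<le> max B 0 / \<epsilon>" using \<open>\<epsilon> > 0\<close> by simp
  then have "R\<^sup>2 = max B 0 / \<epsilon> + 1" unfolding R_def by (intro real_sqrt_pow2) linarith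
  then have "R\<^sup>2 * \<epsilon> = max B 0 + \<epsilon>" using \<open>\<epsilon> > 0\<close> by (simp add: distrib_right)
  moreover have "R > 0" unfolding R_def real_sqrt_gt_0_iff using q by linarith
  ultimately have R: "R > 0" "max B 0 < R\<^sup>2 * \<epsilon>" using \<open>\<epsilon> > 0\<close> by simp_all
  have "measure (\<rho> n) {x. norm x > R} < \<epsilon>" for n
  proof -
    interpret prob_space "\<rho> n" by (rule prob)
    have m: "{x :: 'a. norm x > R} \<in> sets (\<rho> n)" unfolding sets by measurable
    have "ennreal (R\<^sup>2 * measure (\<rho> n) {x. norm x > R}) = (\<integral>\<^sup>+ x. ennreal (R\<^sup>2) * indicator {x. norm x > R} x \<partial>\<rho> n)"
      using m by (simp add: nn_integral_cmult_indicator emeasure_eq_measure ennreal_mult')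
    also have "\<dots> \<le> (\<integral>\<^sup>+ x. ennreal ((norm x)\<^sup>2) \<partial>\<rho> n)"
      using R(1) by (intro nn_integral_mono) (auto simp: indicator_def intro!: ennreal_leI power_mono)
    also have "\<dots> \<le> ennreal (max B 0)" by (rule order.trans[OF B]) (simp add: ennreal_leI)
    finally have "R\<^sup>2 * measure (\<rho> n) {x. norm x > R} \<le> max B 0" by (subst (asm) ennreal_le_iff) simp_all
    then have "R\<^sup>2 * measure (\<rho> n) {x. norm x > R} < R\<^sup>2 * \<epsilon>" using R(2) by linarith
    then show ?thesis using R(1) by (simp add: mult_less_cancel_left_pos)
  qed
  then show ?thesis by blast
qed

text \<open>The direct method, run on nearly optimal plans rather than on the measures: the limit
  plan has lower semicontinuous cost, and its first marginal is the minimizer. The constraints pass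
  to the limit because they are inequalities on open sets.\<close>

theorem density_projection_exists:
  fixes \<Omega> :: "'a::euclidean_space set"
  assumes \<Omega>: "closed \<Omega>" "convex \<Omega>" "emeasure lborel \<Omega> \<ge> 1" and \<mu>: "\<mu> \<in> prob_measures_p 2 \<Omega>"
  shows "\<exists>\<rho>\<in>bounded_density_measures 2 \<Omega>. \<forall>\<rho>'\<in>bounded_density_measures 2 \<Omega>.
    wasserstein_pow 2 \<rho> \<mu> \<le> wasserstein_pow 2 \<rho>' \<mu>"
proof -
  define K where "K = bounded_density_measures 2 \<Omega>"
  have KD: "\<rho> \<in> prob_measures_p 2 \<Omega>" "sub_lebesgue \<rho>" if "\<rho> \<in> K" for \<rho>
    using that by (simp_all add: K_def bounded_density_measures_iff)
  note \<mu>D = prob_measures_2D[OF \<mu>]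
  define I where "I = (INF \<rho>\<in>K. wasserstein_pow 2 \<rho> \<mu>)"
  obtain \<rho>0 where \<rho>0: "\<rho>0 \<in> K" using bounded_density_measures_nonempty[OF \<Omega>] by (auto simp: K_def)
  have plan0: "\<rho>0 \<Otimes>\<^sub>M \<mu> \<in> transport_plans \<rho>0 \<mu>"
    by (rule transport_plans_nonempty[OF prob_measures_2D(1,2)[OF KD(1)[OF \<rho>0]] \<mu>D(1,2)])
  have "I \<le> wasserstein_pow 2 \<rho>0 \<mu>" unfolding I_def by (rule INF_lower[OF \<rho>0])
  also have "\<dots> \<le> quadratic_cost (\<rho>0 \<Otimes>\<^sub>M \<mu>)" by (rule wasserstein_pow_le_cost[OF plan0])
  also have "\<dots> < \<infinity>" by (rule quadratic_cost_finite[OF plan0 KD(1)[OF \<rho>0] \<mu>])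
  finally have I_fin: "I < \<infinity>" .
  define e :: "nat \<Rightarrow> real" where "e n = inverse (real (Suc n))" for n
  have "\<exists>q. fst q \<in> K \<and> snd q \<in> transport_plans (fst q) \<mu> \<and> quadratic_cost (snd q) < I + ennreal (e n)" for n
  proof -
    have "0 < ennreal (e n)" by (simp add: e_def)
    then have "I < I + ennreal (e n)" using I_fin ennreal_add_left_cancel_less[of I 0 "ennreal (e n)"] by simp
    then obtain \<rho> where "\<rho> \<in> K" "wasserstein_pow 2 \<rho> \<mu> < I + ennreal (e n)"
      unfolding I_def INF_less_iff by blast
    moreover from this(2) obtain \<gamma> where "\<gamma> \<in> transport_plans \<rho> \<mu>" "quadratic_cost \<gamma> < I + ennreal (e n)"
      unfolding wasserstein_pow_2 INF_less_iff by blast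
    ultimately show ?thesis by (intro exI[of _ "(\<rho>, \<gamma>)"]) simp
  qed
  then have "\<forall>n. \<exists>q. fst q \<in> K \<and> snd q \<in> transport_plans (fst q) \<mu> \<and> quadratic_cost (snd q) < I + ennreal (e n)"
    by (rule allI)
  from choice[OF this] obtain q where q: "\<forall>n. fst (q n) \<in> K \<and> snd (q n) \<in> transport_plans (fst (q n)) \<mu> \<and>
      quadratic_cost (snd (q n)) < I + ennreal (e n)" ..
  define \<rho> \<gamma> where "\<rho> n = fst (q n)" and "\<gamma> n = snd (q n)" for n
  have \<rho>: "\<rho> n \<in> K" and \<gamma>: "\<gamma> n \<in> transport_plans (\<rho> n) \<mu>" and cost: "quadratic_cost (\<gamma> n) < I + ennreal (e n)" for n
    using q by (simp_all add: \<rho>_def \<gamma>_def)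
  note g = transport_plansD[OF \<gamma>]
  \<comment> \<open>\<open>I + 1\<close> bounds all costs along the sequence, since
    \<open>e n \<le> 1\<close>.\<close>
  define B where "B = 2 * (I + 1) + 2 * (\<integral>\<^sup>+ x. ennreal ((norm x)\<^sup>2) \<partial>\<mu>)"
  have B: "(\<integral>\<^sup>+ x. ennreal ((norm x)\<^sup>2) \<partial>\<rho> n) \<le> B" for n
  proof -
    have "e n \<le> 1" unfolding e_def by (rule inverse_le_1_iff[THEN iffD2]) simp
    then have "I + ennreal (e n) \<le> I + 1" by (intro add_left_mono) (simp flip: ennreal_1 add: ennreal_leI del: ennreal_1)
    then have "quadratic_cost (\<gamma> n) \<le> I + 1" by (rule order.trans[OF less_imp_le[OF cost]])
    then have "2 * quadratic_cost (\<gamma> n) + 2 * (\<integral>\<^sup>+ x. ennreal ((norm x)\<^sup>2) \<partial>\<mu>) \<le> B"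
      unfolding B_def by (intro add_right_mono mult_left_mono) simp_all
    then show ?thesis by (rule order.trans[OF second_moment_le[OF \<gamma>]])
  qed
  have B_fin: "B < \<infinity>" using I_fin \<mu>D(4) by (simp add: B_def ennreal_mult_less_top)
  then have B_real: "ennreal (enn2real B) = B" by (intro ennreal_enn2real) simp
  have B': "(\<integral>\<^sup>+ x. ennreal ((norm x)\<^sup>2) \<partial>\<rho> n) \<le> ennreal (enn2real B)" for n
    unfolding B_real by (rule B)
  have tight: "\<exists>R. \<forall>n. measure (\<gamma> n) {p. norm p > R} < \<epsilon>" if "\<epsilon> > 0" for \<epsilon>
  proof (rule transport_plans_tight[OF \<gamma> _ that])
    fix \<epsilon> :: real assume "\<epsilon> > 0"
    then show "\<exists>R. \<forall>n. measure (\<rho> n) {x. norm x > R} < \<epsilon>"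
      by (rule tight_of_second_moment[OF g(6) g(8) B'])
  qed
  obtain r M where r: "strict_mono (r :: nat \<Rightarrow> nat)" and M: "sets M = sets borel" "prob_space M"
    and lim: "lsc_limit (\<lambda>n. \<gamma> (r n)) M"
    by (rule tight_imp_lsc_limit[of \<gamma>, OF g(1) g(2) tight]) (assumption, rule that)
  define \<sigma> where "\<sigma> = distr M borel fst"
  have M_plan: "M \<in> transport_plans \<sigma> \<mu>"
    unfolding \<sigma>_def by (rule lsc_limit_transport_plans[OF \<gamma> M lim])
  note m = transport_plansD[OF M_plan]
  have \<sigma>_open: "emeasure \<sigma> U \<le> liminf (\<lambda>n. emeasure (\<rho> (r n)) U)" if U: "open U" for U
    unfolding transport_plans_marginal_fst[OF M_plan borel_open[OF U], symmetric]
      transport_plans_marginal_fst[OF \<gamma> borel_open[OF U], symmetric]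
    by (rule lsc_limit_open[OF lim open_Times[OF U open_UNIV] g(1) M(1)])
  have "emeasure \<sigma> U \<le> emeasure lborel U" if U: "open U" for U
  proof -
    have "liminf (\<lambda>n. emeasure (\<rho> (r n)) U) \<le> liminf (\<lambda>n. emeasure lborel U)"
      using sub_lebesgue.le_lborel[OF KD(2)[OF \<rho>] borel_open[OF U]] by (intro Liminf_mono always_eventually allI)
    also have "\<dots> = emeasure lborel U" by (simp add: Liminf_const)
    finally show ?thesis using \<sigma>_open[OF U] by (rule order.trans[rotated])
  qed
  then have "sub_lebesgue \<sigma>"
    using emeasure_le_lborel_of_open_le[OF m(6)] m(6,8) by (simp add: sub_lebesgue_iff)
  moreover have "emeasure \<sigma> (- \<Omega>) = 0"
  \<comment> \<open>Closedness of \<open>\<Omega>\<close> enters here: its complement is open, so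
    its vanishing mass is inherited by the limit.\<close>
  proof -
    have "emeasure \<sigma> (- \<Omega>) \<le> liminf (\<lambda>n. emeasure (\<rho> (r n)) (- \<Omega>))"
      using \<Omega>(1) by (intro \<sigma>_open) (simp add: open_Compl)
    also have "\<dots> = 0"
      unfolding prob_measures_2D(3)[OF KD(1)[OF \<rho>]] by (simp add: Liminf_const)
    finally show ?thesis by simp
  qed
  moreover have "(\<integral>\<^sup>+ x. ennreal ((norm x)\<^sup>2) \<partial>\<sigma>) < \<infinity>"
  proof -
    have "(\<integral>\<^sup>+ x. ennreal ((norm x)\<^sup>2) \<partial>\<sigma>) = (\<integral>\<^sup>+ p. ennreal ((norm (fst p))\<^sup>2) \<partial>M)"
      using nn_integral_fst_plan[OF M_plan, of "\<lambda>x. ennreal ((norm x)\<^sup>2)"] by simp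
    also have "\<dots> \<le> liminf (\<lambda>n. \<integral>\<^sup>+ p. ennreal ((norm (fst p))\<^sup>2) \<partial>\<gamma> (r n))"
      by (rule lsc_limit_continuous[OF lim]) (intro continuous_intros)
    also have "\<dots> = liminf (\<lambda>n. \<integral>\<^sup>+ x. ennreal ((norm x)\<^sup>2) \<partial>\<rho> (r n))"
      using nn_integral_fst_plan[OF \<gamma>, of "\<lambda>x. ennreal ((norm x)\<^sup>2)"] by simp
    also have "\<dots> \<le> liminf (\<lambda>n. B)"
      using B by (intro Liminf_mono always_eventually allI)
    also have "\<dots> < \<infinity>" using B_fin by (simp add: Liminf_const)
    finally show ?thesis .
  qed
  ultimately have \<sigma>_K: "\<sigma> \<in> K"
    using m(6,8) by (simp add: K_def bounded_density_measures_iff prob_measures_p_def)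
  have \<sigma>_le: "wasserstein_pow 2 \<sigma> \<mu> \<le> I"
  proof -
    have "wasserstein_pow 2 \<sigma> \<mu> \<le> quadratic_cost M" by (rule wasserstein_pow_le_cost[OF M_plan])
    also have "\<dots> \<le> liminf (\<lambda>n. quadratic_cost (\<gamma> (r n)))"
      unfolding quadratic_cost_def by (rule lsc_limit_continuous[OF lim]) (intro continuous_intros)
    also have "\<dots> \<le> liminf (\<lambda>n. I + ennreal (e (r n)))"
      using cost by (intro Liminf_mono always_eventually allI less_imp_le)
    also have "\<dots> = I"
    proof -
      have "e \<longlonglongrightarrow> 0" unfolding e_def by (rule LIMSEQ_inverse_real_of_nat)
      then have "(\<lambda>n. e (r n)) \<longlonglongrightarrow> 0"
        using LIMSEQ_subseq_LIMSEQ[OF _ r, of e 0] by (simp only: comp_def)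
      then have "(\<lambda>n. I + ennreal (e (r n))) \<longlonglongrightarrow> I + ennreal 0"
        by (intro tendsto_add tendsto_const tendsto_ennrealI)
      from lim_imp_Liminf[OF sequentially_bot this] show ?thesis by simp
    qed
    finally show ?thesis .
  qed
  show ?thesis unfolding K_def[symmetric]
  proof (intro bexI[OF _ \<sigma>_K] ballI)
    fix \<rho>' assume "\<rho>' \<in> K"
    then have "I \<le> wasserstein_pow 2 \<rho>' \<mu>" unfolding I_def by (rule INF_lower)
    with \<sigma>_le show "wasserstein_pow 2 \<sigma> \<mu> \<le> wasserstein_pow 2 \<rho>' \<mu>" by (rule order.trans)
  qed
qed

text \<open>\<open>arg_min_on\<close> is a Hilbert choice; the existence theorem supplies the
  witness that makes the chosen measure an actual minimizer.\<close>

lemma density_projection_minimal: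
  fixes \<Omega> :: "'a::euclidean_space set"
  assumes \<Omega>: "closed \<Omega>" "convex \<Omega>" "emeasure lborel \<Omega> \<ge> 1" and \<mu>: "\<mu> \<in> prob_measures_p 2 \<Omega>"
  shows "density_projection 2 \<Omega> \<mu> \<in> bounded_density_measures 2 \<Omega>"
    "\<rho> \<in> bounded_density_measures 2 \<Omega> \<Longrightarrow>
      wasserstein_pow 2 (density_projection 2 \<Omega> \<mu>) \<mu> \<le> wasserstein_pow 2 \<rho> \<mu>"
proof -
  let ?f = "\<lambda>\<rho>. wasserstein_pow 2 \<rho> \<mu>" and ?K = "bounded_density_measures 2 \<Omega>"
  obtain \<rho>0 where "\<rho>0 \<in> ?K" "\<forall>\<rho>'\<in>?K. ?f \<rho>0 \<le> ?f \<rho>'"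
    using density_projection_exists[OF assms] by blast
  then have "is_arg_min ?f (\<lambda>\<rho>. \<rho> \<in> ?K) \<rho>0" by (auto simp: is_arg_min_def not_less)
  then have "is_arg_min ?f (\<lambda>\<rho>. \<rho> \<in> ?K) (density_projection 2 \<Omega> \<mu>)"
    unfolding density_projection_def arg_min_on_def arg_min_def by (rule someI)
  then show "density_projection 2 \<Omega> \<mu> \<in> ?K" "\<rho> \<in> ?K \<Longrightarrow> ?f (density_projection 2 \<Omega> \<mu>) \<le> ?f \<rho>"
    by (auto simp: is_arg_min_def not_less)
qed

section \<open>Approximate gluing of couplings\<close>

text \<open>On each pair of fibres with common label \<open>i\<close> the coupling is the product
  measure divided by the common mass \<open>m i\<close>. Integrating out one variable returns the
  factor \<open>m i\<close>. Labels of mass 0 are countably many and form a null set, so the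
  infinite density there does no harm.\<close>

lemma coupling_of_labels:
  fixes a :: "'u \<Rightarrow> nat" and b :: "'v \<Rightarrow> nat"
  assumes \<alpha>: "prob_space \<alpha>" and \<beta>: "prob_space \<beta>"
    and a [measurable]: "a \<in> \<alpha> \<rightarrow>\<^sub>M count_space UNIV" and b [measurable]: "b \<in> \<beta> \<rightarrow>\<^sub>M count_space UNIV"
    and eq: "\<And>i. emeasure \<alpha> {u \<in> space \<alpha>. a u = i} = emeasure \<beta> {v \<in> space \<beta>. b v = i}"
  obtains \<Gamma> where "sets \<Gamma> = sets (\<alpha> \<Otimes>\<^sub>M \<beta>)"
    "\<And>X. X \<in> sets \<alpha> \<Longrightarrow> emeasure \<Gamma> (X \<times> space \<beta>) = emeasure \<alpha> X"
    "\<And>Y. Y \<in> sets \<beta> \<Longrightarrow> emeasure \<Gamma> (space \<alpha> \<times> Y) = emeasure \<beta> Y"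
    "AE p in \<Gamma>. a (fst p) = b (snd p)"
proof -
  interpret \<alpha>: prob_space \<alpha> by fact
  interpret \<beta>: prob_space \<beta> by fact
  interpret pair_prob_space \<alpha> \<beta> ..
  define m where "m i = emeasure \<alpha> {u \<in> space \<alpha>. a u = i}" for i
  have m_less: "m i < \<infinity>" for i unfolding m_def by (simp add: \<alpha>.emeasure_eq_measure)
  have m_\<beta>: "m i = emeasure \<beta> {v \<in> space \<beta>. b v = i}" for i unfolding m_def by (rule eq)
  have inv: "1 / m i * m i = 1" if "m i \<noteq> 0" for i
    using that m_less[of i] by (simp add: ennreal_times_divide ennreal_divide_self mult.commute)
  define f where "f p = (if a (fst p) = b (snd p) then 1 / m (a (fst p)) else 0)" for p
  have f [measurable]: "f \<in> borel_measurable (\<alpha> \<Otimes>\<^sub>M \<beta>)"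
  proof -
    have A [measurable]: "(\<lambda>p. a (fst p)) \<in> \<alpha> \<Otimes>\<^sub>M \<beta> \<rightarrow>\<^sub>M count_space UNIV"
      by (rule measurable_compose[OF measurable_fst a])
    have [measurable]: "(\<lambda>p. b (snd p)) \<in> \<alpha> \<Otimes>\<^sub>M \<beta> \<rightarrow>\<^sub>M count_space UNIV"
      by (rule measurable_compose[OF measurable_snd b])
    have "(\<lambda>p. 1 / m (a (fst p))) \<in> borel_measurable (\<alpha> \<Otimes>\<^sub>M \<beta>)"
      by (rule measurable_compose[OF A, of "\<lambda>i. 1 / m i"]) simp
    moreover have "Measurable.pred (\<alpha> \<Otimes>\<^sub>M \<beta>) (\<lambda>p. \<exists>i. a (fst p) = i \<and> b (snd p) = i)" by measurable
    then have "Measurable.pred (\<alpha> \<Otimes>\<^sub>M \<beta>) (\<lambda>p. a (fst p) = b (snd p))" by (simp add: eq_commute)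
    ultimately show ?thesis unfolding f_def by measurable
  qed
  have pos_a: "AE u in \<alpha>. m (a u) \<noteq> 0"
  proof -
    have "AE u in \<alpha>. \<not> (a u = i \<and> m i = 0)" for i
    proof (cases "m i = 0")
      case True
      have "{u \<in> space \<alpha>. a u = i} \<in> null_sets \<alpha>"
        using True unfolding m_def null_sets_def by simp
      then show ?thesis by (rule AE_I') auto
    qed simp
    then have "AE u in \<alpha>. \<forall>i. \<not> (a u = i \<and> m i = 0)" unfolding AE_all_countable by (rule allI)
    then show ?thesis by eventually_elim blast
  qed
  have pos_b: "AE v in \<beta>. m (b v) \<noteq> 0"
  proof -
    have "AE v in \<beta>. \<not> (b v = i \<and> m i = 0)" for i
    proof (cases "m i = 0")
      case True
      have "{v \<in> space \<beta>. b v = i} \<in> null_sets \<beta>"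
        using True unfolding m_\<beta> null_sets_def by simp
      then show ?thesis by (rule AE_I') auto
    qed simp
    then have "AE v in \<beta>. \<forall>i. \<not> (b v = i \<and> m i = 0)" unfolding AE_all_countable by (rule allI)
    then show ?thesis by eventually_elim blast
  qed
  show ?thesis
  proof (rule that[of "density (\<alpha> \<Otimes>\<^sub>M \<beta>) f"])
    fix X assume [measurable]: "X \<in> sets \<alpha>"
    have "emeasure (density (\<alpha> \<Otimes>\<^sub>M \<beta>) f) (X \<times> space \<beta>) = (\<integral>\<^sup>+ p. f p * indicator (X \<times> space \<beta>) p \<partial>(\<alpha> \<Otimes>\<^sub>M \<beta>))"
      by (rule emeasure_density) measurable
    also have "\<dots> = (\<integral>\<^sup>+ u. \<integral>\<^sup>+ v. f (u, v) * indicator (X \<times> space \<beta>) (u, v) \<partial>\<beta> \<partial>\<alpha>)"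
      by (rule \<beta>.nn_integral_fst[symmetric]) measurable
    also have "\<dots> = (\<integral>\<^sup>+ u. indicator X u \<partial>\<alpha>)"
    proof (rule nn_integral_cong_AE, use pos_a in eventually_elim)
      fix u assume u: "m (a u) \<noteq> 0"
      have "(\<integral>\<^sup>+ v. f (u, v) * indicator (X \<times> space \<beta>) (u, v) \<partial>\<beta>)
        = (\<integral>\<^sup>+ v. (1 / m (a u) * indicator X u) * indicator {v \<in> space \<beta>. b v = a u} v \<partial>\<beta>)"
        by (intro nn_integral_cong) (auto simp: f_def indicator_def)
      also have "\<dots> = (1 / m (a u) * indicator X u) * m (a u)"
        unfolding m_\<beta>[of "a u"] by (rule nn_integral_cmult_indicator) measurable
      also have "\<dots> = indicator X u" using inv[OF u] by (simp add: indicator_def)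
      finally show "(\<integral>\<^sup>+ v. f (u, v) * indicator (X \<times> space \<beta>) (u, v) \<partial>\<beta>) = indicator X u" .
    qed
    also have "\<dots> = emeasure \<alpha> X" by simp
    finally show "emeasure (density (\<alpha> \<Otimes>\<^sub>M \<beta>) f) (X \<times> space \<beta>) = emeasure \<alpha> X" .
  next
    fix Y assume [measurable]: "Y \<in> sets \<beta>"
    have "emeasure (density (\<alpha> \<Otimes>\<^sub>M \<beta>) f) (space \<alpha> \<times> Y) = (\<integral>\<^sup>+ p. f p * indicator (space \<alpha> \<times> Y) p \<partial>(\<alpha> \<Otimes>\<^sub>M \<beta>))"
      by (rule emeasure_density) measurable
    also have "\<dots> = (\<integral>\<^sup>+ v. \<integral>\<^sup>+ u. f (u, v) * indicator (space \<alpha> \<times> Y) (u, v) \<partial>\<alpha> \<partial>\<beta>)"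
      by (rule nn_integral_snd[symmetric]) measurable
    also have "\<dots> = (\<integral>\<^sup>+ v. indicator Y v \<partial>\<beta>)"
    proof (rule nn_integral_cong_AE, use pos_b in eventually_elim)
      fix v assume v: "m (b v) \<noteq> 0"
      have "(\<integral>\<^sup>+ u. f (u, v) * indicator (space \<alpha> \<times> Y) (u, v) \<partial>\<alpha>)
        = (\<integral>\<^sup>+ u. (1 / m (b v) * indicator Y v) * indicator {u \<in> space \<alpha>. a u = b v} u \<partial>\<alpha>)"
        by (intro nn_integral_cong) (auto simp: f_def indicator_def)
      also have "\<dots> = (1 / m (b v) * indicator Y v) * m (b v)"
        unfolding m_def[of "b v"] by (rule nn_integral_cmult_indicator) measurable
      also have "\<dots> = indicator Y v" using inv[OF v] by (simp add: indicator_def)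
      finally show "(\<integral>\<^sup>+ u. f (u, v) * indicator (space \<alpha> \<times> Y) (u, v) \<partial>\<alpha>) = indicator Y v" .
    qed
    also have "\<dots> = emeasure \<beta> Y" by simp
    finally show "emeasure (density (\<alpha> \<Otimes>\<^sub>M \<beta>) f) (space \<alpha> \<times> Y) = emeasure \<beta> Y" .
  next
    show "AE p in density (\<alpha> \<Otimes>\<^sub>M \<beta>) f. a (fst p) = b (snd p)"
      by (subst AE_density) (simp_all add: f_def)
  qed simp
qed

text \<open>The label of \<open>x\<close> is the index of the first point of a dense sequence within
  \<open>\<epsilon> / 2\<close> of \<open>x\<close>; two points with the same label are close to the
  same point.\<close>

lemma small_cell_label:
  assumes "\<epsilon> > 0"
  obtains c :: "'a::euclidean_space \<Rightarrow> nat" where "c \<in> borel \<rightarrow>\<^sub>M count_space UNIV"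
    "\<And>x y. c x = c y \<Longrightarrow> dist x y \<le> \<epsilon>"
proof -
  obtain D :: "'a set" where D: "countable D" "\<And>X. open X \<Longrightarrow> X \<noteq> {} \<Longrightarrow> \<exists>d\<in>D. d \<in> X"
    by (rule countable_dense_setE) (rule that)
  define c where "c x = (LEAST n. dist (from_nat_into D n) x < \<epsilon> / 2)" for x
  have ex: "\<exists>n. dist (from_nat_into D n) x < \<epsilon> / 2" for x
  proof -
    have "ball x (\<epsilon> / 2) \<noteq> {}" using assms by simp
    then obtain d where "d \<in> D" "d \<in> ball x (\<epsilon> / 2)" using D(2)[OF open_ball] by blast
    then have "dist (from_nat_into D (to_nat_on D d)) x < \<epsilon> / 2" using D(1) by (simp add: dist_commute)
    then show ?thesis ..
  qed
  have c: "dist (from_nat_into D (c x)) x < \<epsilon> / 2" for x unfolding c_def by (rule LeastI_ex[OF ex])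
  show ?thesis
  proof (rule that[of c])
    show "c \<in> borel \<rightarrow>\<^sub>M count_space UNIV" unfolding c_def by measurable
    show "dist x y \<le> \<epsilon>" if "c x = c y" for x y
      using c[of x] c[of y] dist_triangle3[of x y "from_nat_into D (c x)"] that by simp
  qed
qed

text \<open>Exact gluing needs disintegration; matching the two copies of the common marginal only up
  to a cell of a fine countable partition does not.\<close>

lemma approximate_gluing:
  fixes \<alpha> :: "'u::second_countable_topology measure" and \<beta> :: "'v::second_countable_topology measure"
    and f :: "'u \<Rightarrow> 'a::euclidean_space" and g :: "'v \<Rightarrow> 'a"
  assumes \<alpha>: "sets \<alpha> = sets borel" "prob_space \<alpha>" and \<beta>: "sets \<beta> = sets borel" "prob_space \<beta>"
    and f: "f \<in> \<alpha> \<rightarrow>\<^sub>M borel" and g: "g \<in> \<beta> \<rightarrow>\<^sub>M borel"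
    and eq: "distr \<alpha> borel f = distr \<beta> borel g" and "\<epsilon> > 0"
  obtains \<Gamma> :: "('u \<times> 'v) measure" where "sets \<Gamma> = sets borel" "prob_space \<Gamma>"
    "distr \<Gamma> borel fst = \<alpha>" "distr \<Gamma> borel snd = \<beta>" "AE p in \<Gamma>. dist (f (fst p)) (g (snd p)) \<le> \<epsilon>"
proof -
  obtain c :: "'a \<Rightarrow> nat" where c: "c \<in> borel \<rightarrow>\<^sub>M count_space UNIV" "\<And>x y. c x = c y \<Longrightarrow> dist x y \<le> \<epsilon>"
    by (rule small_cell_label[OF \<open>\<epsilon> > 0\<close>]) (rule that)
  have sp: "space \<alpha> = UNIV" "space \<beta> = UNIV"
    using sets_eq_imp_space_eq[OF \<alpha>(1)] sets_eq_imp_space_eq[OF \<beta>(1)] by simp_all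
  \<comment> \<open>Equal laws of \<open>f\<close> and \<open>g\<close> give each cell the same mass
    on both sides, which is all that the coupling of labels asks for.\<close>
  have "emeasure \<alpha> {u \<in> space \<alpha>. c (f u) = i} = emeasure \<beta> {v \<in> space \<beta>. c (g v) = i}" for i
  proof -
    have C: "{x. c x = i} \<in> sets borel" using measurable_sets[OF c(1), of "{i}"] by (simp add: vimage_def)
    have "emeasure (distr \<alpha> borel f) {x. c x = i} = emeasure (distr \<beta> borel g) {x. c x = i}" by (simp add: eq)
    then show ?thesis by (simp add: emeasure_distr[OF f C] emeasure_distr[OF g C] vimage_def sp)
  qed
  note labels = this
  obtain \<Gamma> where \<Gamma>: "sets \<Gamma> = sets (\<alpha> \<Otimes>\<^sub>M \<beta>)"
    "\<And>X. X \<in> sets \<alpha> \<Longrightarrow> emeasure \<Gamma> (X \<times> space \<beta>) = emeasure \<alpha> X"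
    "\<And>Y. Y \<in> sets \<beta> \<Longrightarrow> emeasure \<Gamma> (space \<alpha> \<times> Y) = emeasure \<beta> Y"
    "AE p in \<Gamma>. c (f (fst p)) = c (g (snd p))"
    by (rule coupling_of_labels[OF \<alpha>(2) \<beta>(2) measurable_compose[OF f c(1)] measurable_compose[OF g c(1)] labels])
      (rule that)
  have sets: "sets \<Gamma> = sets borel"
    unfolding \<Gamma>(1) sets_pair_measure_cong[OF \<alpha>(1) \<beta>(1)] borel_prod ..
  have sp\<Gamma>: "space \<Gamma> = UNIV" using sets_eq_imp_space_eq[OF sets] by simp
  have eqs: "fst -` X = X \<times> (UNIV :: 'v set)" "snd -` Y = (UNIV :: 'u set) \<times> Y" for X Y by auto
  note m = measurable_fst_snd_borel[OF sets]
  show ?thesis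
  proof (rule that[OF sets])
    show "prob_space \<Gamma>"
      using \<Gamma>(2)[of UNIV] prob_space.emeasure_space_1[OF \<alpha>(2)] \<alpha>(1) sp sp\<Gamma> by (intro prob_spaceI) simp
    show "distr \<Gamma> borel fst = \<alpha>"
      by (rule measure_eqI) (simp_all add: \<alpha>(1) emeasure_distr[OF m(1)] eqs sp\<Gamma> \<Gamma>(2)[unfolded sp \<alpha>(1)])
    show "distr \<Gamma> borel snd = \<beta>"
      by (rule measure_eqI) (simp_all add: \<beta>(1) emeasure_distr[OF m(2)] eqs sp\<Gamma> \<Gamma>(3)[unfolded sp \<beta>(1)])
    show "AE p in \<Gamma>. dist (f (fst p)) (g (snd p)) \<le> \<epsilon>"
      using \<Gamma>(4) by eventually_elim (rule c(2))
  qed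
qed

section \<open>Competitors along the interpolation and pointwise estimates\<close>

lemma distr_pair_transport_plan:
  fixes f g :: "'u \<Rightarrow> 'a::euclidean_space"
  assumes "prob_space P" and f: "f \<in> P \<rightarrow>\<^sub>M borel" and g: "g \<in> P \<rightarrow>\<^sub>M borel"
  shows "distr P borel (\<lambda>p. (f p, g p)) \<in> transport_plans (distr P borel f) (distr P borel g)"
    and "quadratic_cost (distr P borel (\<lambda>p. (f p, g p))) = (\<integral>\<^sup>+ p. ennreal ((norm (f p - g p))\<^sup>2) \<partial>P)"
proof -
  have fg: "(\<lambda>p. (f p, g p)) \<in> P \<rightarrow>\<^sub>M borel"
    unfolding borel_prod[symmetric] by (rule measurable_Pair[OF f g])
  note m = measurable_fst_snd_borel[where \<gamma>="borel :: ('a \<times> 'a) measure", OF refl]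
  show "distr P borel (\<lambda>p. (f p, g p)) \<in> transport_plans (distr P borel f) (distr P borel g)"
    using prob_space.prob_space_distr[OF assms(1) fg]
    by (simp add: transport_plans_def distr_distr[OF m(1) fg] distr_distr[OF m(2) fg] comp_def)
  show "quadratic_cost (distr P borel (\<lambda>p. (f p, g p))) = (\<integral>\<^sup>+ p. ennreal ((norm (f p - g p))\<^sup>2) \<partial>P)"
    unfolding quadratic_cost_def by (subst nn_integral_distr[OF fg]) simp_all
qed

text \<open>Convexity keeps the interpolation in \<open>\<Omega>\<close> unless an endpoint lies
  outside, which happens with mass 0. Thus the interpolations compete in both minimization
  problems.\<close>

lemma interpolant_bounded_density:
  fixes \<Omega> :: "'a::euclidean_space set"
  assumes \<Omega>: "closed \<Omega>" "convex \<Omega>" and \<rho>: "\<rho> \<in> prob_measures_p 2 \<Omega>" and \<sigma>: "\<sigma> \<in> prob_measures_p 2 \<Omega>"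
    and \<pi>: "\<pi> \<in> transport_plans \<rho> \<sigma>" and t: "t \<in> {0..1}"
    and le: "\<And>A. A \<in> sets borel \<Longrightarrow> emeasure \<pi> {p. (1 - t) *\<^sub>R fst p + t *\<^sub>R snd p \<in> A} \<le> emeasure lborel A"
  shows "distr \<pi> borel (\<lambda>p. (1 - t) *\<^sub>R fst p + t *\<^sub>R snd p) \<in> bounded_density_measures 2 \<Omega>"
proof -
  let ?f = "\<lambda>p :: 'a \<times> 'a. (1 - t) *\<^sub>R fst p + t *\<^sub>R snd p"
  note g = transport_plansD[OF \<pi>]
  have m: "?f \<in> \<pi> \<rightarrow>\<^sub>M borel"
    unfolding borel_measurable_plan[OF \<pi>] by (intro borel_measurable_continuous_onI continuous_intros)
  have distr_eq: "emeasure (distr \<pi> borel ?f) A = emeasure \<pi> {p. ?f p \<in> A}" if "A \<in> sets borel" for A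
    using that by (simp add: emeasure_distr[OF m] g(5) vimage_def)
  have prob: "prob_space (distr \<pi> borel ?f)" by (rule prob_space.prob_space_distr[OF g(2) m])
  then have "sub_lebesgue (distr \<pi> borel ?f)"
    using le by (simp add: sub_lebesgue_iff distr_eq)
  moreover have "emeasure (distr \<pi> borel ?f) (- \<Omega>) = 0"
  proof -
    have C: "- \<Omega> \<in> sets borel" using \<Omega>(1) by simp
    have sets: "(- \<Omega>) \<times> UNIV \<in> sets \<pi>" "UNIV \<times> (- \<Omega>) \<in> sets \<pi>"
      unfolding g(1) borel_prod[symmetric] by (intro pair_measureI C; simp)+
    have "emeasure (distr \<pi> borel ?f) (- \<Omega>) = emeasure \<pi> {p. ?f p \<in> - \<Omega>}" by (rule distr_eq[OF C])
    also have "\<dots> \<le> emeasure \<pi> ((- \<Omega>) \<times> UNIV \<union> UNIV \<times> (- \<Omega>))"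
    proof (rule emeasure_mono)
      show "{p. ?f p \<in> - \<Omega>} \<subseteq> (- \<Omega>) \<times> UNIV \<union> UNIV \<times> (- \<Omega>)"
      proof
        fix p assume p: "p \<in> {p. ?f p \<in> - \<Omega>}"
        have "?f p \<in> \<Omega>" if "fst p \<in> \<Omega>" "snd p \<in> \<Omega>"
          using t by (intro convexD[OF \<Omega>(2) that]) auto
        with p show "p \<in> (- \<Omega>) \<times> UNIV \<union> UNIV \<times> (- \<Omega>)" by (cases p) auto
      qed
    qed (rule sets.Un[OF sets])
    also have "\<dots> \<le> emeasure \<pi> ((- \<Omega>) \<times> UNIV) + emeasure \<pi> (UNIV \<times> (- \<Omega>))"
      by (rule emeasure_subadditive[OF sets])
    also have "\<dots> = 0"
      unfolding transport_plans_marginal_fst[OF \<pi> C] transport_plans_marginal_snd[OF \<pi> C]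
      using prob_measures_2D(3)[OF \<rho>] prob_measures_2D(3)[OF \<sigma>] by simp
    finally show ?thesis by simp
  qed
  moreover have "(\<integral>\<^sup>+ x. ennreal ((norm x)\<^sup>2) \<partial>distr \<pi> borel ?f) < \<infinity>"
  proof -
    have "(\<integral>\<^sup>+ x. ennreal ((norm x)\<^sup>2) \<partial>distr \<pi> borel ?f) = (\<integral>\<^sup>+ p. ennreal ((norm (?f p))\<^sup>2) \<partial>\<pi>)"
      by (rule nn_integral_distr[OF m]) simp
    also have "\<dots> \<le> (\<integral>\<^sup>+ p. ennreal (2 * (norm (fst p))\<^sup>2 + 2 * (norm (snd p))\<^sup>2) \<partial>\<pi>)"
    proof (intro nn_integral_mono ennreal_leI)
      fix p :: "'a \<times> 'a"
      have "(norm (?f p))\<^sup>2 \<le> 2 * (norm ((1 - t) *\<^sub>R fst p))\<^sup>2 + 2 * (norm (- (t *\<^sub>R snd p)))\<^sup>2"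
        using norm_diff_power2_le[of "(1 - t) *\<^sub>R fst p" "- (t *\<^sub>R snd p)"] by simp
      also have "\<dots> \<le> 2 * (norm (fst p))\<^sup>2 + 2 * (norm (snd p))\<^sup>2"
        using t by (intro add_mono mult_left_mono power_mono) (auto intro: mult_left_le_one_le)
      finally show "(norm (?f p))\<^sup>2 \<le> 2 * (norm (fst p))\<^sup>2 + 2 * (norm (snd p))\<^sup>2" .
    qed
    also have "\<dots> = ennreal 2 * (\<integral>\<^sup>+ p. ennreal ((norm (fst p))\<^sup>2) \<partial>\<pi>) + ennreal 2 * (\<integral>\<^sup>+ p. ennreal ((norm (snd p))\<^sup>2) \<partial>\<pi>)"
      by (rule nn_integral_add_scaled) (simp_all add: borel_measurable_plan[OF \<pi>])
    also have "\<dots> = ennreal 2 * (\<integral>\<^sup>+ x. ennreal ((norm x)\<^sup>2) \<partial>\<rho>) + ennreal 2 * (\<integral>\<^sup>+ x. ennreal ((norm x)\<^sup>2) \<partial>\<sigma>)"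
      using nn_integral_fst_plan[OF \<pi>, of "\<lambda>x. ennreal ((norm x)\<^sup>2)"]
        nn_integral_snd_plan[OF \<pi>, of "\<lambda>x. ennreal ((norm x)\<^sup>2)"] by simp
    also have "\<dots> < \<infinity>"
      using prob_measures_2D(4)[OF \<rho>] prob_measures_2D(4)[OF \<sigma>] by (simp add: ennreal_mult_less_top)
    finally show ?thesis .
  qed
  ultimately show ?thesis
    using prob by (simp add: bounded_density_measures_iff prob_measures_p_def)
qed

text \<open>Expanding the two squares on the left, the cross terms combine to
  \<open>2 t \<langle>(x' - z') - (y - w), z' - x'\<rangle>\<close>, and \<open>2 \<langle>w - y, z' - x'\<rangle>\<close> is estimated by
  \<open>\<parallel>w - y\<parallel>\<^sup>2 + \<parallel>z' - x'\<parallel>\<^sup>2\<close>.\<close>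

lemma interpolation_inequality:
  fixes x' y z' w :: "'a::real_inner"
  assumes "t \<ge> 0"
  shows "(norm ((1 - t) *\<^sub>R x' + t *\<^sub>R z' - y))\<^sup>2 + (norm ((1 - t) *\<^sub>R z' + t *\<^sub>R x' - w))\<^sup>2 + t * (norm (x' - z'))\<^sup>2
    \<le> (norm (x' - y))\<^sup>2 + (norm (z' - w))\<^sup>2 + t * (norm (y - w))\<^sup>2 + 2 * t\<^sup>2 * (norm (x' - z'))\<^sup>2"
proof -
  define u where "u = z' - x'"
  have 1: "(norm ((1 - t) *\<^sub>R x' + t *\<^sub>R z' - y))\<^sup>2 = (norm (x' - y))\<^sup>2 + 2 * t * ((x' - y) \<bullet> u) + t\<^sup>2 * (norm u)\<^sup>2"
  proof -
    have eq: "(1 - t) *\<^sub>R x' + t *\<^sub>R z' - y = (x' - y) + t *\<^sub>R u" by (simp add: u_def algebra_simps)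
    show ?thesis unfolding eq
      by (simp add: power2_norm_eq_inner inner_add_left[of _ "t *\<^sub>R u"] inner_add_right[of _ _ "t *\<^sub>R u"] inner_commute power2_eq_square[of t])
  qed
  have 2: "(norm ((1 - t) *\<^sub>R z' + t *\<^sub>R x' - w))\<^sup>2 = (norm (z' - w))\<^sup>2 - 2 * t * ((z' - w) \<bullet> u) + t\<^sup>2 * (norm u)\<^sup>2"
  proof -
    have eq: "(1 - t) *\<^sub>R z' + t *\<^sub>R x' - w = (z' - w) - t *\<^sub>R u" by (simp add: u_def algebra_simps)
    show ?thesis unfolding eq
      by (simp add: power2_norm_eq_inner inner_diff_left[of _ "t *\<^sub>R u"] inner_diff_right[of _ _ "t *\<^sub>R u"] inner_commute power2_eq_square[of t])
  qed
  have 3: "(x' - y) \<bullet> u - (z' - w) \<bullet> u = (w - y) \<bullet> u - (norm u)\<^sup>2"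
    by (simp add: u_def power2_norm_eq_inner inner_diff_left inner_diff_right)
  have "0 \<le> (norm ((w - y) - u))\<^sup>2" by simp
  also have "\<dots> = (norm (y - w))\<^sup>2 - 2 * ((w - y) \<bullet> u) + (norm u)\<^sup>2"
    by (simp add: power2_norm_eq_inner inner_diff_left inner_diff_right inner_commute)
  finally have "t * (2 * ((w - y) \<bullet> u)) \<le> t * ((norm (y - w))\<^sup>2 + (norm u)\<^sup>2)"
    using assms by (intro mult_left_mono) linarith+
  moreover have "2 * t * ((x' - y) \<bullet> u) - 2 * t * ((z' - w) \<bullet> u) = t * (2 * ((w - y) \<bullet> u)) - 2 * t * (norm u)\<^sup>2"
    using arg_cong[OF 3, of "\<lambda>r. 2 * t * r"] by (simp add: right_diff_distrib)
  moreover have "norm (x' - z') = norm u" by (simp add: u_def norm_minus_commute)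
  ultimately show ?thesis unfolding 1 2 by (simp add: distrib_left)
qed

text \<open>The cross term is absorbed by \<open>2 * r \<le> 1 + r\<^sup>2\<close>, so the error is
  affine in the squared distance and can be integrated against a plan of finite cost.\<close>

lemma norm_power2_perturb:
  fixes x x' y :: "'a::real_normed_vector"
  assumes "dist x x' \<le> \<epsilon>" "\<epsilon> \<ge> 0"
  shows "(norm (x' - y))\<^sup>2 \<le> (1 + \<epsilon>) * (norm (x - y))\<^sup>2 + (\<epsilon> + \<epsilon>\<^sup>2)"
proof -
  define r where "r = norm (x - y)"
  have "norm (x' - y) \<le> r + \<epsilon>"
    using assms(1) norm_triangle_ineq[of "x' - x" "x - y"] by (simp add: r_def dist_norm norm_minus_commute)
  then have "(norm (x' - y))\<^sup>2 \<le> (r + \<epsilon>)\<^sup>2" by (intro power_mono) simp_all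
  also have "\<dots> = r\<^sup>2 + \<epsilon> * (2 * r) + \<epsilon>\<^sup>2" by (simp add: power2_sum)
  also have "\<dots> \<le> r\<^sup>2 + \<epsilon> * (1 + r\<^sup>2) + \<epsilon>\<^sup>2"
    using sum_squares_bound[of r 1] assms(2) by (intro add_mono mult_left_mono) simp_all
  also have "\<dots> = (1 + \<epsilon>) * (norm (x - y))\<^sup>2 + (\<epsilon> + \<epsilon>\<^sup>2)" by (simp add: r_def algebra_simps)
  finally show ?thesis .
qed

lemma sub_lebesgue_pairI: "sub_lebesgue \<rho> \<Longrightarrow> sub_lebesgue \<sigma> \<Longrightarrow> sub_lebesgue_pair \<rho> \<sigma>"
  by (simp add: sub_lebesgue_pair_def)

lemma ennreal_nn_integral_sum3:
  assumes "f \<in> borel_measurable M" "g \<in> borel_measurable M" "h \<in> borel_measurable M"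
    and "\<And>x. f x \<ge> 0" "\<And>x. g x \<ge> 0" "\<And>x. h x \<ge> 0"
  shows "(\<integral>\<^sup>+ x. ennreal (f x + g x + h x) \<partial>M)
    = (\<integral>\<^sup>+ x. ennreal (f x) \<partial>M) + (\<integral>\<^sup>+ x. ennreal (g x) \<partial>M) + (\<integral>\<^sup>+ x. ennreal (h x) \<partial>M)"
proof -
  have "(\<integral>\<^sup>+ x. ennreal (f x + g x + h x) \<partial>M) = (\<integral>\<^sup>+ x. ennreal (f x) + ennreal (g x) + ennreal (h x) \<partial>M)"
    using assms(4-6) by (intro nn_integral_cong) simp
  then show ?thesis using assms(1-3) by (simp add: nn_integral_add)
qed

section \<open>The projection does not increase the distance\<close>

text \<open>Two gluings, over \<open>\<rho>\<close> and then over \<open>\<sigma>\<close>. A point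
  of the product reads \<open>(((x, y), (x', z')), (z, w))\<close>: the common marginals occur
  twice, and the copies \<open>x, x'\<close> and \<open>z, z'\<close> differ by at most
  \<open>\<epsilon>\<close>.\<close>

lemma four_point_coupling:
  fixes \<gamma>1 \<pi> \<gamma>2 :: "('a::euclidean_space \<times> 'a) measure"
  assumes \<gamma>1: "\<gamma>1 \<in> transport_plans \<rho> \<mu>" and \<pi>: "\<pi> \<in> transport_plans \<rho> \<sigma>" and \<gamma>2: "\<gamma>2 \<in> transport_plans \<sigma> \<nu>"
    and "\<epsilon> > 0"
  obtains P :: "((('a \<times> 'a) \<times> ('a \<times> 'a)) \<times> ('a \<times> 'a)) measure" where
    "sets P = sets borel" "prob_space P"
    "distr P borel (\<lambda>p. fst (fst p)) = \<gamma>1" "distr P borel (\<lambda>p. snd (fst p)) = \<pi>" "distr P borel snd = \<gamma>2"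
    "AE p in P. dist (fst (fst (fst p))) (fst (snd (fst p))) \<le> \<epsilon>"
    "AE p in P. dist (snd (snd (fst p))) (fst (snd p)) \<le> \<epsilon>"
proof -
  note g1 = transport_plansD[OF \<gamma>1] and gp = transport_plansD[OF \<pi>] and g2 = transport_plansD[OF \<gamma>2]
  have eq1: "distr \<gamma>1 borel fst = distr \<pi> borel fst" using g1(3) gp(3) by simp
  obtain \<Gamma> where \<Gamma>: "sets \<Gamma> = sets borel" "prob_space \<Gamma>" "distr \<Gamma> borel fst = \<gamma>1" "distr \<Gamma> borel snd = \<pi>"
    "AE p in \<Gamma>. dist (fst (fst p)) (fst (snd p)) \<le> \<epsilon>"
    by (rule approximate_gluing[OF g1(1,2) gp(1,2) measurable_fst_snd_borel(1)[OF g1(1)]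
        measurable_fst_snd_borel(1)[OF gp(1)] eq1 \<open>\<epsilon> > 0\<close>]) (rule that)
  note m\<Gamma> = measurable_fst_snd_borel[OF \<Gamma>(1)]
  note mb = measurable_fst_snd_borel[where \<gamma>="borel :: ('a \<times> 'a) measure", OF refl]
  have eq2: "distr \<Gamma> borel (\<lambda>q. snd (snd q)) = distr \<gamma>2 borel fst"
    using distr_distr[OF mb(2) m\<Gamma>(2)] gp(4) g2(3) by (simp add: \<Gamma>(4) comp_def)
  obtain P where P: "sets P = sets borel" "prob_space P" "distr P borel fst = \<Gamma>" "distr P borel snd = \<gamma>2"
    "AE p in P. dist (snd (snd (fst p))) (fst (snd p)) \<le> \<epsilon>"
    by (rule approximate_gluing[OF \<Gamma>(1,2) g2(1,2) measurable_compose[OF m\<Gamma>(2) mb(2)]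
        measurable_fst_snd_borel(1)[OF g2(1)] eq2 \<open>\<epsilon> > 0\<close>]) (rule that)
  note mP = measurable_fst_snd_borel[OF P(1)]
  note mb\<Gamma> = measurable_fst_snd_borel[where \<gamma>="borel :: (('a \<times> 'a) \<times> ('a \<times> 'a)) measure", OF refl]
  show ?thesis
  proof (rule that[OF P(1,2) _ _ P(4) _ P(5)])
    show "distr P borel (\<lambda>p. fst (fst p)) = \<gamma>1"
      using distr_distr[OF mb\<Gamma>(1) mP(1)] by (simp add: P(3) \<Gamma>(3) comp_def)
    show "distr P borel (\<lambda>p. snd (fst p)) = \<pi>"
      using distr_distr[OF mb\<Gamma>(2) mP(1)] by (simp add: P(3) \<Gamma>(4) comp_def)
    show "AE p in P. dist (fst (fst (fst p))) (fst (snd (fst p))) \<le> \<epsilon>"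
      using \<Gamma>(5) unfolding P(3)[symmetric] by (rule AE_distrD[OF mP(1)])
  qed
qed

text \<open>Both minimality properties are tested with interpolations of \<open>x'\<close> and
  \<open>z'\<close>, coupled to \<open>y\<close> and to \<open>w\<close>. The plan
  \<open>\<gamma>\<close> is the law of \<open>(y, w)\<close>; it depends on \<open>t\<close>,
  \<open>\<epsilon>\<close> and the two nearly optimal plans, hence the existential form.\<close>

lemma projection_estimate:
  fixes \<Omega> :: "'a::euclidean_space set"
  assumes \<Omega>: "closed \<Omega>" "convex \<Omega>"
    and \<rho>: "\<rho> \<in> bounded_density_measures 2 \<Omega>" and \<sigma>: "\<sigma> \<in> bounded_density_measures 2 \<Omega>"
    and \<rho>_min: "\<And>\<rho>'. \<rho>' \<in> bounded_density_measures 2 \<Omega> \<Longrightarrow> wasserstein_pow 2 \<rho> \<mu> \<le> wasserstein_pow 2 \<rho>' \<mu>"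
    and \<sigma>_min: "\<And>\<sigma>'. \<sigma>' \<in> bounded_density_measures 2 \<Omega> \<Longrightarrow> wasserstein_pow 2 \<sigma> \<nu> \<le> wasserstein_pow 2 \<sigma>' \<nu>"
    and \<gamma>1: "\<gamma>1 \<in> transport_plans \<rho> \<mu>" and \<gamma>2: "\<gamma>2 \<in> transport_plans \<sigma> \<nu>"
    and \<pi>: "\<pi> \<in> transport_plans \<rho> \<sigma>"
    and \<pi>_le: "\<And>t A. t \<in> {0..1} \<Longrightarrow> A \<in> sets borel \<Longrightarrow>
      emeasure \<pi> {p. (1 - t) *\<^sub>R fst p + t *\<^sub>R snd p \<in> A} \<le> emeasure lborel A"
    and t: "t \<in> {0..1}" and "\<epsilon> > 0"
  shows "\<exists>\<gamma>\<in>transport_plans \<mu> \<nu>. wasserstein_pow 2 \<rho> \<mu> + wasserstein_pow 2 \<sigma> \<nu> + ennreal t * quadratic_cost \<pi>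
    \<le> ennreal (1 + \<epsilon>) * quadratic_cost \<gamma>1 + ennreal (1 + \<epsilon>) * quadratic_cost \<gamma>2 + ennreal (2 * (\<epsilon> + \<epsilon>\<^sup>2))
      + ennreal t * quadratic_cost \<gamma> + ennreal (2 * t\<^sup>2) * quadratic_cost \<pi>"
proof -
  obtain P :: "((('a \<times> 'a) \<times> ('a \<times> 'a)) \<times> ('a \<times> 'a)) measure" where
    P: "sets P = sets borel" "prob_space P"
    and D: "distr P borel (\<lambda>p. fst (fst p)) = \<gamma>1" "distr P borel (\<lambda>p. snd (fst p)) = \<pi>" "distr P borel snd = \<gamma>2"
    and close: "AE p in P. dist (fst (fst (fst p))) (fst (snd (fst p))) \<le> \<epsilon>"
      "AE p in P. dist (snd (snd (fst p))) (fst (snd p)) \<le> \<epsilon>"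
    by (rule four_point_coupling[OF \<gamma>1 \<pi> \<gamma>2 \<open>\<epsilon> > 0\<close>]) (rule that)
  interpret prob_space P by (rule P(2))
  have PB: "borel_measurable P = borel_measurable borel" by (rule measurable_cong_sets[OF P(1) refl])
  have meas: "f \<in> borel_measurable P" if "continuous_on UNIV f" for f :: "_ \<Rightarrow> 'c::topological_space"
    unfolding PB by (rule borel_measurable_continuous_onI[OF that])
  have m: "(\<lambda>p. fst (fst p)) \<in> P \<rightarrow>\<^sub>M borel" "(\<lambda>p. snd (fst p)) \<in> P \<rightarrow>\<^sub>M borel" "snd \<in> P \<rightarrow>\<^sub>M borel"
    by (rule meas, intro continuous_intros)+
  note mb = measurable_fst_snd_borel[where \<gamma>="borel :: ('a \<times> 'a) measure", OF refl]
  define x y x' z' z w where "x p = fst (fst (fst p))" and "y p = snd (fst (fst p))"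
    and "x' p = fst (snd (fst p))" and "z' p = snd (snd (fst p))" and "z p = fst (snd p)" and "w p = snd (snd p)"
    for p :: "(('a \<times> 'a) \<times> ('a \<times> 'a)) \<times> ('a \<times> 'a)"
  have [measurable]: "x \<in> borel_measurable P" "y \<in> borel_measurable P" "x' \<in> borel_measurable P"
    "z' \<in> borel_measurable P" "z \<in> borel_measurable P" "w \<in> borel_measurable P"
    unfolding x_def y_def x'_def z'_def z_def w_def by (rule meas, intro continuous_intros)+
  have y_law: "distr P borel y = \<mu>"
    using distr_distr[OF mb(2) m(1)] transport_plansD(4)[OF \<gamma>1] by (simp add: D(1) comp_def y_def[abs_def])
  have w_law: "distr P borel w = \<nu>"
    using distr_distr[OF mb(2) m(3)] transport_plansD(4)[OF \<gamma>2] by (simp add: D(3) comp_def w_def[abs_def])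
  have cost: "quadratic_cost \<gamma>1 = (\<integral>\<^sup>+ p. ennreal ((norm (x p - y p))\<^sup>2) \<partial>P)"
    "quadratic_cost \<pi> = (\<integral>\<^sup>+ p. ennreal ((norm (x' p - z' p))\<^sup>2) \<partial>P)"
    "quadratic_cost \<gamma>2 = (\<integral>\<^sup>+ p. ennreal ((norm (z p - w p))\<^sup>2) \<partial>P)"
    unfolding D[symmetric] quadratic_cost_def x_def y_def x'_def z'_def z_def w_def
    by (subst nn_integral_distr[OF m(1)] nn_integral_distr[OF m(2)] nn_integral_distr[OF m(3)]; simp)+
  define X where "X s p = (1 - s) *\<^sub>R x' p + s *\<^sub>R z' p" for s p
  have [measurable]: "X s \<in> borel_measurable P" for s unfolding X_def by measurable
  have X_law: "distr P borel (X s) \<in> bounded_density_measures 2 \<Omega>" if s: "s \<in> {0..1}" for s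
  proof -
    have "(\<lambda>p :: 'a \<times> 'a. (1 - s) *\<^sub>R fst p + s *\<^sub>R snd p) \<in> borel_measurable borel"
      by (intro borel_measurable_continuous_onI continuous_intros)
    from distr_distr[OF this m(2)]
    have "distr P borel (X s) = distr \<pi> borel (\<lambda>p. (1 - s) *\<^sub>R fst p + s *\<^sub>R snd p)"
      by (simp add: D(2) comp_def X_def[abs_def] x'_def z'_def)
    also have "\<dots> \<in> bounded_density_measures 2 \<Omega>"
      using \<rho> \<sigma> by (intro interpolant_bounded_density[OF \<Omega> _ _ \<pi> s \<pi>_le[OF s]]) (simp_all add: bounded_density_measures_iff)
    finally show ?thesis .
  qed
  have A: "wasserstein_pow 2 \<rho> \<mu> \<le> (\<integral>\<^sup>+ p. ennreal ((norm (X t p - y p))\<^sup>2) \<partial>P)"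
  proof -
    have "wasserstein_pow 2 \<rho> \<mu> \<le> wasserstein_pow 2 (distr P borel (X t)) \<mu>" by (rule \<rho>_min[OF X_law[OF t]])
    also have "\<dots> \<le> quadratic_cost (distr P borel (\<lambda>p. (X t p, y p)))"
      using distr_pair_transport_plan(1)[OF P(2), of "X t" y] by (intro wasserstein_pow_le_cost) (simp add: y_law)
    also have "\<dots> = (\<integral>\<^sup>+ p. ennreal ((norm (X t p - y p))\<^sup>2) \<partial>P)"
      by (rule distr_pair_transport_plan(2)[OF P(2)]) measurable
    finally show ?thesis .
  qed
  \<comment> \<open>From \<open>\<sigma>\<close> the interpolation runs backwards: time
    \<open>t\<close> away from \<open>z'\<close> is time \<open>1 - t\<close> away from
    \<open>x'\<close>.\<close>
  have t': "1 - t \<in> {0..1}" using t by simp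
  have B: "wasserstein_pow 2 \<sigma> \<nu> \<le> (\<integral>\<^sup>+ p. ennreal ((norm (X (1 - t) p - w p))\<^sup>2) \<partial>P)"
  proof -
    have "wasserstein_pow 2 \<sigma> \<nu> \<le> wasserstein_pow 2 (distr P borel (X (1 - t))) \<nu>" by (rule \<sigma>_min[OF X_law[OF t']])
    also have "\<dots> \<le> quadratic_cost (distr P borel (\<lambda>p. (X (1 - t) p, w p)))"
      using distr_pair_transport_plan(1)[OF P(2), of "X (1 - t)" w] by (intro wasserstein_pow_le_cost) (simp add: w_law)
    also have "\<dots> = (\<integral>\<^sup>+ p. ennreal ((norm (X (1 - t) p - w p))\<^sup>2) \<partial>P)"
      by (rule distr_pair_transport_plan(2)[OF P(2)]) measurable
    finally show ?thesis .
  qed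
  define \<gamma> where "\<gamma> = distr P borel (\<lambda>p. (y p, w p))"
  have \<gamma>: "\<gamma> \<in> transport_plans \<mu> \<nu>"
    using distr_pair_transport_plan(1)[OF P(2), of y w] by (simp add: \<gamma>_def y_law w_law)
  have cost_\<gamma>: "quadratic_cost \<gamma> = (\<integral>\<^sup>+ p. ennreal ((norm (y p - w p))\<^sup>2) \<partial>P)"
    unfolding \<gamma>_def by (rule distr_pair_transport_plan(2)[OF P(2)]) measurable
  have "wasserstein_pow 2 \<rho> \<mu> + wasserstein_pow 2 \<sigma> \<nu> + ennreal t * quadratic_cost \<pi>
    \<le> (\<integral>\<^sup>+ p. ennreal ((norm (X t p - y p))\<^sup>2) \<partial>P) + (\<integral>\<^sup>+ p. ennreal ((norm (X (1 - t) p - w p))\<^sup>2) \<partial>P)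
      + ennreal t * (\<integral>\<^sup>+ p. ennreal ((norm (x' p - z' p))\<^sup>2) \<partial>P)"
    unfolding cost(2) by (intro add_mono A B order.refl)
  also have "ennreal t * (\<integral>\<^sup>+ p. ennreal ((norm (x' p - z' p))\<^sup>2) \<partial>P) = (\<integral>\<^sup>+ p. ennreal (t * (norm (x' p - z' p))\<^sup>2) \<partial>P)"
    using t by (simp add: ennreal_mult' nn_integral_cmult)
  also have "(\<integral>\<^sup>+ p. ennreal ((norm (X t p - y p))\<^sup>2) \<partial>P) + (\<integral>\<^sup>+ p. ennreal ((norm (X (1 - t) p - w p))\<^sup>2) \<partial>P)
      + (\<integral>\<^sup>+ p. ennreal (t * (norm (x' p - z' p))\<^sup>2) \<partial>P)
    = (\<integral>\<^sup>+ p. ennreal ((norm (X t p - y p))\<^sup>2 + (norm (X (1 - t) p - w p))\<^sup>2 + t * (norm (x' p - z' p))\<^sup>2) \<partial>P)"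
    using t by (intro ennreal_nn_integral_sum3[symmetric]) (simp_all, measurable)
  also have "\<dots> \<le> (\<integral>\<^sup>+ p. ennreal (1 + \<epsilon>) * ennreal ((norm (x p - y p))\<^sup>2) + ennreal (1 + \<epsilon>) * ennreal ((norm (z p - w p))\<^sup>2)
      + ennreal (2 * (\<epsilon> + \<epsilon>\<^sup>2)) + ennreal t * ennreal ((norm (y p - w p))\<^sup>2)
      + ennreal (2 * t\<^sup>2) * ennreal ((norm (x' p - z' p))\<^sup>2) \<partial>P)"
  proof (rule nn_integral_mono_AE, use close in eventually_elim)
    case (elim p)
    have 1: "(norm (x' p - y p))\<^sup>2 \<le> (1 + \<epsilon>) * (norm (x p - y p))\<^sup>2 + (\<epsilon> + \<epsilon>\<^sup>2)"
      using elim(1) \<open>\<epsilon> > 0\<close> by (intro norm_power2_perturb) (simp_all add: x_def x'_def)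
    have 2: "(norm (z' p - w p))\<^sup>2 \<le> (1 + \<epsilon>) * (norm (z p - w p))\<^sup>2 + (\<epsilon> + \<epsilon>\<^sup>2)"
      using elim(2) \<open>\<epsilon> > 0\<close> by (intro norm_power2_perturb) (simp_all add: z_def z'_def dist_commute)
    have "(norm (X t p - y p))\<^sup>2 + (norm (X (1 - t) p - w p))\<^sup>2 + t * (norm (x' p - z' p))\<^sup>2
      \<le> (norm (x' p - y p))\<^sup>2 + (norm (z' p - w p))\<^sup>2 + t * (norm (y p - w p))\<^sup>2 + 2 * t\<^sup>2 * (norm (x' p - z' p))\<^sup>2"
      using interpolation_inequality[of t "x' p" "z' p" "y p" "w p"] t by (simp add: X_def add.commute)
    also have "\<dots> \<le> ((1 + \<epsilon>) * (norm (x p - y p))\<^sup>2 + (\<epsilon> + \<epsilon>\<^sup>2)) + ((1 + \<epsilon>) * (norm (z p - w p))\<^sup>2 + (\<epsilon> + \<epsilon>\<^sup>2))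
      + t * (norm (y p - w p))\<^sup>2 + 2 * t\<^sup>2 * (norm (x' p - z' p))\<^sup>2"
      by (intro add_right_mono add_mono 1 2)
    also have "\<dots> = (1 + \<epsilon>) * (norm (x p - y p))\<^sup>2 + (1 + \<epsilon>) * (norm (z p - w p))\<^sup>2 + 2 * (\<epsilon> + \<epsilon>\<^sup>2)
        + t * (norm (y p - w p))\<^sup>2 + 2 * t\<^sup>2 * (norm (x' p - z' p))\<^sup>2" by simp
    finally have le: "(norm (X t p - y p))\<^sup>2 + (norm (X (1 - t) p - w p))\<^sup>2 + t * (norm (x' p - z' p))\<^sup>2
      \<le> (1 + \<epsilon>) * (norm (x p - y p))\<^sup>2 + (1 + \<epsilon>) * (norm (z p - w p))\<^sup>2 + 2 * (\<epsilon> + \<epsilon>\<^sup>2)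
        + t * (norm (y p - w p))\<^sup>2 + 2 * t\<^sup>2 * (norm (x' p - z' p))\<^sup>2" .
    have "ennreal ((norm (X t p - y p))\<^sup>2 + (norm (X (1 - t) p - w p))\<^sup>2 + t * (norm (x' p - z' p))\<^sup>2)
      \<le> ennreal ((1 + \<epsilon>) * (norm (x p - y p))\<^sup>2 + (1 + \<epsilon>) * (norm (z p - w p))\<^sup>2 + 2 * (\<epsilon> + \<epsilon>\<^sup>2)
        + t * (norm (y p - w p))\<^sup>2 + 2 * t\<^sup>2 * (norm (x' p - z' p))\<^sup>2)"
      by (rule ennreal_leI[OF le])
    also have "\<dots> = ennreal (1 + \<epsilon>) * ennreal ((norm (x p - y p))\<^sup>2) + ennreal (1 + \<epsilon>) * ennreal ((norm (z p - w p))\<^sup>2)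
      + ennreal (2 * (\<epsilon> + \<epsilon>\<^sup>2)) + ennreal t * ennreal ((norm (y p - w p))\<^sup>2)
      + ennreal (2 * t\<^sup>2) * ennreal ((norm (x' p - z' p))\<^sup>2)"
      using t \<open>\<epsilon> > 0\<close> by (simp add: ennreal_plus[symmetric] ennreal_mult[symmetric] del: ennreal_plus)
    finally show ?case .
  qed
  also have "\<dots> = ennreal (1 + \<epsilon>) * quadratic_cost \<gamma>1 + ennreal (1 + \<epsilon>) * quadratic_cost \<gamma>2 + ennreal (2 * (\<epsilon> + \<epsilon>\<^sup>2))
      + ennreal t * quadratic_cost \<gamma> + ennreal (2 * t\<^sup>2) * quadratic_cost \<pi>"
    unfolding cost cost_\<gamma> by (simp add: nn_integral_add nn_integral_cmult emeasure_space_1)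
  finally show ?thesis using \<gamma> by blast
qed

text \<open>For fixed \<open>t\<close> the limit in \<open>\<epsilon>\<close> removes the errors and
  lets \<open>I + J\<close> cancel. Only then is it safe to divide by \<open>t\<close>, after which
  the quadratic term becomes \<open>2 * t * D\<close> and vanishes with \<open>t\<close>.\<close>

lemma le_of_le_perturbation:
  fixes I J D V :: real
  assumes le: "\<And>t \<epsilon>. 0 < t \<Longrightarrow> t \<le> 1 \<Longrightarrow> 0 < \<epsilon> \<Longrightarrow>
    I + J + t * D \<le> (1 + \<epsilon>) * (I + \<epsilon>) + (1 + \<epsilon>) * (J + \<epsilon>) + 2 * (\<epsilon> + \<epsilon>\<^sup>2) + t * V + 2 * t\<^sup>2 * D"
  shows "D \<le> V"
proof -
  have *: "D \<le> V + 2 * t * D" if t: "0 < t" "t \<le> 1" for t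
  proof -
    let ?f = "\<lambda>\<epsilon>. (1 + \<epsilon>) * (I + \<epsilon>) + (1 + \<epsilon>) * (J + \<epsilon>) + 2 * (\<epsilon> + \<epsilon>\<^sup>2) + t * V + 2 * t\<^sup>2 * D"
    have "(?f \<longlongrightarrow> (1 + 0) * (I + 0) + (1 + 0) * (J + 0) + 2 * (0 + 0\<^sup>2) + t * V + 2 * t\<^sup>2 * D) (at_right 0)"
      by (intro tendsto_intros)
    moreover have "\<forall>\<^sub>F \<epsilon> in at_right 0. I + J + t * D \<le> ?f \<epsilon>"
      using eventually_at_right_less[of 0] by eventually_elim (rule le[OF t])
    ultimately have "I + J + t * D \<le> (1 + 0) * (I + 0) + (1 + 0) * (J + 0) + 2 * (0 + 0\<^sup>2) + t * V + 2 * t\<^sup>2 * D"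
      by (intro tendsto_lowerbound[where F="at_right (0 :: real)"]) simp_all
    then have "t * D \<le> t * (V + 2 * t * D)" by (simp add: power2_eq_square algebra_simps)
    then show ?thesis using t(1) by simp
  qed
  have "((\<lambda>t. V + 2 * t * D) \<longlongrightarrow> V + 2 * 0 * D) (at_right 0)" by (intro tendsto_intros)
  moreover have "\<forall>\<^sub>F t in at_right (0 :: real). D \<le> V + 2 * t * D"
    using eventually_at_right_real[of 0 1] by (auto elim!: eventually_mono intro: *)
  ultimately have "D \<le> V + 2 * 0 * D" by (intro tendsto_lowerbound[where F="at_right (0 :: real)"]) simp_all
  then show ?thesis by simp
qed

lemma near_optimal_plan:
  assumes "wasserstein_pow 2 \<rho> \<mu> < \<infinity>" "\<epsilon> > 0"
  obtains \<gamma> where "\<gamma> \<in> transport_plans \<rho> \<mu>" "quadratic_cost \<gamma> \<le> wasserstein_pow 2 \<rho> \<mu> + ennreal \<epsilon>"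
proof -
  have "0 < ennreal \<epsilon>" using assms(2) by simp
  then have "wasserstein_pow 2 \<rho> \<mu> < wasserstein_pow 2 \<rho> \<mu> + ennreal \<epsilon>"
    using assms(1) ennreal_add_left_cancel_less[of "wasserstein_pow 2 \<rho> \<mu>" 0 "ennreal \<epsilon>"] by simp
  then obtain \<gamma> where "\<gamma> \<in> transport_plans \<rho> \<mu>" "quadratic_cost \<gamma> < wasserstein_pow 2 \<rho> \<mu> + ennreal \<epsilon>"
    unfolding wasserstein_pow_2[of \<rho> \<mu>] INF_less_iff by blast
  then show ?thesis by (intro that[of \<gamma>]) simp_all
qed

lemma wasserstein_pow_finite:
  assumes "\<mu> \<in> prob_measures_p 2 \<Omega>" "\<nu> \<in> prob_measures_p 2 \<Omega>'"
  shows "wasserstein_pow 2 \<mu> \<nu> < \<infinity>"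
proof -
  have plan: "\<mu> \<Otimes>\<^sub>M \<nu> \<in> transport_plans \<mu> \<nu>"
    by (intro transport_plans_nonempty prob_measures_2D[OF assms(1)] prob_measures_2D[OF assms(2)])
  show ?thesis
    by (rule order.strict_trans1[OF wasserstein_pow_le_cost[OF plan] quadratic_cost_finite[OF plan assms]])
qed

lemma wasserstein_pow_projection_le:
  fixes \<Omega> :: "'a::euclidean_space set" and \<mu> \<nu> :: "'a measure"
  assumes \<Omega>: "closed \<Omega>" "convex \<Omega>" "emeasure lborel \<Omega> \<ge> 1"
    and \<mu>: "\<mu> \<in> prob_measures_p 2 \<Omega>" and \<nu>: "\<nu> \<in> prob_measures_p 2 \<Omega>"
    and single: "is_singleton (transport_plans \<mu> \<nu>)"
  shows "wasserstein_pow 2 (density_projection 2 \<Omega> \<mu>) (density_projection 2 \<Omega> \<nu>) \<le> wasserstein_pow 2 \<mu> \<nu>"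
proof -
  define \<rho> \<sigma> where "\<rho> = density_projection 2 \<Omega> \<mu>" and "\<sigma> = density_projection 2 \<Omega> \<nu>"
  note \<rho> = density_projection_minimal[OF \<Omega> \<mu>, folded \<rho>_def]
  note \<sigma> = density_projection_minimal[OF \<Omega> \<nu>, folded \<sigma>_def]
  have \<rho>_P: "\<rho> \<in> prob_measures_p 2 \<Omega>" "sub_lebesgue \<rho>" and \<sigma>_P: "\<sigma> \<in> prob_measures_p 2 \<Omega>" "sub_lebesgue \<sigma>"
    using \<rho>(1) \<sigma>(1) by (simp_all add: bounded_density_measures_iff)
  obtain \<pi> where \<pi>: "\<pi> \<in> transport_plans \<rho> \<sigma>" and \<pi>_le: "\<forall>t\<in>{0..1}. \<forall>A\<in>sets borel.
      emeasure \<pi> {p. (1 - t) *\<^sub>R fst p + t *\<^sub>R snd p \<in> A} \<le> emeasure lborel A"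
    using sub_lebesgue_pair.displacement_coupling[OF sub_lebesgue_pairI[OF \<rho>_P(2) \<sigma>_P(2)]] by (rule bexE)
  \<comment> \<open>With a single plan the one produced by the estimate is the same for all
    \<open>t\<close> and \<open>\<epsilon>\<close>, and its cost is the infimum.\<close>
  obtain \<gamma> where \<gamma>: "transport_plans \<mu> \<nu> = {\<gamma>}" using single by (rule is_singletonE)
  have V: "wasserstein_pow 2 \<mu> \<nu> = quadratic_cost \<gamma>" unfolding wasserstein_pow_2 \<gamma> by simp
  have obtain_real: "\<exists>r. e = ennreal r \<and> 0 \<le> r" if "e < \<infinity>" for e
    using that by (intro exI[of _ "enn2real e"]) simp
  \<comment> \<open>The cancellation of \<open>I + J\<close> happens in the reals, so each of the
    four costs is represented by a finite number.\<close>
  obtain I where I: "wasserstein_pow 2 \<rho> \<mu> = ennreal I" "0 \<le> I"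
    using obtain_real[OF wasserstein_pow_finite[OF \<rho>_P(1) \<mu>]] by blast
  obtain J where J: "wasserstein_pow 2 \<sigma> \<nu> = ennreal J" "0 \<le> J"
    using obtain_real[OF wasserstein_pow_finite[OF \<sigma>_P(1) \<nu>]] by blast
  obtain W where W: "quadratic_cost \<gamma> = ennreal W" "0 \<le> W"
    using obtain_real[OF wasserstein_pow_finite[OF \<mu> \<nu>, unfolded V]] by blast
  obtain D where D: "quadratic_cost \<pi> = ennreal D" "0 \<le> D"
    using obtain_real[OF quadratic_cost_finite[OF \<pi> \<rho>_P(1) \<sigma>_P(1)]] by blast
  note fin = I J W D
  have "D \<le> W"
  proof (rule le_of_le_perturbation)
    fix t \<epsilon> :: real assume t: "0 < t" "t \<le> 1" and \<epsilon>: "0 < \<epsilon>"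
    obtain \<gamma>1 where \<gamma>1: "\<gamma>1 \<in> transport_plans \<rho> \<mu>" "quadratic_cost \<gamma>1 \<le> wasserstein_pow 2 \<rho> \<mu> + ennreal \<epsilon>"
      by (rule near_optimal_plan[OF wasserstein_pow_finite[OF \<rho>_P(1) \<mu>] \<epsilon>]) (rule that)
    obtain \<gamma>2 where \<gamma>2: "\<gamma>2 \<in> transport_plans \<sigma> \<nu>" "quadratic_cost \<gamma>2 \<le> wasserstein_pow 2 \<sigma> \<nu> + ennreal \<epsilon>"
      by (rule near_optimal_plan[OF wasserstein_pow_finite[OF \<sigma>_P(1) \<nu>] \<epsilon>]) (rule that)
    have t': "t \<in> {0..1}" using t by simp
    have "\<exists>\<gamma>\<in>transport_plans \<mu> \<nu>. wasserstein_pow 2 \<rho> \<mu> + wasserstein_pow 2 \<sigma> \<nu> + ennreal t * quadratic_cost \<pi>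
      \<le> ennreal (1 + \<epsilon>) * quadratic_cost \<gamma>1 + ennreal (1 + \<epsilon>) * quadratic_cost \<gamma>2 + ennreal (2 * (\<epsilon> + \<epsilon>\<^sup>2))
        + ennreal t * quadratic_cost \<gamma> + ennreal (2 * t\<^sup>2) * quadratic_cost \<pi>"
      by (rule projection_estimate[OF \<Omega>(1,2) \<rho>(1) \<sigma>(1) _ _ \<gamma>1(1) \<gamma>2(1) \<pi> _ t' \<epsilon>])
        (rule \<rho>(2) \<sigma>(2) \<pi>_le[THEN bspec, THEN bspec]; assumption)+
    then have "ennreal I + ennreal J + ennreal t * ennreal D
      \<le> ennreal (1 + \<epsilon>) * quadratic_cost \<gamma>1 + ennreal (1 + \<epsilon>) * quadratic_cost \<gamma>2 + ennreal (2 * (\<epsilon> + \<epsilon>\<^sup>2))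
        + ennreal t * ennreal W + ennreal (2 * t\<^sup>2) * ennreal D"
      unfolding \<gamma> by (simp only: fin bex_simps singleton_iff) (simp add: fin)
    also have "\<dots> \<le> ennreal (1 + \<epsilon>) * (ennreal I + ennreal \<epsilon>) + ennreal (1 + \<epsilon>) * (ennreal J + ennreal \<epsilon>)
        + ennreal (2 * (\<epsilon> + \<epsilon>\<^sup>2)) + ennreal t * ennreal W + ennreal (2 * t\<^sup>2) * ennreal D"
      using \<gamma>1(2) \<gamma>2(2) unfolding fin by (intro add_mono mult_left_mono order.refl) simp_all
    also have "\<dots> = ennreal ((1 + \<epsilon>) * (I + \<epsilon>) + (1 + \<epsilon>) * (J + \<epsilon>) + 2 * (\<epsilon> + \<epsilon>\<^sup>2) + t * W + 2 * t\<^sup>2 * D)"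
      using t \<epsilon> fin by (simp add: ennreal_plus[symmetric] ennreal_mult[symmetric] del: ennreal_plus)
    also have "ennreal I + ennreal J + ennreal t * ennreal D = ennreal (I + J + t * D)"
      using t \<epsilon> fin by (simp add: ennreal_plus[symmetric] ennreal_mult[symmetric] del: ennreal_plus)
    finally show "I + J + t * D \<le> (1 + \<epsilon>) * (I + \<epsilon>) + (1 + \<epsilon>) * (J + \<epsilon>) + 2 * (\<epsilon> + \<epsilon>\<^sup>2) + t * W + 2 * t\<^sup>2 * D"
      using t \<epsilon> fin by (subst (asm) ennreal_le_iff) simp_all
  qed
  then have "quadratic_cost \<pi> \<le> quadratic_cost \<gamma>" unfolding fin by (rule ennreal_leI)
  then show ?thesis
    unfolding V \<rho>_def[symmetric] \<sigma>_def[symmetric] by (rule order.trans[OF wasserstein_pow_le_cost[OF \<pi>]])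
qed

theorem corollary3p3:
  fixes \<Omega> :: "'a::euclidean_space set" and \<mu> \<nu> :: "'a measure"
  assumes "closed \<Omega>" and "convex \<Omega>" and "emeasure lborel \<Omega> \<ge> 1"
    and "\<mu> \<in> prob_measures_p 2 \<Omega>" and "\<nu> \<in> prob_measures_p 2 \<Omega>"
    and "is_singleton (transport_plans \<mu> \<nu>)"
  shows "wasserstein 2 (density_projection 2 \<Omega> \<mu>) (density_projection 2 \<Omega> \<nu>)
           \<le> wasserstein 2 \<mu> \<nu>"
proof -
  let ?A = "wasserstein_pow 2 (density_projection 2 \<Omega> \<mu>) (density_projection 2 \<Omega> \<nu>)"
  have le: "?A \<le> wasserstein_pow 2 \<mu> \<nu>" by (rule wasserstein_pow_projection_le[OF assms])
  \<comment> \<open>Finiteness selects the branch of \<open>wasserstein\<close> with the root on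
    both sides and makes \<open>enn2real\<close> monotone here.\<close>
  have fin: "wasserstein_pow 2 \<mu> \<nu> < \<infinity>" by (rule wasserstein_pow_finite[OF assms(4,5)])
  then have "?A < \<infinity>" by (rule order.strict_trans1[OF le])
  then show ?thesis
    using fin le unfolding wasserstein_def
    by (auto intro!: ennreal_leI powr_mono2 enn2real_mono)
qed

end
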